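(* Let $\mathcal D\subset\mathbb R^d$ be a bounded domain satisfying the standing assumptions in the context, let $(X_t,V_t)_{t\ge0}$ be the stochastic billiard with reflection density $\bar\gamma$, and let $\chi$ be its invariant probability measure. Let $f:\overline{\mathcal D}\times\mathbb S^{d-1}\to\mathbb R$ be a measurable and bounded function which is centered, that is, $$\int_{\overline{\mathcal D}\times\mathbb S^{d-1}}f(x,v)\,\chi(dx,dv)=0 .$$ Then there is $\sigma_f^2\ge0$ such that, as $t\to\infty$, the random variables $$t^{-1/2}\int_0^tf(X_s,V_s)\,ds$$ converge in distribution to a $\mathrm{Normal}(0,\sigma_f^2)$ random variable.
   Context: Notation: $d\ge 2$; $\|\cdot\|$ is the Euclidean norm, $\mathcal B(x,\varepsilon)$ the open ball, $\mathbb S^{d-1}$ the unit sphere, $e=(1,0,\dots,0)$, and $\mathbb S_v=\{w\in\mathbb S^{d-1}:v\cdot w>0\}$. On $\mathbb S^{d-1}$ we integrate with respect to (unnormalized) surface measure, and $\partial\mathcal D$ carries $(d-1)$-dimensional Hausdorff measure. Standing assumptions on the domain: $\mathcal D\subset\mathbb R^d$ is open and connected, and (Lipschitz condition) for every $x\in\partial\mathcal D$ there exist $\varepsilon_x>0$, an affine isometry $\mathfrak I_x:\mathbb R^d\to\mathbb R^d$ with $\mathfrak I_x x=0$ and a Lipschitz function $f_x:\mathbb R^{d-1}\to\mathbb R$ with $f_x(0)=0$ such that $\mathfrak I_x(\mathcal D\cap\mathcal B(x,\varepsilon_x))=\{z\in\mathcal B(0,\varepsilon_x):z^{(d)}>f_x(z^{(1)},\dots,z^{(d-1)})\}$.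 Moreover there is a relatively open set $\tilde{\mathcal R}\subset\partial\mathcal D$, with $\partial\mathcal D\setminus\tilde{\mathcal R}$ of Hausdorff measure zero, such that $\partial\mathcal D$ has a local $C^1$ parametrization at each point of $\tilde{\mathcal R}$. For $x\in\tilde{\mathcal R}$, $\mathbf n(x)$ is the unit normal vector pointing into $\mathcal D$. Reflection law: $\bar\gamma$ is a probability density on $\mathbb S_e$ with $\inf_{u\in B}\bar\gamma(u)>0$ for every compact $B\subset\mathbb S_e$. $(U_x,x\in\partial\mathcal D)$ is a measurable family of orthogonal linear operators of $\mathbb R^d$ with $U_xe=\mathbf n(x)$ for all $x\in\tilde{\mathcal R}$. Case 1: $\bar\gamma(u)$ depends only on $u\cdot e$; then $\mathcal R:=\tilde{\mathcal R}$. Case 2: otherwise; then $x\mapsto U_x$ is assumed continuous at almost every $x\in\partial\mathcal D$ and $\mathcal R:=\{x\in\tilde{\mathcal R}: x\mapsto U_x\text{ is continuous at }x\}$. Stochastic billiard: for $x\in\tilde{\mathcal R},u\in\mathbb S_{\mathbf n(x)}$ or $x\in\mathcal D,u\in\mathbb S^{d-1}$ let $\mathsf r_x(u)=\inf\{t>0:x+tu\in\partial\mathcal D\}$ and $\mathsf h_x(u)=x+u\,\mathsf r_x(u)$. Let $\eta_0,\eta_1,\dots$ be i.i.d. with density $\bar\gamma$. Started from $\xi_0\in\mathcal R$: $\xi_{n+1}=\mathsf h_{\xi_n}(U_{\xi_n}\eta_n)$, $\tau_0=0$, $\tau_n=\sum_{i=0}^{n-1}\mathsf r_{\xi_i}(U_{\xi_i}\eta_i)$,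 and for $t\in[\tau_n,\tau_{n+1})$, $X_t=\xi_n+(t-\tau_n)U_{\xi_n}\eta_n$ and $V_t=U_{\xi_n}\eta_n$ (almost surely $\xi_n\in\mathcal R$ for all $n$ and $\tau_n\to\infty$). Started from $(x_0,v_0)\in\mathcal D\times\mathbb S^{d-1}$: the particle moves as $X_t=x_0+tv_0$, $V_t=v_0$ up to time $\mathsf r_{x_0}(v_0)$ and then continues as the process just described started from $\mathsf h_{x_0}(v_0)$. The initial condition may be random (independent of the $\eta$'s), provided the first boundary point visited lies in $\mathcal R$ almost surely; otherwise it is arbitrary. The invariant measure $\chi$: it is the unique probability measure on $\mathcal D\times\mathbb S^{d-1}$ to which the law of $(X_t,V_t)$ converges in total variation as $t\to\infty$ (exponentially fast, uniformly in the initial distribution); its existence is known. *)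

theory Defs
  imports "HOL-Probability.Probability"
begin

section \<open>The space, the sphere, Hausdorff measure\<close>

text \<open>
  The space of dimension d is modelled as the product of the space of dimension d - 1 with the
  last coordinate axis, so that Lipschitz graphs and local parametrizations have a domain type.
  Here d is the cardinality of the index type plus one, hence at least 2; the norm of the product
  type is the Euclidean norm. The linear order on the index type only serves to single out the
  first coordinate.
\<close>

type_synonym 'm space = "(real ^ 'm) \<times> real"

definition e1 :: "'m::{finite,linorder} space" where
  "e1 = (axis (Min UNIV) 1, 0)"

abbreviation unit_sphere :: "'a::euclidean_space set" where
  "unit_sphere \<equiv> sphere 0 1"

definition half_sphere :: "'a::euclidean_space \<Rightarrow> 'a set" where
  "half_sphere v = {w \<in> unit_sphere. v \<bullet> w > 0}"

text \<open>
  Unnormalized surface measure of the unit sphere, given by polar coordinates: the mass of A is d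
  times the volume of the cone over A inside the unit ball. It is a measure on the Borel sets of
  the whole space, concentrated on the sphere.
\<close>

definition sphere_measure :: "'a::euclidean_space measure" where
  "sphere_measure =
     scale_measure (of_nat DIM('a)) (distr (restrict_space lborel (ball 0 1 - {0})) borel sgn)"

text \<open>
  Hausdorff (outer) measure of dimension s > 0. Boundedness of the covering sets is required
  because \<^const>\<open>diameter\<close> is only meaningful for bounded sets.
\<close>

definition hausdorff_content :: "real \<Rightarrow> real \<Rightarrow> 'a::metric_space set \<Rightarrow> ennreal" where
  "hausdorff_content s \<delta> A =
     (INF E \<in> {E :: nat \<Rightarrow> 'a set. A \<subseteq> (\<Union>i. E i) \<and> (\<forall>i. bounded (E i) \<and> diameter (E i) \<le> \<delta>)}.
        \<Sum>i. ennreal (unit_ball_vol s * (diameter (E i) / 2) powr s))"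

definition hausdorff_measure :: "real \<Rightarrow> 'a::metric_space set \<Rightarrow> ennreal" where
  "hausdorff_measure s A = (SUP \<delta> \<in> {0<..}. hausdorff_content s \<delta> A)"

definition boundary_null :: "'m::finite space set \<Rightarrow> bool" where
  "boundary_null A \<longleftrightarrow> hausdorff_measure (real CARD('m)) A = 0"


section \<open>The domain\<close>

definition affine_isometry :: "('a::euclidean_space \<Rightarrow> 'a) \<Rightarrow> bool" where
  "affine_isometry I \<longleftrightarrow> (\<exists>T b. orthogonal_transformation T \<and> I = (\<lambda>y. T y + b))"

definition lipschitz_boundary :: "'m::finite space set \<Rightarrow> bool" where
  "lipschitz_boundary D \<longleftrightarrow>
     (\<forall>x \<in> frontier D. \<exists>\<epsilon>>0. \<exists>I. \<exists>f :: real ^ 'm \<Rightarrow> real. \<exists>L.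
        affine_isometry I \<and> I x = 0 \<and> L-lipschitz_on UNIV f \<and> f 0 = 0 \<and>
        I ` (D \<inter> ball x \<epsilon>) = {z \<in> ball 0 \<epsilon>. snd z > f (fst z)})"

text \<open>
  A (regular) C1 parametrization of a relatively open piece of a hypersurface S: an injective C1
  immersion of an open set W that is a homeomorphism onto a relatively open subset of S.
\<close>

definition C1_parametrization ::
  "'m::finite space set \<Rightarrow> (real ^ 'm) set \<Rightarrow> (real ^ 'm \<Rightarrow> 'm space)
     \<Rightarrow> (real ^ 'm \<Rightarrow> (real ^ 'm) \<Rightarrow>\<^sub>L 'm space) \<Rightarrow> bool" where
  "C1_parametrization S W \<phi> \<phi>' \<longleftrightarrow>
     open W \<and>
     (\<forall>w \<in> W. (\<phi> has_derivative blinfun_apply (\<phi>' w)) (at w)) \<and>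
     continuous_on W \<phi>' \<and>
     (\<forall>w \<in> W. inj (blinfun_apply (\<phi>' w))) \<and>
     openin (top_of_set S) (\<phi> ` W) \<and>
     (\<exists>\<psi>. homeomorphism W (\<phi> ` W) \<phi> \<psi>)"

definition C1_at :: "'m::finite space set \<Rightarrow> 'm space \<Rightarrow> bool" where
  "C1_at S x \<longleftrightarrow> (\<exists>W \<phi> \<phi>'. C1_parametrization S W \<phi> \<phi>' \<and> x \<in> \<phi> ` W)"

definition inward_unit_normal :: "'m::finite space set \<Rightarrow> 'm space \<Rightarrow> 'm space \<Rightarrow> bool" where
  "inward_unit_normal D x n \<longleftrightarrow>
     norm n = 1 \<and>
     (\<exists>W \<phi> \<phi>' w. C1_parametrization (frontier D) W \<phi> \<phi>' \<and> w \<in> W \<and> \<phi> w = x \<and>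
        (\<forall>h. n \<bullet> blinfun_apply (\<phi>' w) h = 0)) \<and>
     (\<exists>\<delta>>0. \<forall>s \<in> {0<..<\<delta>}. x + s *\<^sub>R n \<in> D)"

locale billiard_domain =
  fixes D Rt :: "'m::{finite,linorder} space set"
  assumes open_domain: "open D"
    and connected_domain: "connected D"
    and lipschitz: "lipschitz_boundary D"
    and smooth_part_open: "openin (top_of_set (frontier D)) Rt"
    and smooth_part_full: "boundary_null (frontier D - Rt)"
    and smooth_part: "\<And>x. x \<in> Rt \<Longrightarrow> C1_at (frontier D) x"


section \<open>The reflection law\<close>

definition rotation_symmetric :: "('m::{finite,linorder} space \<Rightarrow> real) \<Rightarrow> bool" where
  "rotation_symmetric \<gamma> \<longleftrightarrow> (\<exists>g. \<forall>u \<in> half_sphere e1. \<gamma> u = g (u \<bullet> e1))"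

text \<open>Only the values of the density on the open half-sphere around \<open>e1\<close> are meaningful.\<close>

definition reflection_measure ::
  "('m::{finite,linorder} space \<Rightarrow> real) \<Rightarrow> 'm space measure" where
  "reflection_measure \<gamma> =
     density sphere_measure (\<lambda>u. ennreal (indicator (half_sphere e1) u * \<gamma> u))"

text \<open>Continuity of the family at a boundary point is continuity along the boundary,
  in operator norm.\<close>

definition U_continuous_at ::
  "'m::finite space set \<Rightarrow> ('m space \<Rightarrow> 'm space \<Rightarrow>\<^sub>L 'm space) \<Rightarrow> 'm space \<Rightarrow> bool" where
  "U_continuous_at D U x \<longleftrightarrow> continuous (at x within frontier D) U"

locale billiard = billiard_domain D Rt
  for D Rt :: "'m::{finite,linorder} space set" +
  fixes \<gamma> :: "'m space \<Rightarrow> real"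
    and U :: "'m space \<Rightarrow> 'm space \<Rightarrow>\<^sub>L 'm space"
  assumes density_measurable: "\<gamma> \<in> borel_measurable (restrict_space borel (half_sphere e1))"
    and density_nonneg: "\<And>u. u \<in> half_sphere e1 \<Longrightarrow> \<gamma> u \<ge> 0"
    and density_prob: "prob_space (reflection_measure \<gamma>)"
    and density_pos: "\<And>B. compact B \<Longrightarrow> B \<noteq> {} \<Longrightarrow> B \<subseteq> half_sphere e1 \<Longrightarrow> (INF u\<in>B. \<gamma> u) > 0"
    and U_measurable: "U \<in> borel_measurable (restrict_space borel (frontier D))"
    and U_orthogonal: "\<And>x. x \<in> frontier D \<Longrightarrow> orthogonal_transformation (blinfun_apply (U x))"
    and U_normal: "\<And>x. x \<in> Rt \<Longrightarrow> inward_unit_normal D x (blinfun_apply (U x) e1)"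
    and U_continuous: "\<not> rotation_symmetric \<gamma> \<Longrightarrow>
          boundary_null {x \<in> frontier D. \<not> U_continuous_at D U x}"

definition regular_points ::
  "'m::{finite,linorder} space set \<Rightarrow> 'm space set \<Rightarrow> ('m space \<Rightarrow> real)
     \<Rightarrow> ('m space \<Rightarrow> 'm space \<Rightarrow>\<^sub>L 'm space) \<Rightarrow> 'm space set" where
  "regular_points D Rt \<gamma> U =
     (if rotation_symmetric \<gamma> then Rt else {x \<in> Rt. U_continuous_at D U x})"


section \<open>Trajectories\<close>

definition exit_time :: "'a::euclidean_space set \<Rightarrow> 'a \<Rightarrow> 'a \<Rightarrow> real" where
  "exit_time D x u = Inf {t. t > 0 \<and> x + t *\<^sub>R u \<in> frontier D}"

definition exit_point :: "'a::euclidean_space set \<Rightarrow> 'a \<Rightarrow> 'a \<Rightarrow> 'a" where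
  "exit_point D x u = x + exit_time D x u *\<^sub>R u"

text \<open>
  The following are deterministic functionals of the starting point and of the sequence \<open>u\<close> of
  directions drawn at the successive reflections.
\<close>

primrec hit_point ::
  "'a::euclidean_space set \<Rightarrow> ('a \<Rightarrow> 'a \<Rightarrow>\<^sub>L 'a) \<Rightarrow> 'a \<Rightarrow> (nat \<Rightarrow> 'a) \<Rightarrow> nat \<Rightarrow> 'a" where
  "hit_point D U x u 0 = x"
| "hit_point D U x u (Suc n) =
     exit_point D (hit_point D U x u n) (blinfun_apply (U (hit_point D U x u n)) (u n))"

definition out_velocity ::
  "'a::euclidean_space set \<Rightarrow> ('a \<Rightarrow> 'a \<Rightarrow>\<^sub>L 'a) \<Rightarrow> 'a \<Rightarrow> (nat \<Rightarrow> 'a) \<Rightarrow> nat \<Rightarrow> 'a" where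
  "out_velocity D U x u n = blinfun_apply (U (hit_point D U x u n)) (u n)"

definition hit_time ::
  "'a::euclidean_space set \<Rightarrow> ('a \<Rightarrow> 'a \<Rightarrow>\<^sub>L 'a) \<Rightarrow> 'a \<Rightarrow> (nat \<Rightarrow> 'a) \<Rightarrow> nat \<Rightarrow> real" where
  "hit_time D U x u n = (\<Sum>i<n. exit_time D (hit_point D U x u i) (out_velocity D U x u i))"

definition boundary_state ::
  "'a::euclidean_space set \<Rightarrow> ('a \<Rightarrow> 'a \<Rightarrow>\<^sub>L 'a) \<Rightarrow> 'a \<Rightarrow> (nat \<Rightarrow> 'a) \<Rightarrow> real \<Rightarrow> 'a \<times> 'a" where
  "boundary_state D U x u t =
     (let n = (THE n. hit_time D U x u n \<le> t \<and> t < hit_time D U x u (Suc n)) in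
        (hit_point D U x u n + (t - hit_time D U x u n) *\<^sub>R out_velocity D U x u n,
         out_velocity D U x u n))"

text \<open>
  An initial condition is a pair \<open>(x, v)\<close>; the velocity \<open>v\<close> is ignored if \<open>x\<close> is a boundary point.
\<close>

definition first_boundary_point :: "'a::euclidean_space set \<Rightarrow> 'a \<times> 'a \<Rightarrow> 'a" where
  "first_boundary_point D = (\<lambda>(x, v). if x \<in> D then exit_point D x v else x)"

definition billiard_state ::
  "'a::euclidean_space set \<Rightarrow> ('a \<Rightarrow> 'a \<Rightarrow>\<^sub>L 'a) \<Rightarrow> 'a \<times> 'a \<Rightarrow> (nat \<Rightarrow> 'a) \<Rightarrow> real \<Rightarrow> 'a \<times> 'a" where
  "billiard_state D U = (\<lambda>(x, v) u t.
     if x \<in> D then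
       (if t < exit_time D x v then (x + t *\<^sub>R v, v)
        else boundary_state D U (exit_point D x v) u (t - exit_time D x v))
     else boundary_state D U x u t)"


section \<open>The stochastic billiard\<close>

definition stochastic_billiard ::
  "'m::{finite,linorder} space set \<Rightarrow> 'm space set \<Rightarrow> ('m space \<Rightarrow> real)
     \<Rightarrow> ('m space \<Rightarrow> 'm space \<Rightarrow>\<^sub>L 'm space)
     \<Rightarrow> 'w measure \<Rightarrow> ('w \<Rightarrow> 'm space \<times> 'm space) \<Rightarrow> (nat \<Rightarrow> 'w \<Rightarrow> 'm space) \<Rightarrow> bool" where
  "stochastic_billiard D Rt \<gamma> U P Z0 \<eta> \<longleftrightarrow>
     prob_space P \<and>
     prob_space.indep_vars P (\<lambda>_. borel) \<eta> UNIV \<and>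
     (\<forall>n. distr P borel (\<eta> n) = reflection_measure \<gamma>) \<and>
     Z0 \<in> borel_measurable P \<and>
     prob_space.indep_set P
       (sets (vimage_algebra (space P) Z0 borel))
       (sets (vimage_algebra (space P) (\<lambda>\<omega> n. \<eta> n \<omega>) (PiM UNIV (\<lambda>_. borel)))) \<and>
     (AE \<omega> in P. Z0 \<omega> \<in> D \<times> unit_sphere \<or> fst (Z0 \<omega>) \<in> frontier D) \<and>
     (AE \<omega> in P. first_boundary_point D (Z0 \<omega>) \<in> regular_points D Rt \<gamma> U)"

definition billiard_process ::
  "'m::finite space set \<Rightarrow> ('m space \<Rightarrow> 'm space \<Rightarrow>\<^sub>L 'm space) \<Rightarrow> ('w \<Rightarrow> 'm space \<times> 'm space)
     \<Rightarrow> (nat \<Rightarrow> 'w \<Rightarrow> 'm space) \<Rightarrow> real \<Rightarrow> 'w \<Rightarrow> 'm space \<times> 'm space" where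
  "billiard_process D U Z0 \<eta> t \<omega> = billiard_state D U (Z0 \<omega>) (\<lambda>n. \<eta> n \<omega>) t"

text \<open>
  The trajectory is meaningful only outside a null set of sample points, and may depend on the
  sample point in a non-measurable way inside it (the functions \<open>U\<close> and \<open>f\<close> are unconstrained
  outside their domains). Laws are therefore taken with respect to the completed probability.
\<close>

definition law :: "'w measure \<Rightarrow> ('w \<Rightarrow> 'b::topological_space) \<Rightarrow> 'b measure" where
  "law P Y = distr (completion P) borel Y"


section \<open>The invariant measure\<close>

definition total_variation :: "'b measure \<Rightarrow> 'b measure \<Rightarrow> real" where
  "total_variation M N = (SUP A \<in> sets N. \<bar>measure M A - measure N A\<bar>)"

text \<open>
  The constants do not depend on the initial distribution. The sample space is fixed to the type
  of pairs consisting of an initial condition and a sequence of directions; every stochastic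
  billiard has the same law as one defined on a probability space over this type.
\<close>

definition invariant_measure ::
  "'m::{finite,linorder} space set \<Rightarrow> 'm space set \<Rightarrow> ('m space \<Rightarrow> real)
     \<Rightarrow> ('m space \<Rightarrow> 'm space \<Rightarrow>\<^sub>L 'm space) \<Rightarrow> ('m space \<times> 'm space) measure \<Rightarrow> bool" where
  "invariant_measure D Rt \<gamma> U chi \<longleftrightarrow>
     prob_space chi \<and> sets chi = sets borel \<and> emeasure chi (D \<times> unit_sphere) = 1 \<and>
     (\<exists>C>0. \<exists>c>0.
        \<forall>(P :: (('m space \<times> 'm space) \<times> (nat \<Rightarrow> 'm space)) measure) Z0 \<eta>.
          stochastic_billiard D Rt \<gamma> U P Z0 \<eta> \<longrightarrow>
          (\<forall>t\<ge>0. total_variation (law P (billiard_process D U Z0 \<eta> t)) chi \<le> C * exp (- c * t)))"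


section \<open>Convergence in distribution\<close>

definition normal_law :: "real \<Rightarrow> real measure" where
  "normal_law v =
     (if v = 0 then return borel 0 else density lborel (normal_density 0 (sqrt v)))"

text \<open>The continuous-time analogue of \<^const>\<open>weak_conv_m\<close>.\<close>

definition converges_in_law :: "(real \<Rightarrow> real measure) \<Rightarrow> real measure \<Rightarrow> bool" where
  "converges_in_law M N \<longleftrightarrow>
     (\<forall>x. isCont (cdf N) x \<longrightarrow> ((\<lambda>t. cdf (M t) x) \<longlongrightarrow> cdf N x) at_top)"

end

theory Submission
  imports Defs
begin

text \<open>
  Almost surely all reflections take place at regular points, because the cone over a set of
  Hausdorff measure zero is Lebesgue negligible and because near a regular point the boundary stays
  outside a convex cone around the normal, so that reflected rays enter the domain. The reflection
  times cannot accumulate, since the position would otherwise leave the bounded domain, where the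
  limit \<open>chi\<close> of its law is carried. The state in flight is therefore a Markov process that mixes
  exponentially fast in total variation, uniformly in the starting state.

  Let \<open>A\<close> be the integral of \<open>f\<close> over one unit of time and let \<open>T w\<close> map \<open>z\<close> to the mean of
  \<open>exp (\<i> \<epsilon> A) w\<close>, with \<open>w\<close> evaluated at the state at time 1. Mixing yields bounded solutions \<open>g\<close>, \<open>k\<close>
  of two Poisson equations for which \<open>w = 1 + \<i> \<epsilon> g - \<epsilon>\<^sup>2 k\<close> satisfies
  \<open>T w = exp (- \<epsilon>\<^sup>2 v / 2) w + O(\<epsilon>\<^sup>3)\<close> uniformly. With \<open>\<epsilon> = \<theta> / sqrt t\<close> and about \<open>t\<close> iterations this
  gives the convergence of characteristic functions to that of the normal law, and \<open>v\<close> is nonnegative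
  because characteristic functions are bounded by 1.
\<close>

section \<open>Geometry of a single flight\<close>

text \<open>The mixing hypothesis speaks of continuous time and total variation only, so the
  argument follows the flying particle rather than the chain of reflection points: twisted
  transition operators on bounded functions require no regeneration structure. What is known of
  \<open>chi\<close> is that laws converge to it, so the \<open>chi\<close>-mean of the time
  integral of \<open>f\<close> is computed as a limit along the motion. Two difficulties shape the
  setup. The hypothesis covers interior starts and boundary starts with a freshly drawn velocity,
  whereas at a fixed time the particle may sit on the boundary with a given velocity; such states
  belong to \<open>in_flight\<close> and are pushed a little way along their leg before mixing is
  applied. And the absence of accumulating reflections has to be extracted from mixing itself, so
  for interior starts the billiard is matched with its legs even on paths that might accumulate,
  junk index included. With \<epsilon> of order \<open>1 / sqrt t\<close>, an error of third order
  per step adds up to order \<open>1 / sqrt t\<close> over \<open>t\<close> steps, whereas one of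
  second order would not vanish; hence the two correctors.\<close>

text \<open>Over a piece of \<open>N\<close> of diameter \<delta>, let the factor \<open>r\<close>
  advance in steps of size \<delta>: about \<open>K / \<delta>\<close> balls of radius of order
  \<delta> cover the cone. In dimension \<open>m + 1\<close> their total volume is of order
  \<open>\<delta> ^ m\<close>, which is the corresponding term of the Hausdorff sum.\<close>

lemma negligible_bounded_cone_over_boundary_null:
  fixes N :: "'m::finite space set"
  assumes null: "boundary_null N" and K: "K > 0"
  shows "negligible {r *\<^sub>R (y - x) |r y. 0 \<le> r \<and> r \<le> K \<and> y \<in> N \<and> norm (y - x) \<le> K}"
    (is "negligible ?C")
  unfolding negligible_outer_le
proof (intro allI impI)
  fix e :: real
  assume e: "e > 0"
  define m where "m = CARD('m)"
  have m: "m > 0" by (simp add: m_def)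
  define V where "V = unit_ball_vol (real (Suc m))"
  define b where "b = unit_ball_vol (real m) / 2 ^ m"
  define c where "c = 2 * K + 2"
  define B where "B = (K + 2) * V * c ^ Suc m"
  have V: "V > 0" by (simp add: V_def)
  have b: "b > 0" by (simp add: b_def)
  have c: "c > 0" using K by (simp add: c_def)
  have B: "B > 0" using K V c by (simp add: B_def)
  \<comment> \<open>Scale 1 is enough: the content is dominated by the vanishing measure, and
    diameters at most 1 allow the rounding of the number of balls to be absorbed in
    \<open>2 / \<delta> i\<close>.\<close>
  have "hausdorff_content (real m) 1 N \<le> hausdorff_measure (real m) N"
    unfolding hausdorff_measure_def by (intro SUP_upper) auto
  also have "\<dots> = 0" using null by (simp add: boundary_null_def m_def)
  \<comment> \<open>The factor \<open>B / b\<close> converts the Hausdorff sum into volume, so this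
    threshold costs \<open>e / 2\<close>; the enlargement \<open>\<eta>\<close> of the diameters
    costs the other half.\<close>
  also have "\<dots> < ennreal (e * b / (2 * B))" using e b B by simp
  finally obtain E :: "nat \<Rightarrow> 'm space set" where
    E: "N \<subseteq> (\<Union>i. E i)" "\<And>i. bounded (E i)" "\<And>i. diameter (E i) \<le> 1"
    and Esum: "(\<Sum>i. ennreal (unit_ball_vol (real m) * (diameter (E i) / 2) powr real m))
                < ennreal (e * b / (2 * B))"
    unfolding hausdorff_content_def INF_less_iff by auto
  have diam: "unit_ball_vol (real m) * (diameter (E i) / 2) powr real m = b * diameter (E i) ^ m" for i
    using diameter_ge_0[OF E(2)[of i]] m
    by (simp add: powr_realpow' b_def power_divide)
  \<comment> \<open>Enlarged diameters, to cover the segments over sets of diameter 0 as well.\<close>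
  define \<eta> where "\<eta> i = min 1 (e / (2 * B) * (1 / 2) ^ Suc i)" for i
  define \<delta> where "\<delta> i = max (diameter (E i)) (\<eta> i)" for i
  have \<eta>: "0 < \<eta> i" "\<eta> i \<le> 1" "\<eta> i \<le> e / (2 * B) * (1 / 2) ^ Suc i" for i
    using e B by (auto simp: \<eta>_def)
  have \<delta>: "0 < \<delta> i" "\<delta> i \<le> 1" "diameter (E i) \<le> \<delta> i" for i
    using \<eta>[of i] E(3)[of i] by (auto simp: \<delta>_def)
  have \<delta>m: "\<delta> i ^ m \<le> diameter (E i) ^ m + \<eta> i" for i
  proof -
    have "\<eta> i ^ m \<le> \<eta> i ^ 1" using m \<eta>[of i] by (intro power_decreasing) auto
    moreover have "0 \<le> diameter (E i) ^ m" using diameter_ge_0[OF E(2)] by simp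
    ultimately show ?thesis using \<eta>(1)[of i] by (auto simp: \<delta>_def max_def)
  qed
  define p where "p i = (SOME y. y \<in> E i \<and> norm (y - x) \<le> K)" for i
  define J where "J i = nat \<lceil>K / \<delta> i\<rceil>" for i
  define Q where "Q i j = cball ((real j * \<delta> i) *\<^sub>R (p i - x)) (c * \<delta> i)" for i j
  define T where "T = (\<Union>i. \<Union>j\<in>{..J i}. Q i j)"
  have sub: "?C \<subseteq> T"
  proof
    fix z assume "z \<in> ?C"
    then obtain r y where z: "z = r *\<^sub>R (y - x)" and r: "0 \<le> r" "r \<le> K" and y: "y \<in> N" "norm (y - x) \<le> K"
      by auto
    obtain i where i: "y \<in> E i" using E(1) y(1) by auto
    have pi: "p i \<in> E i" "norm (p i - x) \<le> K"
      using someI[of "\<lambda>y. y \<in> E i \<and> norm (y - x) \<le> K" y] i y by (auto simp: p_def)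
    define j where "j = nat \<lfloor>r / \<delta> i\<rfloor>"
    have q: "0 \<le> r / \<delta> i" "r / \<delta> i \<le> K / \<delta> i" using r \<delta>(1)[of i] by (auto intro: divide_right_mono)
    have jJ: "j \<le> J i" using q unfolding j_def J_def by linarith
    have "real j \<le> r / \<delta> i" "r / \<delta> i \<le> real j + 1" using q unfolding j_def by linarith+
    then have jr: "real j * \<delta> i \<le> r" "r - real j * \<delta> i \<le> \<delta> i"
      using \<delta>(1)[of i] by (auto simp: field_simps)
    have yp: "norm (y - p i) \<le> \<delta> i"
      using diameter_bounded_bound[OF E(2) i pi(1)] \<delta>(3)[of i] by (simp add: dist_norm)
    have "z - (real j * \<delta> i) *\<^sub>R (p i - x) = (r - real j * \<delta> i) *\<^sub>R (y - x) + (real j * \<delta> i) *\<^sub>R (y - p i)"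
      by (simp add: z algebra_simps)
    then have "norm (z - (real j * \<delta> i) *\<^sub>R (p i - x))
        \<le> \<bar>r - real j * \<delta> i\<bar> * norm (y - x) + \<bar>real j * \<delta> i\<bar> * norm (y - p i)"
      by (metis norm_scaleR norm_triangle_ineq)
    also have "\<dots> \<le> \<delta> i * K + K * \<delta> i"
      using jr y yp r \<delta>(1)[of i] K by (intro add_mono mult_mono) auto
    also have "\<dots> \<le> c * \<delta> i" using \<delta>(1)[of i] by (simp add: c_def algebra_simps)
    finally have "z \<in> Q i j" by (simp add: Q_def dist_norm norm_minus_commute)
    then show "z \<in> T" using jJ by (auto simp: T_def)
  qed
  have Qm: "emeasure lborel (\<Union>j\<in>{..J i}. Q i j) \<le> ennreal (B * \<delta> i ^ m)" for i
  proof -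
    have "emeasure lborel (\<Union>j\<in>{..J i}. Q i j) \<le> (\<Sum>j\<in>{..J i}. emeasure lborel (Q i j))"
      by (intro emeasure_subadditive_finite) (auto simp: Q_def)
    also have "\<dots> = (\<Sum>j\<in>{..J i}. ennreal (V * (c * \<delta> i) ^ Suc m))"
      using c \<delta>(1)[of i] by (intro sum.cong) (auto simp: Q_def emeasure_cball V_def m_def add.commute)
    also have "\<dots> = ennreal (real (Suc (J i)) * (V * (c * \<delta> i) ^ Suc m))"
      using V c \<delta>(1)[of i] by (subst sum_ennreal) auto
    also have "\<dots> \<le> ennreal (B * \<delta> i ^ m)"
    proof (rule ennreal_leI)
      have "real (J i) \<le> K / \<delta> i + 1" using K \<delta>(1)[of i] by (simp add: J_def)
      then have "real (Suc (J i)) \<le> K / \<delta> i + 2 / \<delta> i"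
        using \<delta>(1,2)[of i] by (simp add: field_simps)
      then have "real (Suc (J i)) * \<delta> i \<le> K + 2" using \<delta>(1)[of i] by (simp add: field_simps)
      then have "real (Suc (J i)) * \<delta> i * (V * c ^ Suc m * \<delta> i ^ m) \<le> (K + 2) * (V * c ^ Suc m * \<delta> i ^ m)"
        using V c \<delta>(1)[of i] by (intro mult_right_mono) auto
      then show "real (Suc (J i)) * (V * (c * \<delta> i) ^ Suc m) \<le> B * \<delta> i ^ m"
        by (simp add: B_def power_mult_distrib algebra_simps)
    qed
    finally show ?thesis .
  qed
  have comb: "ennreal p * ennreal q + ennreal r * ennreal s = ennreal (p * q + r * s)"
    if "0 \<le> p" "0 \<le> q" "0 \<le> r" "0 \<le> s" for p q r s
    using that by (simp add: ennreal_mult)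
  have "emeasure lborel T \<le> (\<Sum>i. emeasure lborel (\<Union>j\<in>{..J i}. Q i j))"
    unfolding T_def by (intro emeasure_subadditive_countably) (auto simp: Q_def)
  also have "\<dots> \<le> (\<Sum>i. ennreal (B / b) * ennreal (b * diameter (E i) ^ m) + ennreal (e / 2) * ennreal ((1 / 2) ^ Suc i))"
  proof (intro suminf_le order_trans[OF Qm])
    fix i
    have "B * \<delta> i ^ m \<le> B * (diameter (E i) ^ m + e / (2 * B) * (1 / 2) ^ Suc i)"
      using \<delta>m[of i] \<eta>(3)[of i] B by (intro mult_left_mono) auto
    also have "\<dots> = B / b * (b * diameter (E i) ^ m) + e / 2 * (1 / 2) ^ Suc i"
      using B b by (simp add: field_simps)
    finally have le: "B * \<delta> i ^ m \<le> B / b * (b * diameter (E i) ^ m) + e / 2 * (1 / 2) ^ Suc i" .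
    have eq: "ennreal (B / b) * ennreal (b * diameter (E i) ^ m) + ennreal (e / 2) * ennreal ((1 / 2) ^ Suc i)
        = ennreal (B / b * (b * diameter (E i) ^ m) + e / 2 * (1 / 2) ^ Suc i)"
      using B b e diameter_ge_0[OF E(2)[of i]] by (intro comb) simp_all
    show "ennreal (B * \<delta> i ^ m) \<le> ennreal (B / b) * ennreal (b * diameter (E i) ^ m) + ennreal (e / 2) * ennreal ((1 / 2) ^ Suc i)"
      unfolding eq using le by (rule ennreal_leI)
  qed auto
  also have "\<dots> = ennreal (B / b) * (\<Sum>i. ennreal (b * diameter (E i) ^ m)) + ennreal (e / 2) * (\<Sum>i. ennreal ((1 / 2) ^ Suc i))"
    by (subst suminf_add[symmetric]) (auto simp: ennreal_suminf_cmult)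
  also have "(\<Sum>i. ennreal ((1 / 2) ^ Suc i)) = ennreal 1"
    using power_half_series by (intro suminf_ennreal_eq) auto
  also have "ennreal (B / b) * (\<Sum>i. ennreal (b * diameter (E i) ^ m)) + ennreal (e / 2) * ennreal 1
      \<le> ennreal (B / b) * ennreal (e * b / (2 * B)) + ennreal (e / 2) * ennreal 1"
    using Esum unfolding diam by (intro add_mono mult_left_mono) auto
  also have "\<dots> = ennreal e"
    using B b e by (subst comb) simp_all
  finally have le: "emeasure lborel T \<le> ennreal e" .
  have Tb: "T \<in> sets borel" by (auto simp: T_def Q_def)
  then have Tl: "emeasure lebesgue T \<le> ennreal e" using le by simp
  have "T \<in> lmeasurable"
    using Tb Tl by (intro fmeasurableI) (auto simp: less_top[symmetric] top_unique)
  moreover have "measure lebesgue T \<le> e"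
    using Tl e by (simp add: measure_def enn2real_leI)
  ultimately show "\<exists>T. ?C \<subseteq> T \<and> T \<in> lmeasurable \<and> measure lebesgue T \<le> e" using sub by blast
qed

text \<open>Such a \<open>p\<close> is the multiple \<open>1 / s\<close> of the vector from
  \<open>x\<close> to the point of \<open>N\<close> that is hit; countably many bounds exhaust all
  factors and all distances.\<close>

lemma negligible_cone_over_boundary_null:
  fixes N :: "'m::finite space set"
  assumes "boundary_null N"
  shows "negligible {p. \<exists>s>0. x + s *\<^sub>R p \<in> N}"
proof -
  let ?S = "\<lambda>k. {r *\<^sub>R (y - x) |r y. 0 \<le> r \<and> r \<le> real (Suc k) \<and> y \<in> N \<and> norm (y - x) \<le> real (Suc k)}"
  have "{p. \<exists>s>0. x + s *\<^sub>R p \<in> N} \<subseteq> (\<Union>k. ?S k)"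
  proof safe
    fix p s assume s: "(s::real) > 0" "x + s *\<^sub>R p \<in> N"
    obtain k :: nat where k: "max (1 / s) (norm (s *\<^sub>R p)) \<le> real k" using real_arch_simple by blast
    have "p = (1 / s) *\<^sub>R ((x + s *\<^sub>R p) - x)" using s by simp
    moreover have "1 / s \<le> real (Suc k)" "norm ((x + s *\<^sub>R p) - x) \<le> real (Suc k)" "0 \<le> 1 / s"
      using k s by auto
    ultimately show "p \<in> (\<Union>k. ?S k)" using s by blast
  qed
  moreover have "negligible (\<Union>k. ?S k)"
  proof (rule negligible_countable_Union)
    fix S assume "S \<in> range ?S"
    then obtain k where S: "S = ?S k" by blast
    show "negligible S"
      unfolding S by (rule negligible_bounded_cone_over_boundary_null[OF assms]) simp
  qed (rule countable_image, rule countableI_type)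
  ultimately show ?thesis by (rule negligible_subset[rotated])
qed

lemma negligible_vimage_orthogonal:
  fixes T :: "'a::euclidean_space \<Rightarrow> 'a"
  assumes T: "orthogonal_transformation T" and "negligible S"
  shows "negligible (T -` S)"
proof -
  have "T -` S = inv T ` S"
    using orthogonal_transformation_bij[OF T] by (simp add: bij_vimage_eq_inv_image)
  moreover have "linear (inv T)"
    by (rule orthogonal_transformation_linear[OF orthogonal_transformation_inv[OF T]])
  then have "(inv T) differentiable_on S"
    by (intro linear_imp_differentiable_on)
  ultimately show ?thesis
    using negligible_differentiable_image_negligible[of S "inv T"] assms(2) by simp
qed

text \<open>Since \<open>sphere_measure\<close> is a multiple of the image of volume under radial
  projection, a set of directions is null once its cone is. This is the bridge from Hausdorff null
  sets of boundary points to null sets of directions.\<close>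

lemma AE_sphere_measureI:
  fixes Pr :: "'a::euclidean_space \<Rightarrow> bool"
  assumes "Measurable.pred borel Pr" and "negligible {p. p \<noteq> 0 \<and> \<not> Pr (sgn p)}"
  shows "AE u in sphere_measure. Pr u"
proof -
  let ?B = "restrict_space lborel (ball 0 1 - {0}) :: 'a measure" and ?E = "{p. p \<noteq> 0 \<and> \<not> Pr (sgn p)}"
  have sgn: "sgn \<in> ?B \<rightarrow>\<^sub>M borel"
    unfolding sgn_div_norm by (intro measurable_restrict_space1) simp
  have "AE p in lebesgue. p \<notin> ?E"
    using assms(2) unfolding negligible_iff_null_sets by (rule AE_not_in)
  then have "AE p in lborel. p \<notin> ?E" unfolding AE_completion_iff .
  then have "AE p in ?B. Pr (sgn p)" by (subst AE_restrict_space_iff) auto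
  then have "AE u in distr ?B borel sgn. Pr u"
    using sgn assms(1) by (subst AE_distr_iff) auto
  then obtain N where "{u \<in> space (distr ?B borel sgn). \<not> Pr u} \<subseteq> N"
      "emeasure (distr ?B borel sgn) N = 0" "N \<in> sets (distr ?B borel sgn)"
    by (rule AE_E)
  then show ?thesis
    unfolding sphere_measure_def by (intro AE_I[where N = N]) (auto simp: space_scale_measure)
qed

text \<open>The normal condition provides points of \<open>D\<close> along \<open>n\<close> only. By
  differentiability, boundary points near \<open>x\<close> make a small angle with the tangent
  space, so a cone around \<open>n\<close> that contains the direction \<open>v\<close> is free of
  them near \<open>x\<close>; a segment inside this cone that starts on the normal cannot leave
  \<open>D\<close>.\<close>

lemma inward_ray_enters_domain:
  assumes D: "open D" and n: "inward_unit_normal D x n" and v: "norm v = 1" "v \<bullet> n > 0"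
  shows "\<exists>\<delta>>0. \<forall>s\<in>{0<..<\<delta>}. x + s *\<^sub>R v \<in> D"
proof -
  from n obtain W \<phi> \<phi>' w \<delta> where n1: "norm n = 1"
    and par: "C1_parametrization (frontier D) W \<phi> \<phi>'" and w: "w \<in> W" "\<phi> w = x"
    and orth: "\<And>h. n \<bullet> blinfun_apply (\<phi>' w) h = 0"
    and \<delta>: "\<delta> > 0" "\<And>s. s \<in> {0<..<\<delta>} \<Longrightarrow> x + s *\<^sub>R n \<in> D"
    unfolding inward_unit_normal_def by blast
  from par w obtain \<psi> where der: "(\<phi> has_derivative blinfun_apply (\<phi>' w)) (at w)"
    and inj: "inj (blinfun_apply (\<phi>' w))"
    and op: "openin (top_of_set (frontier D)) (\<phi> ` W)"
    and hom: "homeomorphism W (\<phi> ` W) \<phi> \<psi>"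
    unfolding C1_parametrization_def by blast
  \<comment> \<open>Half of the cosine between \<open>v\<close> and \<open>n\<close>, so that the
    segments below satisfy the cone condition strictly.\<close>
  define \<kappa> where "\<kappa> = (v \<bullet> n) / 2"
  have \<kappa>: "\<kappa> > 0" "\<kappa> \<le> 1 / 2"
    using v n1 norm_cauchy_schwarz[of v n] by (auto simp: \<kappa>_def)
  have "linear (blinfun_apply (\<phi>' w))"
    by (rule bounded_linear.linear[OF blinfun.bounded_linear_right])
  then obtain B where B: "B > 0" "\<And>h. B * norm h \<le> norm (blinfun_apply (\<phi>' w) h)"
    using linear_inj_bounded_below_pos[OF _ inj] by blast
  \<comment> \<open>As \<open>B\<close> bounds the derivative from below, this tolerance turns an
    error relative to \<open>norm (w' - w)\<close> into one relative to
    \<open>norm (\<phi> w' - x)\<close> with constant \<open>\<kappa>\<close>.\<close>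
  obtain d where d: "d > 0" "\<And>w'. norm (w' - w) < d \<Longrightarrow>
      norm (\<phi> w' - \<phi> w - blinfun_apply (\<phi>' w) (w' - w)) \<le> (\<kappa> * B / 2) * norm (w' - w)"
    using der[unfolded has_derivative_at_alt, THEN conjunct2, rule_format, of "\<kappa> * B / 2"] B \<kappa> by auto
  have tangent: "\<bar>n \<bullet> (\<phi> w' - x)\<bar> \<le> \<kappa> * norm (\<phi> w' - x)" if w': "norm (w' - w) < d" for w'
  proof -
    let ?A = "blinfun_apply (\<phi>' w) (w' - w)"
    have "norm ?A \<le> norm (\<phi> w' - x) + norm (\<phi> w' - x - ?A)"
      by (metis add_diff_cancel_left' diff_add_cancel norm_triangle_ineq4)
    then have "B * norm (w' - w) \<le> norm (\<phi> w' - x) + (\<kappa> * B / 2) * norm (w' - w)"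
      using B(2)[of "w' - w"] d(2)[OF w'] unfolding w(2) by linarith
    moreover have "(\<kappa> * B / 2) * norm (w' - w) \<le> (B / 2) * norm (w' - w)"
      using \<kappa> B(1) by (intro mult_right_mono) auto
    ultimately have *: "(B / 2) * norm (w' - w) \<le> norm (\<phi> w' - x)" by (simp add: field_simps)
    have "n \<bullet> (\<phi> w' - x) = n \<bullet> (\<phi> w' - x - ?A)" by (simp add: inner_diff_right orth)
    then have "\<bar>n \<bullet> (\<phi> w' - x)\<bar> \<le> norm (\<phi> w' - x - ?A)"
      using Cauchy_Schwarz_ineq2[of n "\<phi> w' - x - ?A"] n1 by simp
    also have "\<dots> \<le> \<kappa> * ((B / 2) * norm (w' - w))" using d(2)[OF w'] w(2) by simp
    also have "\<dots> \<le> \<kappa> * norm (\<phi> w' - x)" using * \<kappa> by (intro mult_left_mono) auto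
    finally show ?thesis .
  qed
  \<comment> \<open>Continuity of the inverse chart, together with relative openness of its image,
    makes every boundary point near \<open>x\<close> the image of a parameter near
    \<open>w\<close>.\<close>
  obtain r1 where r1: "r1 > 0" "\<And>y. y \<in> \<phi> ` W \<Longrightarrow> dist y x < r1 \<Longrightarrow> dist (\<psi> y) w < d"
  proof -
    have "continuous_on (\<phi> ` W) \<psi>" "\<psi> x = w" "x \<in> \<phi> ` W"
      using hom w unfolding homeomorphism_def by auto
    then show ?thesis using d(1) that unfolding continuous_on_iff by metis
  qed
  obtain r2 where r2: "r2 > 0" "\<And>y. y \<in> frontier D \<Longrightarrow> dist y x < r2 \<Longrightarrow> y \<in> \<phi> ` W"
  proof -
    have "x \<in> \<phi> ` W" using w by auto
    from op[unfolded openin_euclidean_subtopology_iff, THEN conjunct2, rule_format, OF this]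
    show ?thesis using that by blast
  qed
  define r where "r = min (min r1 r2) \<delta>"
  have r: "r > 0" using r1 r2 \<delta> by (simp add: r_def)
  have off: "\<not> (norm (y - x) < r \<and> \<kappa> * norm (y - x) < n \<bullet> (y - x))" if y: "y \<in> frontier D" for y
  proof
    assume a: "norm (y - x) < r \<and> \<kappa> * norm (y - x) < n \<bullet> (y - x)"
    then have yr: "dist y x < r1" "dist y x < r2" by (auto simp: dist_norm r_def)
    have yW: "y \<in> \<phi> ` W" by (rule r2(2)[OF y yr(2)])
    have "norm (\<psi> y - w) < d" using r1(2)[OF yW yr(1)] by (simp add: dist_norm)
    moreover have "\<phi> (\<psi> y) = y" using hom yW unfolding homeomorphism_def by auto
    ultimately have "\<bar>n \<bullet> (y - x)\<bar> \<le> \<kappa> * norm (y - x)" using tangent[of "\<psi> y"] by simp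
    then show False using a by linarith
  qed
  have "x + s *\<^sub>R v \<in> D" if s: "s \<in> {0<..<r}" for s
  proof (rule ccontr)
    assume nD: "x + s *\<^sub>R v \<notin> D"
    let ?S = "closed_segment (x + s *\<^sub>R n) (x + s *\<^sub>R v)"
    have "?S \<inter> frontier D \<noteq> {}"
    proof (rule connected_Int_frontier)
      have "x + s *\<^sub>R n \<in> D" using \<delta>(2)[of s] s by (simp add: r_def)
      then show "?S \<inter> D \<noteq> {}" using ends_in_segment(1) by blast
      show "?S - D \<noteq> {}" using nD ends_in_segment(2) by blast
    qed simp
    then obtain y where y: "y \<in> ?S" "y \<in> frontier D" by blast
    then obtain t where t: "0 \<le> t" "t \<le> 1" "y = (1 - t) *\<^sub>R (x + s *\<^sub>R n) + t *\<^sub>R (x + s *\<^sub>R v)"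
      unfolding in_segment by blast
    have yx: "y - x = s *\<^sub>R ((1 - t) *\<^sub>R n + t *\<^sub>R v)" by (simp add: t(3) algebra_simps)
    have "norm ((1 - t) *\<^sub>R n + t *\<^sub>R v) \<le> (1 - t) + t"
      using norm_triangle_ineq[of "(1 - t) *\<^sub>R n" "t *\<^sub>R v"] n1 v t by simp
    then have le: "norm (y - x) \<le> s" using s by (simp add: yx)
    have "n \<bullet> ((1 - t) *\<^sub>R n + t *\<^sub>R v) = (1 - t) + t * (2 * \<kappa>)"
      using n1 by (simp add: inner_add_right dot_square_norm inner_commute \<kappa>_def)
    moreover have "(1 - t) + t * (2 * \<kappa>) \<ge> 2 * \<kappa>"
      using mult_right_mono[of "2 * \<kappa>" 1 "1 - t"] \<kappa> t by (simp add: algebra_simps)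
    ultimately have "n \<bullet> (y - x) \<ge> s * (2 * \<kappa>)" using s by (simp add: yx)
    moreover have "\<kappa> * norm (y - x) \<le> \<kappa> * s" using le \<kappa> by (intro mult_left_mono) auto
    moreover have "\<kappa> * s < s * (2 * \<kappa>)" using \<kappa> s by simp
    ultimately have "\<kappa> * norm (y - x) < n \<bullet> (y - x)" by linarith
    then show False using off[OF y(2)] le s by auto
  qed
  then show ?thesis using r by blast
qed

text \<open>No boundary point is met strictly between time 0 and the exit time, so one interior
  point, the midpoint, places the whole open segment in \<open>D\<close>. The base point itself may
  be on the boundary, as happens at the instant of a reflection.\<close>

definition in_flight :: "'a::euclidean_space set \<Rightarrow> 'a set \<Rightarrow> ('a \<times> 'a) set" where
  "in_flight D R = {(x, v). norm v = 1 \<and> 0 < exit_time D x v \<and>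
     x + (exit_time D x v / 2) *\<^sub>R v \<in> D \<and> exit_point D x v \<in> R}"

lemma exit_time_le:
  assumes "t > 0" "x + t *\<^sub>R v \<in> frontier D"
  shows "exit_time D x v \<le> t"
  unfolding exit_time_def by (rule cInf_lower) (use assms in \<open>auto intro!: bdd_belowI[of _ 0]\<close>)

lemma ray_meets_frontier:
  fixes x v :: "'a::real_normed_vector"
  assumes "x + a *\<^sub>R v \<in> D" "x + b *\<^sub>R v \<notin> D"
  obtains t where "min a b \<le> t" "t \<le> max a b" "x + t *\<^sub>R v \<in> frontier D"
proof -
  let ?I = "(\<lambda>t. x + t *\<^sub>R v) ` {min a b..max a b}"
  have "x + a *\<^sub>R v \<in> ?I" "x + b *\<^sub>R v \<in> ?I" by (intro imageI; simp)+
  then have "?I \<inter> D \<noteq> {}" "?I - D \<noteq> {}" using assms by blast+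
  moreover have "connected ?I"
    by (intro connected_continuous_image connected_Icc) (auto intro!: continuous_intros)
  ultimately have "?I \<inter> frontier D \<noteq> {}" using connected_Int_frontier by blast
  then obtain t where "t \<in> {min a b..max a b}" "x + t *\<^sub>R v \<in> frontier D" by blast
  then show ?thesis by (intro that[of t]) simp_all
qed

text \<open>The initial stretch inside \<open>D\<close> keeps the hitting times away from 0, hence
  their set is closed and its infimum is attained; boundedness of \<open>D\<close> makes the set
  nonempty.\<close>

lemma exit_of_entering_ray:
  assumes D: "open D" "bounded D" and v: "norm v = 1"
    and \<delta>: "\<delta> > 0" "\<And>s. s \<in> {0<..<\<delta>} \<Longrightarrow> x + s *\<^sub>R v \<in> D"
  shows "exit_time D x v \<ge> \<delta>" "exit_point D x v \<in> frontier D"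
    "exit_point D x v \<in> R \<Longrightarrow> (x, v) \<in> in_flight D R"
proof -
  let ?A = "{t. t > 0 \<and> x + t *\<^sub>R v \<in> frontier D}"
  have ge: "t \<ge> \<delta>" if "t \<in> ?A" for t
    using that \<delta>(2)[of t] D(1) by (force simp: frontier_def interior_open)
  have clo: "closed ?A"
  proof -
    have "?A = {t. \<delta> \<le> t \<and> x + t *\<^sub>R v \<in> frontier D}" using ge \<delta>(1) by force
    also have "\<dots> = {\<delta>..} \<inter> (\<lambda>t. x + t *\<^sub>R v) -` frontier D" by auto
    also have "closed \<dots>"
      by (intro closed_Int closed_vimage frontier_closed continuous_intros closed_atLeast)
    finally show ?thesis .
  qed
  have ne: "?A \<noteq> {}"
  proof -
    obtain b where b: "b > 0" "\<And>y. y \<in> D \<Longrightarrow> norm y \<le> b" using D(2) bounded_pos by blast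
    define t1 where "t1 = \<delta> + b + norm x + 1"
    have "norm (x + t1 *\<^sub>R v) \<ge> t1 - norm x"
      using norm_triangle_ineq2[of "t1 *\<^sub>R v" "- x"] v \<delta>(1) b(1) by (simp add: t1_def add.commute)
    then have out: "x + t1 *\<^sub>R v \<notin> D" using b(2)[of "x + t1 *\<^sub>R v"] \<delta>(1) by (auto simp: t1_def)
    have "x + (\<delta> / 2) *\<^sub>R v \<in> D" using \<delta> by simp
    then obtain t where "min (\<delta> / 2) t1 \<le> t" "x + t *\<^sub>R v \<in> frontier D"
      using out by (rule ray_meets_frontier)
    moreover have "min (\<delta> / 2) t1 > 0" using \<delta>(1) b(1) by (simp add: t1_def add_pos_nonneg)
    ultimately have "0 < t" by linarith
    then have "t \<in> ?A" using \<open>x + t *\<^sub>R v \<in> frontier D\<close> by simp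
    then show ?thesis by blast
  qed
  have mem: "exit_time D x v \<in> ?A"
    unfolding exit_time_def using ne clo by (intro closed_contains_Inf) (auto intro!: bdd_belowI[of _ 0])
  show g: "exit_time D x v \<ge> \<delta>" using ge[OF mem] .
  show "exit_point D x v \<in> frontier D" using mem by (simp add: exit_point_def)
  assume R: "exit_point D x v \<in> R"
  have "x + (exit_time D x v / 2) *\<^sub>R v \<in> D"
  proof (rule ccontr)
    assume out: "x + (exit_time D x v / 2) *\<^sub>R v \<notin> D"
    have "x + (\<delta> / 2) *\<^sub>R v \<in> D" using \<delta> by simp
    then obtain t where "min (\<delta> / 2) (exit_time D x v / 2) \<le> t" "t \<le> max (\<delta> / 2) (exit_time D x v / 2)"
        "x + t *\<^sub>R v \<in> frontier D"
      using out by (rule ray_meets_frontier)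
    then show False using exit_time_le[of t x v D] \<delta>(1) g by auto
  qed
  then show "(x, v) \<in> in_flight D R"
    using v R g \<delta>(1) by (auto simp: in_flight_def)
qed

lemma in_flight_segment:
  assumes z: "(x, v) \<in> in_flight D R" and s: "0 < s" "s < exit_time D x v"
  shows "x + s *\<^sub>R v \<in> D"
proof (rule ccontr)
  assume out: "x + s *\<^sub>R v \<notin> D"
  have mid: "x + (exit_time D x v / 2) *\<^sub>R v \<in> D" using z by (simp add: in_flight_def)
  then obtain t where "min (exit_time D x v / 2) s \<le> t" "t \<le> max (exit_time D x v / 2) s"
      "x + t *\<^sub>R v \<in> frontier D"
    using out by (rule ray_meets_frontier)
  then show False using exit_time_le[of t x v D] s by (auto simp: min_def max_def split: if_splits)
qed

lemma in_flight_advance: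
  assumes z: "(x, v) \<in> in_flight D R" and R: "R \<subseteq> frontier D" and r: "0 \<le> r" "r < exit_time D x v"
  shows "exit_time D (x + r *\<^sub>R v) v = exit_time D x v - r"
    and "exit_point D (x + r *\<^sub>R v) v = exit_point D x v"
    and "(x + r *\<^sub>R v, v) \<in> in_flight D R"
proof -
  \<comment> \<open>As \<open>R\<close> lies in the frontier, the exit time is a genuine hitting
    time and not the infimum of an empty set.\<close>
  have F: "x + exit_time D x v *\<^sub>R v \<in> frontier D" using z R by (auto simp: in_flight_def exit_point_def)
  show eq: "exit_time D (x + r *\<^sub>R v) v = exit_time D x v - r"
    unfolding exit_time_def[of D "x + r *\<^sub>R v"]
  proof (rule cInf_eq_minimum)
    show "exit_time D x v - r \<in> {t. 0 < t \<and> x + r *\<^sub>R v + t *\<^sub>R v \<in> frontier D}"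
      using F r by (simp add: algebra_simps)
    fix t assume "t \<in> {t. 0 < t \<and> x + r *\<^sub>R v + t *\<^sub>R v \<in> frontier D}"
    then have "0 < r + t" "x + (r + t) *\<^sub>R v \<in> frontier D" using r by (auto simp: algebra_simps)
    then show "exit_time D x v - r \<le> t" using exit_time_le[of "r + t" x v D] by simp
  qed
  show ep: "exit_point D (x + r *\<^sub>R v) v = exit_point D x v"
    by (simp add: exit_point_def eq algebra_simps)
  have "x + (r + (exit_time D x v - r) / 2) *\<^sub>R v \<in> D"
    using r by (intro in_flight_segment[OF z]) (auto simp: field_simps)
  then show "(x + r *\<^sub>R v, v) \<in> in_flight D R"
    using z r by (auto simp: in_flight_def eq ep scaleR_add_left add.assoc)
qed

text \<open>The states that hit the frontier during a compact time interval form a closed set, being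
  the projection of a closed set along a compact factor. The event of a hit before time
  \<open>c\<close> is a countable union of such sets.\<close>

lemma borel_measurable_exit_time:
  fixes D :: "'a::euclidean_space set"
  shows "(\<lambda>z. exit_time D (fst z) (snd z)) \<in> borel_measurable borel"
proof -
  let ?G = "\<lambda>a b. {z :: 'a \<times> 'a. \<exists>t\<in>{a..b}. fst z + t *\<^sub>R snd z \<in> frontier D}"
  have "closed (?G a b)" for a b :: real
  proof -
    have "closed ((\<lambda>p :: real \<times> 'a \<times> 'a. fst (snd p) + fst p *\<^sub>R snd (snd p)) -` frontier D)"
      by (intro closed_vimage frontier_closed continuous_intros)
    then have "closed {p :: real \<times> 'a \<times> 'a. fst (snd p) + fst p *\<^sub>R snd (snd p) \<in> frontier D}"
      by (simp add: vimage_def)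
    then have "closed {z. \<exists>t. t \<in> {a..b} \<and> (t, z) \<in> {p :: real \<times> 'a \<times> 'a. fst (snd p) + fst p *\<^sub>R snd (snd p) \<in> frontier D}}"
      by (intro closed_compact_projection) auto
    then show ?thesis by (simp add: Bex_def)
  qed
  then have G: "?G a b \<in> sets borel" for a b by simp
  let ?A = "\<lambda>z :: 'a \<times> 'a. {t. t > 0 \<and> fst z + t *\<^sub>R snd z \<in> frontier D}"
  have H_eq: "{z. \<exists>t\<in>?A z. t < c} = (\<Union>n. ?G (1 / real (Suc n)) (c - 1 / real (Suc n)))" (is "?H c = ?R") for c
  proof (intro subset_antisym subsetI)
    fix z assume "z \<in> ?H c"
    then obtain t where t: "t > 0" "fst z + t *\<^sub>R snd z \<in> frontier D" "t < c" by blast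
    obtain n where "inverse (real (Suc n)) < min t (c - t)" using reals_Archimedean[of "min t (c - t)"] t by auto
    then have "t \<in> {1 / real (Suc n)..c - 1 / real (Suc n)}" by (auto simp: inverse_eq_divide)
    then show "z \<in> ?R" using t(2) by blast
  next
    fix z assume "z \<in> ?R"
    then obtain n t where t: "1 / real (Suc n) \<le> t" "t \<le> c - 1 / real (Suc n)" "fst z + t *\<^sub>R snd z \<in> frontier D"
      by (auto simp del: of_nat_Suc)
    have "0 < 1 / real (Suc n)" by simp
    then have "0 < t" "t < c" using t by linarith+
    then show "z \<in> ?H c" using t(3) by blast
  qed
  have H: "?H c \<in> sets borel" for c
    unfolding H_eq using G by (intro sets.countable_UN) blast
  show ?thesis
  proof (rule borel_measurableI_less)
    fix c
    \<comment> \<open>Off \<open>E\<close> the ray never meets the frontier, and the exit time is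
      the constant \<open>Inf {}\<close>.\<close>
    define E where "E = (\<Union>n::nat. ?H (real n))"
    have E: "E \<in> sets borel" unfolding E_def using H by (intro sets.countable_UN) blast
    have E_iff: "z \<in> E \<longleftrightarrow> ?A z \<noteq> {}" for z unfolding E_def using reals_Archimedean2 by blast
    have "exit_time D (fst z) (snd z) < c \<longleftrightarrow> z \<in> ?H c \<or> z \<notin> E \<and> Inf {} < c" for z
    proof (cases "?A z = {}")
      case True
      then have "exit_time D (fst z) (snd z) = Inf {}" unfolding exit_time_def by (rule arg_cong)
      then show ?thesis using True E_iff[of z] by auto
    next
      case False
      then have "Inf (?A z) < c \<longleftrightarrow> (\<exists>t\<in>?A z. t < c)" by (intro cInf_less_iff) (auto intro!: bdd_belowI[of _ 0])
      then show ?thesis using False E_iff[of z] by (simp add: exit_time_def)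
    qed
    then have "{z \<in> space borel. exit_time D (fst z) (snd z) < c} = ?H c \<union> (if Inf {} < c then - E else {})"
      by auto
    also have "\<dots> \<in> sets borel" using H E by (auto intro: borel_comp)
    finally show "{z \<in> space borel. exit_time D (fst z) (snd z) < c} \<in> sets borel" .
  qed
qed

section \<open>Trajectories\<close>

text \<open>Leg 0 starts at the state \<open>z\<close>, in flight already; the direction \<open>u n\<close> is drawn at the end of leg \<open>n\<close>.\<close>

primrec leg ::
  "'a::euclidean_space set \<Rightarrow> ('a \<Rightarrow> 'a \<Rightarrow>\<^sub>L 'a) \<Rightarrow> 'a \<times> 'a \<Rightarrow> (nat \<Rightarrow> 'a) \<Rightarrow> nat \<Rightarrow> 'a \<times> 'a" where
  "leg D U z u 0 = z"
| "leg D U z u (Suc n) =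
     (let y = exit_point D (fst (leg D U z u n)) (snd (leg D U z u n)) in (y, blinfun_apply (U y) (u n)))"

definition leg_time ::
  "'a::euclidean_space set \<Rightarrow> ('a \<Rightarrow> 'a \<Rightarrow>\<^sub>L 'a) \<Rightarrow> 'a \<times> 'a \<Rightarrow> (nat \<Rightarrow> 'a) \<Rightarrow> nat \<Rightarrow> real" where
  "leg_time D U z u n = (\<Sum>i<n. exit_time D (fst (leg D U z u i)) (snd (leg D U z u i)))"

text \<open>The default value mimics the one that \<^const>\<open>billiard_state\<close> picks when the hitting times accumulate.\<close>

definition leg_index ::
  "'a::euclidean_space set \<Rightarrow> ('a \<Rightarrow> 'a \<Rightarrow>\<^sub>L 'a) \<Rightarrow> 'a \<times> 'a \<Rightarrow> (nat \<Rightarrow> 'a) \<Rightarrow> real \<Rightarrow> nat" where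
  "leg_index D U z u t =
     (if \<exists>n. t < leg_time D U z u (Suc n) then LEAST n. t < leg_time D U z u (Suc n)
      else Suc (THE n. False))"

definition flight ::
  "'a::euclidean_space set \<Rightarrow> ('a \<Rightarrow> 'a \<Rightarrow>\<^sub>L 'a) \<Rightarrow> 'a \<times> 'a \<Rightarrow> (nat \<Rightarrow> 'a) \<Rightarrow> real \<Rightarrow> 'a \<times> 'a" where
  "flight D U z u t =
     (let n = leg_index D U z u t in
        (fst (leg D U z u n) + (t - leg_time D U z u n) *\<^sub>R snd (leg D U z u n), snd (leg D U z u n)))"

definition regular_path ::
  "'a::euclidean_space set \<Rightarrow> 'a set \<Rightarrow> ('a \<Rightarrow> 'a \<Rightarrow>\<^sub>L 'a) \<Rightarrow> 'a \<times> 'a \<Rightarrow> (nat \<Rightarrow> 'a) \<Rightarrow> bool" where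
  "regular_path D R U z u \<longleftrightarrow> (\<forall>n. leg D U z u n \<in> in_flight D R)"

text \<open>Escape of the reflection times to infinity is tested on integers, which makes it a
  countable condition and hence measurable.\<close>

definition proper_path ::
  "'a::euclidean_space set \<Rightarrow> 'a set \<Rightarrow> ('a \<Rightarrow> 'a \<Rightarrow>\<^sub>L 'a) \<Rightarrow> 'a \<times> 'a \<Rightarrow> (nat \<Rightarrow> 'a) \<Rightarrow> bool" where
  "proper_path D R U z u \<longleftrightarrow> regular_path D R U z u \<and> (\<forall>k::nat. \<exists>n. real k < leg_time D U z u n)"

lemma leg_add: "leg D U z u (n + k) = leg D U (leg D U z u n) (\<lambda>i. u (n + i)) k"
  by (induction k) (simp_all add: Let_def)

lemma leg_time_0 [simp]: "leg_time D U z u 0 = 0"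
  by (simp add: leg_time_def)

lemma leg_time_Suc:
  "leg_time D U z u (Suc n) = leg_time D U z u n + exit_time D (fst (leg D U z u n)) (snd (leg D U z u n))"
  by (simp add: leg_time_def)

lemma leg_time_add:
  "leg_time D U z u (n + k) = leg_time D U z u n + leg_time D U (leg D U z u n) (\<lambda>i. u (n + i)) k"
  by (induction k) (simp_all add: leg_time_Suc leg_add)

lemma leg_cong: "(\<And>i. i < n \<Longrightarrow> u i = u' i) \<Longrightarrow> leg D U z u n = leg D U z u' n"
  by (induction n) (simp_all add: Let_def)

text \<open>The off-by-one matters: the end of leg \<open>n\<close>, which is
  \<open>leg_time\<close> at \<open>Suc n\<close>, depends only on directions of index below
  \<open>n\<close>. Hence the event that leg \<open>n\<close> is in progress at a given time is
  decided by these directions.\<close>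

lemma leg_time_cong:
  assumes "\<And>i. Suc i < n \<Longrightarrow> u i = u' i"
  shows "leg_time D U z u n = leg_time D U z u' n"
  unfolding leg_time_def
proof (rule sum.cong)
  fix i assume "i \<in> {..<n}"
  then have "leg D U z u i = leg D U z u' i" using assms by (intro leg_cong) auto
  then show "exit_time D (fst (leg D U z u i)) (snd (leg D U z u i)) =
      exit_time D (fst (leg D U z u' i)) (snd (leg D U z u' i))" by simp
qed simp

text \<open>A boundary start spends \<open>u 0\<close> on creating leg 0, whereas an interior start
  spends it at the end of leg 0; this shift by one is what links legs and hitting points.\<close>

lemma leg_boundary_start:
  "leg D U (x, blinfun_apply (U x) (u 0)) (\<lambda>i. u (Suc i)) n = (hit_point D U x u n, out_velocity D U x u n)"
  by (induction n) (simp_all add: out_velocity_def Let_def)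

lemma leg_time_boundary_start:
  "leg_time D U (x, blinfun_apply (U x) (u 0)) (\<lambda>i. u (Suc i)) n = hit_time D U x u n"
  by (simp add: leg_time_def hit_time_def leg_boundary_start)

lemma leg_Suc_eq_hit:
  "leg D U (x, v) u (Suc n) = (hit_point D U (exit_point D x v) u n, out_velocity D U (exit_point D x v) u n)"
  using leg_add[of D U "(x, v)" u 1 n] leg_boundary_start[of D U "exit_point D x v" u n]
  by (simp add: Let_def out_velocity_def)

lemma leg_time_Suc_eq_hit:
  "leg_time D U (x, v) u (Suc n) = exit_time D x v + hit_time D U (exit_point D x v) u n"
  using leg_time_add[of D U "(x, v)" u 1 n] leg_time_boundary_start[of D U "exit_point D x v" u n]
  by (simp add: leg_time_Suc Let_def)

lemma leg_time_strict_mono: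
  assumes "regular_path D R U z u"
  shows "strict_mono (leg_time D U z u)"
  unfolding strict_mono_Suc_iff
proof
  fix n
  have "leg D U z u n \<in> in_flight D R" using assms by (simp add: regular_path_def)
  then show "leg_time D U z u n < leg_time D U z u (Suc n)"
    by (auto simp: leg_time_Suc in_flight_def split: prod.splits)
qed

text \<open>If \<open>T\<close> never exceeds \<open>t\<close>, the description is of an
  unsatisfiable predicate, and its value is the number \<open>THE n. False\<close>, the same for all
  paths. Recording it lets paths with accumulating reflections be followed until they are
  excluded.\<close>

lemma the_interval_index:
  fixes T :: "nat \<Rightarrow> real"
  assumes T: "strict_mono T" "T 0 \<le> t"
  shows "(THE n. T n \<le> t \<and> t < T (Suc n)) =
    (if \<exists>n. t < T (Suc n) then LEAST n. t < T (Suc n) else THE n. False)"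
proof (cases "\<exists>n. t < T (Suc n)")
  case True
  let ?n = "LEAST n. t < T (Suc n)"
  have 1: "t < T (Suc ?n)" using True by (rule LeastI_ex)
  have 2: "T ?n \<le> t"
  proof (cases ?n)
    case (Suc m)
    then have "\<not> t < T (Suc m)" by (intro not_less_Least) simp
    then show ?thesis using Suc by simp
  qed (use T in simp)
  have "(THE n. T n \<le> t \<and> t < T (Suc n)) = ?n"
  proof (rule the_equality)
    fix m assume m: "T m \<le> t \<and> t < T (Suc m)"
    then have "T m < T (Suc ?n)" "T ?n < T (Suc m)" using 1 2 by linarith+
    then show "m = ?n" using T(1) by (simp add: strict_mono_less)
  qed (use 1 2 in simp)
  then show ?thesis using True by simp
next
  case False
  then have "(\<lambda>n. T n \<le> t \<and> t < T (Suc n)) = (\<lambda>n. False)" by auto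
  then show ?thesis using False by simp
qed

text \<open>Regularity is the only property of paths at hand when this identity feeds the mixing
  hypothesis, from which the absence of accumulation is deduced later. On accumulating paths both
  sides use the same default, shifted by one because leg 0 precedes the first reflection.\<close>

lemma billiard_state_interior_start:
  assumes x: "x \<in> D" and reg: "regular_path D R U (x, v) u" and t: "t \<ge> 0"
  shows "billiard_state D U (x, v) u t = flight D U (x, v) u t"
proof (cases "t < exit_time D x v")
  case True
  then have "t < leg_time D U (x, v) u (Suc 0)" by (simp add: leg_time_Suc)
  then have "leg_index D U (x, v) u t = 0"
    unfolding leg_index_def by (auto intro!: Least_equality)
  then show ?thesis using x True by (simp add: billiard_state_def flight_def)
next
  case False
  let ?y = "exit_point D x v" and ?s = "t - exit_time D x v"
  have mono: "strict_mono (hit_time D U ?y u)"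
    using leg_time_strict_mono[OF reg] unfolding strict_mono_Suc_iff
    by (metis add_less_cancel_left leg_time_Suc_eq_hit)
  have iff: "t < leg_time D U (x, v) u (Suc n) \<longleftrightarrow> ?s < hit_time D U ?y u n" for n
    by (auto simp: leg_time_Suc_eq_hit)
  have h0: "hit_time D U ?y u 0 = 0" by (simp add: hit_time_def)
  have "leg_index D U (x, v) u t = Suc (THE n. hit_time D U ?y u n \<le> ?s \<and> ?s < hit_time D U ?y u (Suc n))"
  proof (cases "\<exists>n. ?s < hit_time D U ?y u (Suc n)")
    case True
    then obtain n where n: "?s < hit_time D U ?y u (Suc n)" by blast
    have "(LEAST n. ?s < hit_time D U ?y u n) = Suc (LEAST n. ?s < hit_time D U ?y u (Suc n))"
      using n False by (intro Least_Suc[where P = "\<lambda>n. ?s < hit_time D U ?y u n", OF n]) (simp add: h0)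
    moreover have "\<exists>n. ?s < hit_time D U ?y u n" using n by blast
    ultimately show ?thesis
      using True False the_interval_index[OF mono, of ?s]
      by (simp add: leg_index_def iff h0)
  next
    case F: False
    have "\<not> ?s < hit_time D U ?y u n" for n
      using F False by (cases n) (auto simp: h0)
    then show ?thesis
      using False the_interval_index[OF mono, of ?s]
      by (simp add: leg_index_def iff h0)
  qed
  then show ?thesis
    using x False
    by (simp add: billiard_state_def flight_def boundary_state_def Let_def leg_Suc_eq_hit leg_time_Suc_eq_hit
        del: leg.simps)
qed

lemma proper_pathD:
  assumes "proper_path D R U z u"
  shows "regular_path D R U z u" "\<exists>n. t < leg_time D U z u (Suc n)"
proof -
  show reg: "regular_path D R U z u" using assms by (simp add: proper_path_def)
  obtain k :: nat where k: "t \<le> real k" using real_arch_simple by blast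
  obtain n where "real k < leg_time D U z u n" using assms by (auto simp: proper_path_def)
  moreover have "leg_time D U z u n < leg_time D U z u (Suc n)"
    using leg_time_strict_mono[OF reg] by (simp add: strict_mono_Suc_iff)
  ultimately show "\<exists>n. t < leg_time D U z u (Suc n)" using k by (intro exI[of _ n]) linarith
qed

lemma leg_index_proper:
  assumes u: "proper_path D R U z u" and t: "t \<ge> 0"
  shows "leg_time D U z u (leg_index D U z u t) \<le> t" "t < leg_time D U z u (Suc (leg_index D U z u t))"
    "leg_time D U z u n \<le> t \<Longrightarrow> t < leg_time D U z u (Suc n) \<Longrightarrow> leg_index D U z u t = n"
proof -
  note reg = proper_pathD(1)[OF u] and ex = proper_pathD(2)[OF u, of t]
  have idx: "leg_index D U z u t = (LEAST n. t < leg_time D U z u (Suc n))"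
    using ex by (simp add: leg_index_def)
  show 1: "t < leg_time D U z u (Suc (leg_index D U z u t))" unfolding idx using ex by (rule LeastI_ex)
  show 2: "leg_time D U z u (leg_index D U z u t) \<le> t"
  proof (cases "leg_index D U z u t")
    case (Suc m)
    then have "\<not> t < leg_time D U z u (Suc m)" unfolding idx by (intro not_less_Least) simp
    then show ?thesis using Suc by simp
  qed (use t in simp)
  assume "leg_time D U z u n \<le> t" "t < leg_time D U z u (Suc n)"
  then have "leg_time D U z u n < leg_time D U z u (Suc (leg_index D U z u t))"
    "leg_time D U z u (leg_index D U z u t) < leg_time D U z u (Suc n)" using 1 2 by linarith+
  then show "leg_index D U z u t = n"
    using leg_time_strict_mono[OF reg] by (simp add: strict_mono_less)
qed

text \<open>Here hitting points and legs are numbered alike, so their defaults on accumulating paths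
  would differ by one; hence the restriction to proper paths.\<close>

lemma billiard_state_boundary_start:
  assumes x: "x \<notin> D" and u: "proper_path D R U (x, blinfun_apply (U x) (u 0)) (\<lambda>i. u (Suc i))" and t: "t \<ge> 0"
  shows "billiard_state D U (x, v) u t = flight D U (x, blinfun_apply (U x) (u 0)) (\<lambda>i. u (Suc i)) t"
proof -
  let ?z = "(x, blinfun_apply (U x) (u 0))" and ?u = "\<lambda>i. u (Suc i)"
  have mono: "strict_mono (hit_time D U x u)"
    using leg_time_strict_mono[OF proper_pathD(1)[OF u]] by (simp add: leg_time_boundary_start[abs_def])
  have ex: "\<exists>n. t < hit_time D U x u (Suc n)"
    using proper_pathD(2)[OF u, of t] by (simp add: leg_time_boundary_start)
  have "leg_index D U ?z ?u t = (THE n. hit_time D U x u n \<le> t \<and> t < hit_time D U x u (Suc n))"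
    using the_interval_index[OF mono, of t] ex t
    by (simp add: leg_index_def leg_time_boundary_start hit_time_def)
  then show ?thesis
    using x by (simp add: billiard_state_def flight_def boundary_state_def Let_def leg_boundary_start
        leg_time_boundary_start)
qed

lemma flight_in_flight:
  assumes R: "R \<subseteq> frontier D" and u: "proper_path D R U z u" and t: "t \<ge> 0"
  shows "flight D U z u t \<in> in_flight D R"
proof -
  let ?n = "leg_index D U z u t"
  obtain x v where xv: "leg D U z u ?n = (x, v)" by (cases "leg D U z u ?n")
  have "(x, v) \<in> in_flight D R"
    using proper_pathD(1)[OF u] xv unfolding regular_path_def by metis
  moreover have "t - leg_time D U z u ?n < exit_time D x v"
    using leg_index_proper(2)[OF u t] xv by (simp add: leg_time_Suc)
  ultimately show ?thesis
    using in_flight_advance(3)[OF _ R, of x v "t - leg_time D U z u ?n"] leg_index_proper(1)[OF u t] xv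
    by (simp add: flight_def)
qed

text \<open>At a reflection time the position is a boundary point, whence the closure. Points
  slightly ahead on the current leg lie in \<open>D\<close> and converge to the position.\<close>

lemma flight_domain:
  assumes D: "open D" and R: "R \<subseteq> frontier D" and u: "proper_path D R U z u" and t: "t \<ge> 0"
  shows "flight D U z u t \<in> closure D \<times> unit_sphere"
proof -
  obtain y v where yv: "flight D U z u t = (y, v)" by fastforce
  then have f: "(y, v) \<in> in_flight D R" using flight_in_flight[OF R u t] by simp
  have e: "exit_time D y v > 0" using f by (simp add: in_flight_def)
  have "((\<lambda>s. y + s *\<^sub>R v) \<longlongrightarrow> y + 0 *\<^sub>R v) (at_right 0)" by (intro tendsto_intros)
  then have lim: "((\<lambda>s. y + s *\<^sub>R v) \<longlongrightarrow> y) (at_right 0)" by simp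
  have "eventually (\<lambda>s. s < exit_time D y v) (at_right (0::real))" "eventually (\<lambda>s. s > 0) (at_right (0::real))"
    using e eventually_at_right_less by (auto simp: eventually_at_right_real intro: eventually_at_rightI[of 0 "exit_time D y v"])
  then have ev: "eventually (\<lambda>s. y + s *\<^sub>R v \<in> closure D) (at_right 0)"
    by eventually_elim (use in_flight_segment[OF f] closure_subset in blast)
  have "y \<in> closure D"
    using Lim_in_closed_set[OF closed_closure ev _ lim] by simp
  then show ?thesis using f yv by (simp add: in_flight_def)
qed

section \<open>Restarting a path at a fixed time\<close>

context
  fixes D R :: "'a::euclidean_space set" and U :: "'a \<Rightarrow> 'a \<Rightarrow>\<^sub>L 'a" and z u t n z'
  assumes R: "R \<subseteq> frontier D" and u: "proper_path D R U z u" and t: "t \<ge> 0"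
  defines "n \<equiv> leg_index D U z u t" and "z' \<equiv> flight D U z u t"
begin

private lemma advance:
  "exit_time D (fst z') (snd z') = leg_time D U z u (Suc n) - t"
  "exit_point D (fst z') (snd z') = exit_point D (fst (leg D U z u n)) (snd (leg D U z u n))"
proof -
  obtain x v where xv: "leg D U z u n = (x, v)" by fastforce
  have f: "(x, v) \<in> in_flight D R" using proper_pathD(1)[OF u] xv unfolding regular_path_def by metis
  have b: "0 \<le> t - leg_time D U z u n" "t - leg_time D U z u n < exit_time D x v"
    using leg_index_proper(1,2)[OF u t] xv by (auto simp: leg_time_Suc n_def[symmetric])
  have z': "z' = (x + (t - leg_time D U z u n) *\<^sub>R v, v)"
    using xv by (simp add: z'_def flight_def n_def[symmetric])
  show "exit_time D (fst z') (snd z') = leg_time D U z u (Suc n) - t"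
    using in_flight_advance(1)[OF f R b] by (simp add: z' leg_time_Suc xv)
  show "exit_point D (fst z') (snd z') = exit_point D (fst (leg D U z u n)) (snd (leg D U z u n))"
    using in_flight_advance(2)[OF f R b] by (simp add: z' xv)
qed

text \<open>Leg 0 of the restarted path is only the remaining piece of leg \<open>n\<close>, so
  agreement begins with the leg after it.\<close>

private lemma leg_restart: "leg D U z' (\<lambda>i. u (n + i)) (Suc k) = leg D U z u (n + Suc k)"
  by (induction k) (simp_all add: advance Let_def)

private lemma leg_time_restart: "leg_time D U z' (\<lambda>i. u (n + i)) (Suc k) = leg_time D U z u (n + Suc k) - t"
  by (induction k) (simp_all add: leg_time_Suc advance leg_restart del: leg.simps(2))

lemma proper_path_restart: "proper_path D R U z' (\<lambda>i. u (n + i))"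
  unfolding proper_path_def regular_path_def
proof (intro conjI allI)
  fix k
  show "leg D U z' (\<lambda>i. u (n + i)) k \<in> in_flight D R"
  proof (cases k)
    case 0
    then show ?thesis using flight_in_flight[OF R u t] by (simp add: z'_def)
  next
    case (Suc m)
    then show ?thesis using proper_pathD(1)[OF u] unfolding regular_path_def Suc leg_restart by blast
  qed
next
  fix k :: nat
  obtain m where "real k + t < leg_time D U z u (Suc m)" using proper_pathD(2)[OF u] by blast
  also have "\<dots> \<le> leg_time D U z u (n + Suc m)"
    using leg_time_strict_mono[OF proper_pathD(1)[OF u]] by (simp add: strict_mono_less_eq)
  finally have "real k < leg_time D U z' (\<lambda>i. u (n + i)) (Suc m)" by (simp add: leg_time_restart)
  then show "\<exists>m. real k < leg_time D U z' (\<lambda>i. u (n + i)) m" by blast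
qed

lemma flight_restart:
  assumes s: "s \<ge> 0"
  shows "flight D U z u (t + s) = flight D U z' (\<lambda>i. u (n + i)) s"
proof -
  let ?u = "\<lambda>i. u (n + i)"
  define m where "m = leg_index D U z' ?u s"
  note m = leg_index_proper(1,2)[OF proper_path_restart s, folded m_def]
  have lt: "t + s < leg_time D U z u (Suc (n + m))" using m(2) by (simp add: leg_time_restart)
  have le: "leg_time D U z u (n + m) \<le> t + s"
  proof (cases m)
    case 0
    then show ?thesis using leg_index_proper(1)[OF u t] s by (simp add: n_def)
  next
    case (Suc k)
    then show ?thesis using m(1) by (simp add: leg_time_restart)
  qed
  have idx: "leg_index D U z u (t + s) = n + m"
    using leg_index_proper(3)[OF u _ le lt] t s by simp
  show ?thesis
  proof (cases m)
    case 0
    then show ?thesis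
      using idx by (simp add: flight_def[of D U z u "t + s"] flight_def[of D U z' ?u s] m_def[symmetric])
        (simp add: z'_def flight_def n_def[symmetric] algebra_simps Let_def)
  next
    case (Suc k)
    have "leg_time D U z' ?u m = leg_time D U z u (n + m) - t" "leg D U z' ?u m = leg D U z u (n + m)"
      unfolding Suc leg_restart leg_time_restart by simp_all
    then show ?thesis
      by (simp add: flight_def[of D U z u "t + s"] flight_def[of D U z' ?u s] m_def[symmetric] idx Let_def)
  qed
qed

end

text \<open>\<open>comb_seq n u u'\<close> keeps the directions before index \<open>n\<close> and
  continues with \<open>u'\<close>. The legs up to \<open>n\<close> and the end of leg
  \<open>n\<close> are fixed by the former, so nothing changes until time \<open>t\<close>: the leg
  index is a stopping time.\<close>

lemma leg_index_comb_seq: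
  assumes u: "proper_path D R U z u" and t: "t \<ge> 0" and n: "n = leg_index D U z u t"
    and w: "proper_path D R U z (comb_seq n u u')"
  shows "leg_index D U z (comb_seq n u u') t = n"
    "0 \<le> s \<Longrightarrow> s \<le> t \<Longrightarrow> flight D U z (comb_seq n u u') s = flight D U z u s"
proof -
  let ?w = "comb_seq n u u'"
  have lt: "leg_time D U z ?w k = leg_time D U z u k" if "k \<le> Suc n" for k
    using that by (intro leg_time_cong) (simp add: comb_seq_less)
  have lg: "leg D U z ?w k = leg D U z u k" if "k \<le> n" for k
    using that by (intro leg_cong) (simp add: comb_seq_less)
  note b = leg_index_proper(1,2)[OF u t, folded n]
  show "leg_index D U z ?w t = n"
    using b by (intro leg_index_proper(3)[OF w t]) (simp_all add: lt)
  assume s: "0 \<le> s" "s \<le> t"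
  define m where "m = leg_index D U z u s"
  note bm = leg_index_proper(1,2)[OF u s(1), folded m_def]
  have "leg_time D U z u m < leg_time D U z u (Suc n)" using bm b s by linarith
  then have mn: "m \<le> n"
    using leg_time_strict_mono[OF proper_pathD(1)[OF u]] by (simp add: strict_mono_less)
  have "leg_index D U z ?w s = m"
    using bm mn by (intro leg_index_proper(3)[OF w s(1)]) (simp_all add: lt)
  then show "flight D U z ?w s = flight D U z u s"
    using mn by (simp add: flight_def m_def[symmetric] lt lg)
qed

lemma flight_comb_seq:
  assumes R: "R \<subseteq> frontier D"
    and u: "proper_path D R U z u" and t: "t \<ge> 0" and n: "n = leg_index D U z u t"
    and w: "proper_path D R U z (comb_seq n u u')" and s: "s \<ge> 0"
  shows "flight D U z (comb_seq n u u') (t + s) = flight D U (flight D U z u t) u' s"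
proof -
  have "(\<lambda>i. comb_seq n u u' (n + i)) = u'" by (simp add: comb_seq_def)
  then show ?thesis
    using flight_restart[OF R w t s] leg_index_comb_seq(1)[OF u t n w] leg_index_comb_seq(2)[OF u t n w, of t] t by simp
qed

section \<open>Measurability of paths in the starting state and the directions\<close>

lemma borel_measurable_fst_snd [measurable (raw)]:
  fixes f :: "_ \<Rightarrow> 'a::second_countable_topology \<times> 'b::second_countable_topology"
  assumes "f \<in> borel_measurable M"
  shows "(\<lambda>w. fst (f w)) \<in> borel_measurable M" "(\<lambda>w. snd (f w)) \<in> borel_measurable M"
  using assms unfolding borel_prod[symmetric] by measurable

text \<open>Expanding the argument in the basis reduces joint measurability to evaluation at
  finitely many fixed vectors, which is continuous in the operator.\<close>

lemma borel_measurable_blinfun_apply: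
  fixes U :: "'a::euclidean_space \<Rightarrow> 'a \<Rightarrow>\<^sub>L 'a"
  assumes U: "U \<in> borel_measurable borel"
    and [measurable]: "f \<in> borel_measurable M" "g \<in> borel_measurable M"
  shows "(\<lambda>w. blinfun_apply (U (f w)) (g w)) \<in> borel_measurable M"
proof -
  have "continuous_on UNIV (\<lambda>A :: 'a \<Rightarrow>\<^sub>L 'a. blinfun_apply A b)" for b
    by (intro continuous_intros)
  then have [measurable]: "(\<lambda>x. blinfun_apply (U x) b) \<in> borel_measurable borel" for b
    using measurable_compose[OF U borel_measurable_continuous_onI] by blast
  have "blinfun_apply (U (f w)) (g w) = (\<Sum>b\<in>Basis. (g w \<bullet> b) *\<^sub>R blinfun_apply (U (f w)) b)" for w
  proof -
    have "blinfun_apply (U (f w)) (\<Sum>b\<in>Basis. (g w \<bullet> b) *\<^sub>R b) = (\<Sum>b\<in>Basis. (g w \<bullet> b) *\<^sub>R blinfun_apply (U (f w)) b)"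
      by (simp add: blinfun.sum_right blinfun.scaleR_right)
    then show ?thesis by (simp add: euclidean_representation)
  qed
  then show ?thesis by simp
qed

lemma measurable_exit_time [measurable (raw)]:
  assumes [measurable]: "f \<in> borel_measurable M" "g \<in> borel_measurable M"
  shows "(\<lambda>w. exit_time D (f w :: 'a::euclidean_space) (g w)) \<in> borel_measurable M"
proof -
  have "(\<lambda>w. (f w, g w)) \<in> borel_measurable M" by measurable
  from measurable_compose[OF this borel_measurable_exit_time[of D]] show ?thesis by simp
qed

lemma measurable_exit_point [measurable (raw)]:
  assumes [measurable]: "f \<in> borel_measurable M" "g \<in> borel_measurable M"
  shows "(\<lambda>w. exit_point D (f w :: 'a::euclidean_space) (g w)) \<in> borel_measurable M"
  unfolding exit_point_def by measurable

lemma sets_in_flight [measurable]: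
  fixes D R :: "'a::euclidean_space set"
  assumes [measurable]: "D \<in> sets borel" "R \<in> sets borel"
  shows "in_flight D R \<in> sets borel"
proof -
  have "in_flight D R = {z \<in> space borel. norm (snd z) = 1 \<and> 0 < exit_time D (fst z) (snd z) \<and>
     fst z + (exit_time D (fst z) (snd z) / 2) *\<^sub>R snd z \<in> D \<and> exit_point D (fst z) (snd z) \<in> R}"
    by (auto simp: in_flight_def)
  also have "\<dots> \<in> sets borel"
    unfolding borel_prod[symmetric] by measurable
  finally show ?thesis .
qed

abbreviation borel_seq :: "(nat \<Rightarrow> 'a::topological_space) measure" where
  "borel_seq \<equiv> PiM UNIV (\<lambda>_. borel)"

context
  fixes D :: "'a::euclidean_space set" and U :: "'a \<Rightarrow> 'a \<Rightarrow>\<^sub>L 'a"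
  assumes U: "U \<in> borel_measurable borel"
begin

lemma measurable_leg [measurable (raw)]:
  assumes [measurable]: "f \<in> M \<rightarrow>\<^sub>M borel" "g \<in> M \<rightarrow>\<^sub>M borel_seq"
  shows "(\<lambda>w. leg D U (f w) (g w) n) \<in> M \<rightarrow>\<^sub>M borel"
proof (induction n)
  case (Suc n)
  note [measurable] = Suc
  have "(\<lambda>w. g w n) \<in> M \<rightarrow>\<^sub>M borel" by measurable
  then show ?case
    by (simp add: Let_def) (intro borel_measurable_Pair borel_measurable_blinfun_apply U; measurable)
qed simp

lemma measurable_leg_time [measurable (raw)]:
  assumes [measurable]: "f \<in> M \<rightarrow>\<^sub>M borel" "g \<in> M \<rightarrow>\<^sub>M borel_seq"
  shows "(\<lambda>w. leg_time D U (f w) (g w) n) \<in> M \<rightarrow>\<^sub>M borel"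
  unfolding leg_time_def by measurable

lemma measurable_leg_index [measurable (raw)]:
  assumes [measurable]: "f \<in> M \<rightarrow>\<^sub>M borel" "g \<in> M \<rightarrow>\<^sub>M borel_seq" "h \<in> borel_measurable M"
  shows "(\<lambda>w. leg_index D U (f w) (g w) (h w)) \<in> M \<rightarrow>\<^sub>M count_space UNIV"
  unfolding leg_index_def by measurable

lemma measurable_flight [measurable (raw)]:
  assumes [measurable]: "f \<in> M \<rightarrow>\<^sub>M borel" "g \<in> M \<rightarrow>\<^sub>M borel_seq" "h \<in> borel_measurable M"
  shows "(\<lambda>w. flight D U (f w) (g w) (h w)) \<in> M \<rightarrow>\<^sub>M borel"
  unfolding flight_def Let_def
  by (rule measurable_compose_countable[where g = "\<lambda>w. leg_index D U (f w) (g w) (h w)"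
        and f = "\<lambda>n w. (fst (leg D U (f w) (g w) n) + (h w - leg_time D U (f w) (g w) n) *\<^sub>R snd (leg D U (f w) (g w) n),
             snd (leg D U (f w) (g w) n))"]) measurable

lemma pred_proper_path [measurable (raw)]:
  assumes [measurable]: "f \<in> M \<rightarrow>\<^sub>M borel" "g \<in> M \<rightarrow>\<^sub>M borel_seq" "D \<in> sets borel" "R \<in> sets borel"
  shows "Measurable.pred M (\<lambda>w. proper_path D R U (f w) (g w))"
    "Measurable.pred M (\<lambda>w. regular_path D R U (f w) (g w))"
  unfolding proper_path_def regular_path_def by measurable

end

section \<open>Markov property and mixing\<close>

lemma floor_eq_sum_of_bool:
  fixes y :: real
  assumes "0 \<le> y" "y \<le> real n"
  shows "(\<Sum>j=1..n. of_bool (real j \<le> y)) = real_of_int \<lfloor>y\<rfloor>"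
proof -
  have "(\<Sum>j=1..n. of_bool (real j \<le> y)) = (real (card ({1..n} \<inter> {j. real j \<le> y})) :: real)"
    by (simp add: of_bool_def sum.If_cases)
  also have "{1..n} \<inter> {j. real j \<le> y} = {1..nat \<lfloor>y\<rfloor>}"
    using assms by (auto simp: le_nat_iff le_floor_iff)
  also have "real (card {1..nat \<lfloor>y\<rfloor>}) = real_of_int \<lfloor>y\<rfloor>" using assms by simp
  finally show ?thesis .
qed

lemma measure_le_total_variation:
  assumes "prob_space M" "prob_space N" "A \<in> sets N"
  shows "\<bar>measure M A - measure N A\<bar> \<le> total_variation M N"
  unfolding total_variation_def
proof (rule cSUP_upper[OF assms(3)], rule bdd_aboveI2)
  fix B assume "B \<in> sets N"
  show "\<bar>measure M B - measure N B\<bar> \<le> 1"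
    using prob_space.prob_le_1[OF assms(1), of B] prob_space.prob_le_1[OF assms(2), of B]
      measure_nonneg[of M B] measure_nonneg[of N B] by linarith
qed

text \<open>Up to \<open>1 / n\<close>, \<open>h\<close> is the average of the indicators of its
  level sets at heights \<open>j / n\<close>. Each indicator contributes at most the total
  variation, and averaging loses no factor.\<close>

lemma integral_diff_le_total_variation_unit:
  fixes h :: "'a \<Rightarrow> real"
  assumes M: "prob_space M" and N: "prob_space N" and sets: "sets M = sets N"
    and h: "h \<in> borel_measurable N" "\<And>x. 0 \<le> h x" "\<And>x. h x \<le> 1"
  shows "\<bar>(\<integral>x. h x \<partial>M) - (\<integral>x. h x \<partial>N)\<bar> \<le> total_variation M N"
proof (rule field_le_epsilon)
  fix e :: real assume "e > 0"
  then obtain n :: nat where n: "n > 0" "2 / real n < e"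
    using reals_Archimedean2[of "2 / e"] by (metis divide_less_eq mult.commute of_nat_0_less_iff less_trans zero_less_divide_iff zero_less_numeral)
  define A where "A j = {x \<in> space N. real j / real n \<le> h x}" for j
  have A: "A j \<in> sets N" "A j \<in> sets M" for j
    using h(1) by (auto simp: A_def sets)
  define hn where "hn x = (\<Sum>j=1..n. indicator (A j) x) / real n" for x
  have close: "\<bar>h x - hn x\<bar> \<le> 1 / real n" if x: "x \<in> space N" for x
  proof -
    have "(\<Sum>j=1..n. indicator (A j) x :: real) = (\<Sum>j=1..n. of_bool (real j \<le> real n * h x))"
      using n x by (intro sum.cong) (auto simp: A_def field_simps)
    also have "\<dots> = real_of_int \<lfloor>real n * h x\<rfloor>"
      using h(2,3)[of x] n by (intro floor_eq_sum_of_bool) (auto simp: mult_left_le)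
    finally have eq: "hn x = real_of_int \<lfloor>real n * h x\<rfloor> / real n" by (simp add: hn_def)
    have "\<bar>real n * h x - real_of_int \<lfloor>real n * h x\<rfloor>\<bar> \<le> 1" by linarith
    then have "\<bar>real n * h x - real_of_int \<lfloor>real n * h x\<rfloor>\<bar> / real n \<le> 1 / real n"
      using n by (intro divide_right_mono) auto
    also have "\<bar>real n * h x - real_of_int \<lfloor>real n * h x\<rfloor>\<bar> / real n = \<bar>h x - hn x\<bar>"
    proof -
      have "h x - hn x = (real n * h x - real_of_int \<lfloor>real n * h x\<rfloor>) / real n"
        using n by (simp add: eq diff_divide_distrib)
      then show ?thesis by (simp only: abs_divide abs_of_nat)
    qed
    finally show ?thesis .
  qed
  have approx: "\<bar>(\<integral>x. h x \<partial>L) - (\<integral>x. hn x \<partial>L)\<bar> \<le> 1 / real n"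
    and val: "(\<integral>x. hn x \<partial>L) = (\<Sum>j=1..n. measure L (A j)) / real n"
    if L: "prob_space L" "sets L = sets N" for L
  proof -
    interpret L: prob_space L by fact
    have sp: "space L = space N" using L(2) by (rule sets_eq_imp_space_eq)
    have [measurable]: "h \<in> borel_measurable L" "A j \<in> sets L" for j
      using h(1) A L(2) measurable_cong_sets[OF L(2) refl, of borel] by auto
    have ih: "integrable L h"
      using h(2,3) by (intro L.integrable_const_bound[where B = 1]) auto
    have iA: "integrable L (indicat_real (A j))" for j
      by (intro integrable_real_indicator) (auto simp: less_top[symmetric])
    have ihn: "integrable L hn" unfolding hn_def by (intro integrable_divide Bochner_Integration.integrable_sum iA)
    have "\<bar>(\<integral>x. h x \<partial>L) - (\<integral>x. hn x \<partial>L)\<bar> = \<bar>\<integral>x. h x - hn x \<partial>L\<bar>"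
      using ih ihn by simp
    also have "\<dots> \<le> (\<integral>x. 1 / real n \<partial>L)"
      using ih ihn close sp by (intro integral_abs_bound[THEN order_trans] integral_mono_AE) auto
    finally show "\<bar>(\<integral>x. h x \<partial>L) - (\<integral>x. hn x \<partial>L)\<bar> \<le> 1 / real n" by (simp add: L.prob_space)
    show "(\<integral>x. hn x \<partial>L) = (\<Sum>j=1..n. measure L (A j)) / real n"
      unfolding hn_def by (subst integral_divide_zero, subst Bochner_Integration.integral_sum) (auto intro: iA)
  qed
  have "\<bar>(\<integral>x. hn x \<partial>M) - (\<integral>x. hn x \<partial>N)\<bar> = \<bar>\<Sum>j=1..n. measure M (A j) - measure N (A j)\<bar> / real n"
    using val[OF M sets] val[OF N refl] by (simp add: sum_subtractf diff_divide_distrib[symmetric])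
  also have "\<dots> \<le> (\<Sum>j=1..n. total_variation M N) / real n"
    by (intro divide_right_mono order_trans[OF sum_abs] sum_mono measure_le_total_variation M N A) auto
  also have "\<dots> = total_variation M N" using n by simp
  finally show "\<bar>(\<integral>x. h x \<partial>M) - (\<integral>x. h x \<partial>N)\<bar> \<le> total_variation M N + e"
    using approx[OF M sets] approx[OF N refl] n(2) by linarith
qed

text \<open>An affine map carries the range into the unit interval; its shift cancels because both
  measures have mass one, and its slope produces the factor \<open>2 * B\<close>.\<close>

lemma integral_diff_le_total_variation:
  fixes h :: "'a \<Rightarrow> real"
  assumes M: "prob_space M" and N: "prob_space N" and sets: "sets M = sets N"
    and h: "h \<in> borel_measurable N" "\<And>x. \<bar>h x\<bar> \<le> B" and B: "B > 0"
  shows "\<bar>(\<integral>x. h x \<partial>M) - (\<integral>x. h x \<partial>N)\<bar> \<le> 2 * B * total_variation M N"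
proof -
  interpret M: prob_space M by fact
  interpret N: prob_space N by fact
  have hM: "h \<in> borel_measurable M" using h(1) measurable_cong_sets[OF sets refl, of borel] by auto
  have int: "integrable M h" "integrable N h"
    using h hM by (auto intro!: M.integrable_const_bound[where B = B] N.integrable_const_bound[where B = B])
  have *: "\<bar>(\<integral>x. (h x + B) / (2 * B) \<partial>M) - (\<integral>x. (h x + B) / (2 * B) \<partial>N)\<bar> \<le> total_variation M N"
  proof (rule integral_diff_le_total_variation_unit[OF M N sets])
    show "(\<lambda>x. (h x + B) / (2 * B)) \<in> borel_measurable N" using h(1) by measurable
    show "0 \<le> (h x + B) / (2 * B)" "(h x + B) / (2 * B) \<le> 1" for x
      using h(2)[of x] B by (auto simp: field_simps abs_le_iff)
  qed
  have "(\<integral>x. (h x + B) / (2 * B) \<partial>M) - (\<integral>x. (h x + B) / (2 * B) \<partial>N)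
      = ((\<integral>x. h x \<partial>M) - (\<integral>x. h x \<partial>N)) / (2 * B)"
    using int by (simp add: M.prob_space N.prob_space diff_divide_distrib[symmetric])
  then show ?thesis using * B by (simp add: abs_divide field_simps)
qed

text \<open>The strong Markov property of an i.i.d. sequence, in the form used to restart the billiard.\<close>

lemma (in sequence_space) distr_comb_seq_stopping:
  assumes N[measurable]: "N \<in> S \<rightarrow>\<^sub>M count_space (UNIV :: nat set)"
    and G: "AE u in S. G u" and [measurable]: "Measurable.pred S G"
    and stop: "\<And>u u'. G u \<Longrightarrow> G (comb_seq (N u) u u') \<Longrightarrow> N (comb_seq (N u) u u') = N u"
  shows "(\<lambda>(u, u'). comb_seq (N u) u u') \<in> S \<Otimes>\<^sub>M S \<rightarrow>\<^sub>M S"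
    "distr (S \<Otimes>\<^sub>M S) S (\<lambda>(u, u'). comb_seq (N u) u u') = S"
proof -
  interpret S: prob_space S by (rule P.prob_space_axioms)
  interpret SS: pair_prob_space S S ..
  show m[measurable]: "(\<lambda>(u, u'). comb_seq (N u) u u') \<in> S \<Otimes>\<^sub>M S \<rightarrow>\<^sub>M S"
    unfolding split_beta'
    by (rule measurable_compose_countable[where g = "\<lambda>p. N (fst p)" and f = "\<lambda>n p. comb_seq n (fst p) (snd p)"])
      measurable
  have G1: "AE p in S \<Otimes>\<^sub>M S. G (fst p)"
    using G by (intro SS.AE_pair_measure) auto
  have G2: "AE p in S \<Otimes>\<^sub>M S. G (comb_seq n (fst p) (snd p))" for n
  proof -
    have "AE u in distr (S \<Otimes>\<^sub>M S) S (\<lambda>(u, u'). comb_seq n u u'). G u"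
      unfolding PiM_comb_seq by (rule G)
    then show ?thesis by (subst (asm) AE_distr_iff) (auto simp: split_beta' intro: measurable_comb_seq)
  qed
  \<comment> \<open>A sequence is recovered by gluing its own tail onto the glued sequence; this
    yields the converse half of the next equivalence.\<close>
  have swap: "comb_seq n (comb_seq n u u') (\<lambda>i. u (n + i)) = u" for n and u u' :: "nat \<Rightarrow> 'a"
    by (auto simp: comb_seq_def)
  have iff: "AE p in S \<Otimes>\<^sub>M S. N (fst p) = n \<longleftrightarrow> N (comb_seq n (fst p) (snd p)) = n" for n
    using G1 G2[of n]
  proof eventually_elim
    case (elim p)
    show ?case
    proof
      assume "N (fst p) = n"
      then show "N (comb_seq n (fst p) (snd p)) = n" using stop[of "fst p" "snd p"] elim by auto
    next
      assume n: "N (comb_seq n (fst p) (snd p)) = n"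
      show "N (fst p) = n"
        using stop[of "comb_seq n (fst p) (snd p)" "\<lambda>i. fst p (n + i)"] elim by (simp add: n swap)
    qed
  qed
  show "distr (S \<Otimes>\<^sub>M S) S (\<lambda>(u, u'). comb_seq (N u) u u') = S"
  proof (rule measure_eqI)
    fix A assume "A \<in> sets (distr (S \<Otimes>\<^sub>M S) S (\<lambda>(u, u'). comb_seq (N u) u u'))"
    then have A[measurable]: "A \<in> sets S" by simp
    have sum: "(\<Sum>n. of_bool (k = n) * f n) = f k" for k :: nat and f :: "nat \<Rightarrow> ennreal"
      by (subst suminf_finite[of "{k}"]) auto
    have "emeasure (distr (S \<Otimes>\<^sub>M S) S (\<lambda>(u, u'). comb_seq (N u) u u')) A
        = (\<integral>\<^sup>+u. indicator A u \<partial>distr (S \<Otimes>\<^sub>M S) S (\<lambda>(u, u'). comb_seq (N u) u u'))"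
      by (subst nn_integral_indicator) auto
    also have "\<dots> = (\<integral>\<^sup>+p. indicator A (comb_seq (N (fst p)) (fst p) (snd p)) \<partial>(S \<Otimes>\<^sub>M S))"
      by (subst nn_integral_distr) (auto simp: split_beta')
    \<comment> \<open>Splitting by the value of \<open>N\<close> reduces to gluing at a constant
      index, which preserves the product measure.\<close>
    also have "\<dots> = (\<integral>\<^sup>+p. (\<Sum>n. of_bool (N (fst p) = n) * indicator A (comb_seq n (fst p) (snd p))) \<partial>(S \<Otimes>\<^sub>M S))"
      by (simp add: sum)
    also have "\<dots> = (\<Sum>n. \<integral>\<^sup>+p. of_bool (N (fst p) = n) * indicator A (comb_seq n (fst p) (snd p)) \<partial>(S \<Otimes>\<^sub>M S))"
      by (intro nn_integral_suminf) measurable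
    also have "\<dots> = (\<Sum>n. \<integral>\<^sup>+p. of_bool (N (comb_seq n (fst p) (snd p)) = n) * indicator A (comb_seq n (fst p) (snd p)) \<partial>(S \<Otimes>\<^sub>M S))"
    proof (intro suminf_cong nn_integral_cong_AE)
      fix n show "AE p in S \<Otimes>\<^sub>M S. of_bool (N (fst p) = n) * indicator A (comb_seq n (fst p) (snd p)) =
        (of_bool (N (comb_seq n (fst p) (snd p)) = n) * indicator A (comb_seq n (fst p) (snd p)) :: ennreal)"
        using iff[of n] by eventually_elim simp
    qed
    also have "\<dots> = (\<Sum>n. \<integral>\<^sup>+u. of_bool (N u = n) * indicator A u \<partial>distr (S \<Otimes>\<^sub>M S) S (\<lambda>(u, u'). comb_seq n u u'))"
      by (intro suminf_cong, subst nn_integral_distr) (auto simp: split_beta' intro: measurable_comb_seq)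
    also have "\<dots> = (\<Sum>n. \<integral>\<^sup>+u. of_bool (N u = n) * indicator A u \<partial>S)"
      unfolding PiM_comb_seq ..
    also have "\<dots> = (\<integral>\<^sup>+u. (\<Sum>n. of_bool (N u = n) * indicator A u) \<partial>S)"
      by (intro nn_integral_suminf[symmetric]) measurable
    also have "\<dots> = emeasure S A" by (simp only: sum) simp
    finally show "emeasure (distr (S \<Otimes>\<^sub>M S) S (\<lambda>(u, u'). comb_seq (N u) u u')) A = emeasure S A" .
  qed simp
qed

text \<open>Separates probability from geometry: of the shape of the boundary only
  \<open>reflect\<close> is retained, by which a reflection at a point of \<open>R\<close> almost
  surely sends the particle into \<open>D\<close> and on to a point of \<open>R\<close>
  again.\<close>

locale flight_process =
  fixes D R :: "'a::euclidean_space set" and U :: "'a \<Rightarrow> 'a \<Rightarrow>\<^sub>L 'a" and \<rho> :: "'a measure"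
  assumes open_D: "open D" and bounded_D: "bounded D"
    and R_borel [measurable]: "R \<in> sets borel" and R_frontier: "R \<subseteq> frontier D"
    and U_borel: "U \<in> borel_measurable borel"
    and prob_\<rho>: "prob_space \<rho>" and sets_\<rho> [measurable_cong]: "sets \<rho> = sets borel"
    and reflect: "\<And>y. y \<in> R \<Longrightarrow> AE u in \<rho>. (y, blinfun_apply (U y) u) \<in> in_flight D R"
begin

abbreviation "Q \<equiv> PiM (UNIV :: nat set) (\<lambda>_. \<rho>)"

abbreviation "good \<equiv> in_flight D R"

abbreviation "fl \<equiv> flight D U"

lemma D_borel [measurable]: "D \<in> sets borel" using open_D by simp

sublocale sequence_space \<rho>
  by (simp add: sequence_space_def product_prob_space_def product_prob_space_axioms_def
      product_sigma_finite_def prob_\<rho> prob_space_imp_sigma_finite)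

sublocale \<rho>: prob_space \<rho> by (rule prob_\<rho>)

sublocale \<rho>Q: pair_prob_space \<rho> Q ..

sublocale QQ: pair_prob_space Q Q ..

lemma sets_Q [measurable_cong]: "sets Q = sets borel_seq"
  by (intro sets_PiM_cong) (simp_all add: sets_\<rho>)

lemmas [measurable] = measurable_leg[OF U_borel] measurable_leg_time[OF U_borel]
  measurable_leg_index[OF U_borel] measurable_flight[OF U_borel]

lemma good_borel [measurable]: "good \<in> sets borel" by measurable

lemma pred_proper [measurable]:
  assumes [measurable]: "f \<in> M \<rightarrow>\<^sub>M borel" "g \<in> M \<rightarrow>\<^sub>M borel_seq"
  shows "Measurable.pred M (\<lambda>w. proper_path D R U (f w) (g w))"
    "Measurable.pred M (\<lambda>w. regular_path D R U (f w) (g w))"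
  by (intro pred_proper_path[OF U_borel]; measurable)+

text \<open>The first direction is split off the sequence, and the induction hypothesis is applied
  at the random state after the first reflection; therefore the start varies in the
  induction.\<close>

lemma AE_regular_path:
  assumes z: "z \<in> good"
  shows "AE u in Q. regular_path D R U z u"
proof -
  have "AE u in Q. leg D U z u n \<in> good" if "z \<in> good" for n z
    using that
  proof (induction n arbitrary: z)
    case (Suc n)
    let ?y = "exit_point D (fst z) (snd z)"
    have y: "?y \<in> R" using Suc.prems by (auto simp: in_flight_def)
    have *: "leg D U z u (Suc n) = leg D U (?y, blinfun_apply (U ?y) (u 0)) (\<lambda>i. u (Suc i)) n" for u
      using leg_add[of D U z u 1 n] by (simp add: Let_def)
    have [measurable]: "(\<lambda>s. blinfun_apply (U ?y) s) \<in> borel_measurable borel"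
      by (intro borel_measurable_continuous_onI continuous_intros)
    have "AE s in \<rho>. AE u in Q. leg D U (?y, blinfun_apply (U ?y) s) u n \<in> good"
      using reflect[OF y] by eventually_elim (rule Suc.IH)
    then have "AE p in \<rho> \<Otimes>\<^sub>M Q. leg D U (?y, blinfun_apply (U ?y) (fst p)) (snd p) n \<in> good"
      by (intro \<rho>Q.AE_pair_measure) auto
    then have "AE p in \<rho> \<Otimes>\<^sub>M Q. leg D U z (case_nat (fst p) (snd p)) (Suc n) \<in> good"
      by (simp add: * del: leg.simps)
    then have "AE u in distr (\<rho> \<Otimes>\<^sub>M Q) Q (\<lambda>(s, \<omega>). case_nat s \<omega>). leg D U z u (Suc n) \<in> good"
      by (subst AE_distr_iff) (auto simp: split_beta' simp del: leg.simps)
    then show ?case unfolding PiM_iter .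
  qed simp
  then show ?thesis unfolding regular_path_def using z by (simp add: AE_all_countable)
qed

end

text \<open>A state on the boundary can be moved along its first leg into the domain, where the
  mixing hypothesis applies. No reflection happens meanwhile, so the directions stay the
  same.\<close>

lemma
  assumes R: "R \<subseteq> frontier D" and z: "(x, v) \<in> in_flight D R" and r: "0 \<le> r" "r < exit_time D x v"
  shows proper_path_advance: "proper_path D R U (x + r *\<^sub>R v, v) u \<Longrightarrow> proper_path D R U (x, v) u"
    and flight_advance: "proper_path D R U (x, v) u \<Longrightarrow> s \<ge> 0 \<Longrightarrow>
      flight D U (x, v) u (r + s) = flight D U (x + r *\<^sub>R v, v) u s"
proof -
  note adv = in_flight_advance[OF z R r]
  have lg: "leg D U (x + r *\<^sub>R v, v) u (Suc n) = leg D U (x, v) u (Suc n)" for n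
    by (induction n) (simp_all add: adv Let_def)
  have lt: "leg_time D U (x + r *\<^sub>R v, v) u (Suc n) = leg_time D U (x, v) u (Suc n) - r" for n
    by (induction n) (simp_all add: leg_time_Suc adv lg del: leg.simps(2))
  show "proper_path D R U (x, v) u" if p: "proper_path D R U (x + r *\<^sub>R v, v) u"
    unfolding proper_path_def regular_path_def
  proof (intro conjI allI)
    fix n show "leg D U (x, v) u n \<in> in_flight D R"
    proof (cases n)
      case (Suc m)
      then show ?thesis
        using proper_pathD(1)[OF p] unfolding regular_path_def Suc lg[symmetric] by blast
    qed (use z in simp)
  next
    fix k :: nat
    obtain n where "real k < leg_time D U (x + r *\<^sub>R v, v) u (Suc n)" using proper_pathD(2)[OF p] by blast
    then have "real k < leg_time D U (x, v) u (Suc n)" using r by (simp add: lt)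
    then show "\<exists>n. real k < leg_time D U (x, v) u n" by blast
  qed
  assume p: "proper_path D R U (x, v) u" and s: "s \<ge> 0"
  have "leg_index D U (x, v) u r = 0"
    using r by (intro leg_index_proper(3)[OF p]) (simp_all add: leg_time_Suc)
  then show "flight D U (x, v) u (r + s) = flight D U (x + r *\<^sub>R v, v) u s"
    using flight_restart[OF R p r(1) s] by (simp add: flight_def[of D U "(x, v)" u r])
qed

text \<open>Mixing is postulated from interior positions because a billiard started on the boundary
  draws its own velocity: a boundary point with a prescribed outgoing velocity is not one of its
  initial conditions.\<close>

locale ergodic_flight = flight_process D R U \<rho>
  for D R :: "'a::euclidean_space set" and U :: "'a \<Rightarrow> 'a \<Rightarrow>\<^sub>L 'a" and \<rho> :: "'a measure" +
  fixes chi :: "('a \<times> 'a) measure" and C c :: real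
  assumes prob_chi: "prob_space chi" and sets_chi [measurable_cong]: "sets chi = sets borel"
    and chi_domain: "emeasure chi (D \<times> unit_sphere) = 1"
    and C_pos: "C > 0" and c_pos: "c > 0"
    and ergodic: "\<And>z t. z \<in> in_flight D R \<Longrightarrow> fst z \<in> D \<Longrightarrow> t \<ge> 0 \<Longrightarrow>
      total_variation (distr (PiM UNIV (\<lambda>_. \<rho>)) borel (\<lambda>u. flight D U z u t)) chi \<le> C * exp (- c * t)"
begin

sublocale chi: prob_space chi by (rule prob_chi)

lemma prob_distr_flight: "prob_space (distr Q borel (\<lambda>u. fl z u t))"
  by (intro P.prob_space_distr) measurable

text \<open>If infinitely many reflections happened before a finite time, then the junk value of the index would make
  the particle leave the bounded set \<open>D\<close> eventually, whereas \<open>chi\<close> is carried by \<open>D\<close>.\<close>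

lemma AE_proper_path_interior:
  assumes z: "z \<in> good" and zD: "fst z \<in> D"
  shows "AE u in Q. proper_path D R U z u"
proof -
  obtain b where b: "b > 0" "\<And>y. y \<in> closure D \<Longrightarrow> norm y \<le> b"
    using bounded_closure[OF bounded_D] bounded_pos by blast
  define B where "B k = {u \<in> space Q. regular_path D R U z u \<and> (\<forall>n. leg_time D U z u n \<le> real k)}" for k :: nat
  have B[measurable]: "B k \<in> sets Q" for k unfolding B_def by measurable
  have le: "measure Q (B k) \<le> C * exp (- c * t)" if t: "t \<ge> real k + 2 * b + 1" for k t
  proof -
    \<comment> \<open>The default leg starts on the boundary, at norm at most \<open>b\<close>, and
      not after time \<open>k\<close>. At time \<open>t\<close> the extrapolated position is at
      distance at least \<open>2 * b + 1\<close> from there, hence outside \<open>D\<close>.\<close>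
    have out: "fl z u t \<notin> D \<times> unit_sphere" if u: "u \<in> B k" for u
    proof -
      define m where "m = (THE n::nat. False)"
      obtain x v where xv: "leg D U z u (Suc m) = (x, v)" by fastforce
      have T: "leg_time D U z u n \<le> real k" for n using u by (auto simp: B_def)
      have reg: "leg D U z u n \<in> good" for n using u by (auto simp: B_def regular_path_def)
      have "exit_point D (fst (leg D U z u m)) (snd (leg D U z u m)) \<in> R"
        using reg[of m] by (auto simp: in_flight_def)
      then have "x \<in> closure D"
        using xv R_frontier by (auto simp: Let_def frontier_def)
      then have x: "norm x \<le> b" by (rule b(2))
      have v: "norm v = 1" using reg[of "Suc m"] unfolding xv by (simp add: in_flight_def)
      have "\<not> t < leg_time D U z u (Suc n)" for n using T[of "Suc n"] t b(1) by linarith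
      then have "leg_index D U z u t = Suc m" by (simp add: leg_index_def m_def)
      then have f: "fl z u t = (x + (t - leg_time D U z u (Suc m)) *\<^sub>R v, v)"
        by (simp add: flight_def xv del: leg.simps)
      have "t - leg_time D U z u (Suc m) \<ge> 2 * b + 1" using T[of "Suc m"] t by linarith
      then have "norm ((t - leg_time D U z u (Suc m)) *\<^sub>R v) \<ge> 2 * b + 1" using v b(1) by simp
      then have "norm (x + (t - leg_time D U z u (Suc m)) *\<^sub>R v) > b"
        using norm_triangle_ineq2[of "(t - leg_time D U z u (Suc m)) *\<^sub>R v" "- x"] x b(1) by (simp add: add.commute)
      then have "x + (t - leg_time D U z u (Suc m)) *\<^sub>R v \<notin> D" using b(2) closure_subset[of D] by force
      then show ?thesis by (simp add: f)
    qed
    have DS[measurable]: "D \<times> unit_sphere \<in> sets (borel :: ('a \<times> 'a) measure)"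
      using open_D by (intro borel_Times) auto
    let ?E = "{u \<in> space Q. fl z u t \<in> D \<times> unit_sphere}"
    have E[measurable]: "?E \<in> sets Q" by measurable
    have disj: "B k \<inter> ?E = {}"
    proof (rule equals0I)
      fix u assume "u \<in> B k \<inter> ?E"
      then show False using out[of u] by simp
    qed
    have "measure Q (B k) + measure Q ?E = measure Q (B k \<union> ?E)"
      by (rule P.finite_measure_Union[symmetric, OF B E disj])
    also have "\<dots> \<le> 1" by (rule P.prob_le_1)
    finally have 1: "measure Q (B k) + measure Q ?E \<le> 1" .
    \<comment> \<open>Since \<open>chi\<close> gives full mass to
      \<open>D \<times> unit_sphere\<close>, the mass missing because of \<open>B k\<close> is at
      most the total variation distance, which vanishes as \<open>t\<close> grows.\<close>
    have "measure (distr Q borel (\<lambda>u. fl z u t)) (D \<times> unit_sphere) = measure Q ?E"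
      by (subst measure_distr) (auto intro!: arg_cong2[where f = measure])
    moreover have "measure chi (D \<times> unit_sphere) = 1" using chi_domain by (simp add: measure_def)
    ultimately have "\<bar>measure Q ?E - 1\<bar> \<le> total_variation (distr Q borel (\<lambda>u. fl z u t)) chi"
      using measure_le_total_variation[OF prob_distr_flight prob_chi, of "D \<times> unit_sphere" z t] sets_chi DS by simp
    also have "\<dots> \<le> C * exp (- c * t)" using t b(1) by (intro ergodic z zD) simp
    finally show ?thesis using 1 by linarith
  qed
  have zero: "measure Q (B k) = 0" for k
  proof -
    have "(\<lambda>n. C * exp (- c) ^ n) \<longlonglongrightarrow> C * 0"
      using c_pos by (intro tendsto_mult tendsto_const LIMSEQ_power_zero) simp
    then have "(\<lambda>n. C * exp (- c * real n)) \<longlonglongrightarrow> 0"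
      by (simp add: exp_of_nat_mult[symmetric] mult.commute)
    moreover obtain n0 :: nat where "real k + 2 * b + 1 \<le> real n0" using real_arch_simple by blast
    then have "eventually (\<lambda>n. measure Q (B k) \<le> C * exp (- c * real n)) sequentially"
      by (intro eventually_sequentiallyI[of n0] le) (auto intro: order_trans)
    ultimately have "measure Q (B k) \<le> 0"
      using tendsto_lowerbound by fastforce
    then show ?thesis using measure_nonneg[of Q "B k"] by linarith
  qed
  have "AE u in Q. u \<notin> B k" for k
    using zero[of k] by (intro AE_not_in null_setsI) (auto simp: P.emeasure_eq_measure)
  then have "AE u in Q. \<forall>k. u \<notin> B k" by (simp add: AE_all_countable)
  with AE_regular_path[OF z] AE_space show ?thesis
    by eventually_elim (auto simp: B_def proper_path_def not_le)
qed

lemma AE_proper_path: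
  assumes z: "z \<in> good"
  shows "AE u in Q. proper_path D R U z u"
proof -
  obtain x v where xv: "z = (x, v)" by fastforce
  let ?r = "exit_time D x v / 2"
  have r: "0 < ?r" "?r < exit_time D x v" using z by (auto simp: xv in_flight_def)
  have "AE u in Q. proper_path D R U (x + ?r *\<^sub>R v, v) u"
    using in_flight_advance(3)[OF z[unfolded xv] R_frontier, of ?r] r in_flight_segment[OF z[unfolded xv] r]
    by (intro AE_proper_path_interior) auto
  then show ?thesis
    unfolding xv
    by eventually_elim (rule proper_path_advance[OF R_frontier z[unfolded xv]], use r in auto)
qed

text \<open>The state is first advanced by at most one time unit into the interior; the time thus
  lost accounts for the factor \<open>exp c\<close> and the restriction to
  \<open>t \<ge> 1\<close>.\<close>

lemma ergodic_good:
  assumes z: "z \<in> good" and t: "t \<ge> 1"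
  shows "total_variation (distr Q borel (\<lambda>u. fl z u t)) chi \<le> C * exp c * exp (- c * t)"
proof -
  obtain x v where xv: "z = (x, v)" by fastforce
  define r where "r = min (exit_time D x v / 2) 1"
  have r: "0 < r" "r < exit_time D x v" "r \<le> 1" using z by (auto simp: xv r_def in_flight_def)
  have "AE u in Q. fl z u t = fl (x + r *\<^sub>R v, v) u (t - r)"
    using AE_proper_path[OF z]
  proof eventually_elim
    case (elim u)
    then show ?case
      using flight_advance[OF R_frontier z[unfolded xv], of r U u "t - r"] r t by (simp add: xv)
  qed
  then have "distr Q borel (\<lambda>u. fl z u t) = distr Q borel (\<lambda>u. fl (x + r *\<^sub>R v, v) u (t - r))"
    by (intro distr_cong_AE) auto
  also have "total_variation \<dots> chi \<le> C * exp (- c * (t - r))"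
    using in_flight_advance(3)[OF z[unfolded xv] R_frontier, of r] r t in_flight_segment[OF z[unfolded xv], of r]
    by (intro ergodic) auto
  also have "\<dots> \<le> C * (exp c * exp (- c * t))"
    using C_pos c_pos r by (intro mult_left_mono) (auto simp: exp_add[symmetric] algebra_simps)
  finally show ?thesis by (simp add: mult.assoc)
qed

lemma flight_0:
  assumes "z \<in> good"
  shows "fl z u 0 = z"
proof -
  have "0 < leg_time D U z u (Suc 0)" using assms by (auto simp: leg_time_Suc in_flight_def)
  then have "leg_index D U z u 0 = 0" unfolding leg_index_def by (auto intro!: Least_equality)
  then show ?thesis by (simp add: flight_def)
qed

lemma AE_flight_good:
  assumes "z \<in> good" "t \<ge> 0"
  shows "AE u in Q. fl z u t \<in> good"
  using AE_proper_path[OF assms(1)] by eventually_elim (rule flight_in_flight[OF R_frontier _ assms(2)])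

text \<open>The leg index at time \<open>t\<close> is a stopping time on proper paths, so replacing
  all directions from that index on by an independent copy leaves the law of the sequence unchanged.
  Proper paths being of full measure, the original and the glued path are almost surely both
  proper.\<close>

lemma
  assumes z: "z \<in> good" and t: "t \<ge> 0"
  shows measurable_resample: "(\<lambda>p. comb_seq (leg_index D U z (fst p) t) (fst p) (snd p)) \<in> Q \<Otimes>\<^sub>M Q \<rightarrow>\<^sub>M Q"
    and distr_resample: "distr (Q \<Otimes>\<^sub>M Q) Q (\<lambda>p. comb_seq (leg_index D U z (fst p) t) (fst p) (snd p)) = Q"
    and AE_resample: "AE u in Q. AE u' in Q. proper_path D R U z u \<and>
          proper_path D R U z (comb_seq (leg_index D U z u t) u u')"
proof -
  let ?N = "\<lambda>u. leg_index D U z u t" and ?G = "proper_path D R U z"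
  have N: "?N \<in> Q \<rightarrow>\<^sub>M count_space UNIV" and G[measurable]: "Measurable.pred Q ?G" by measurable
  have stop: "?N (comb_seq (?N u) u u') = ?N u" if "?G u" "?G (comb_seq (?N u) u u')" for u u'
    using leg_index_comb_seq(1)[OF that(1) t refl that(2)] .
  show m[measurable]: "(\<lambda>p. comb_seq (?N (fst p)) (fst p) (snd p)) \<in> Q \<Otimes>\<^sub>M Q \<rightarrow>\<^sub>M Q"
    using distr_comb_seq_stopping(1)[OF N AE_proper_path[OF z] G stop] by (simp add: split_beta')
  show d: "distr (Q \<Otimes>\<^sub>M Q) Q (\<lambda>p. comb_seq (?N (fst p)) (fst p) (snd p)) = Q"
    using distr_comb_seq_stopping(2)[OF N AE_proper_path[OF z] G stop] by (simp add: split_beta')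
  have "AE u in distr (Q \<Otimes>\<^sub>M Q) Q (\<lambda>p. comb_seq (?N (fst p)) (fst p) (snd p)). ?G u"
    unfolding d using AE_proper_path[OF z] .
  then have "AE p in Q \<Otimes>\<^sub>M Q. ?G (comb_seq (?N (fst p)) (fst p) (snd p))"
    by (subst (asm) AE_distr_iff) auto
  then have "AE u in Q. AE u' in Q. ?G (comb_seq (?N u) u u')"
    using QQ.AE_pair[where Q = "\<lambda>p. ?G (comb_seq (?N (fst p)) (fst p) (snd p))"] by simp
  with AE_proper_path[OF z] show "AE u in Q. AE u' in Q. ?G u \<and> ?G (comb_seq (?N u) u u')"
    by eventually_elim auto
qed

text \<open>The Markov property in integrated form: \<open>H'\<close> is \<open>H\<close> rewritten
  through the directions \<open>u\<close> of the past and a fresh sequence \<open>u'\<close>. The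
  rewriting is only demanded when both paths are proper, which is almost surely the case.\<close>

lemma resample:
  fixes H :: "(nat \<Rightarrow> 'a) \<Rightarrow> 'b::{banach, second_countable_topology}"
  assumes z: "z \<in> good" and t: "t \<ge> 0"
    and H[measurable]: "H \<in> borel_measurable Q" and bound: "\<And>u. norm (H u) \<le> K"
    and cong: "\<And>u u'. proper_path D R U z u \<Longrightarrow> proper_path D R U z (comb_seq (leg_index D U z u t) u u')
        \<Longrightarrow> H (comb_seq (leg_index D U z u t) u u') = H' u u'"
    and H'[measurable]: "(\<lambda>p. H' (fst p) (snd p)) \<in> borel_measurable (Q \<Otimes>\<^sub>M Q)"
  shows "(\<integral>u. H u \<partial>Q) = (\<integral>u. \<integral>u'. H' u u' \<partial>Q \<partial>Q)"
proof -
  let ?w = "\<lambda>p. comb_seq (leg_index D U z (fst p) t) (fst p) (snd p)"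
  note m[measurable] = measurable_resample[OF z t]
  have "(\<integral>u. H u \<partial>Q) = (\<integral>u. H u \<partial>distr (Q \<Otimes>\<^sub>M Q) Q ?w)"
    unfolding distr_resample[OF z t] ..
  also have "\<dots> = (\<integral>p. H (?w p) \<partial>(Q \<Otimes>\<^sub>M Q))"
    by (subst integral_distr) auto
  also have "\<dots> = (\<integral>u. \<integral>u'. H (?w (u, u')) \<partial>Q \<partial>Q)"
    by (intro QQ.integral_fst'[symmetric] QQ.P.integrable_const_bound[where B = K]) (auto simp: bound)
  also have "\<dots> = (\<integral>u. \<integral>u'. H' u u' \<partial>Q \<partial>Q)"
  proof (rule integral_cong_AE)
    have 1: "(\<lambda>p. H (?w p)) \<in> borel_measurable (Q \<Otimes>\<^sub>M Q)" by measurable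
    show "(\<lambda>u. \<integral>u'. H (?w (u, u')) \<partial>Q) \<in> borel_measurable Q"
      using 1 by (intro P.borel_measurable_lebesgue_integral) (simp add: split_beta')
    show "(\<lambda>u. \<integral>u'. H' u u' \<partial>Q) \<in> borel_measurable Q"
      using H' by (intro P.borel_measurable_lebesgue_integral) (simp add: split_beta')
    show "AE u in Q. (\<integral>u'. H (?w (u, u')) \<partial>Q) = (\<integral>u'. H' u u' \<partial>Q)"
      using AE_resample[OF z t] AE_space
    proof eventually_elim
      case (elim u)
      have "(\<lambda>u'. H (?w (u, u'))) \<in> borel_measurable Q"
        using measurable_Pair2[OF 1 elim(2)] .
      moreover have "(\<lambda>u'. H' u u') \<in> borel_measurable Q"
        using measurable_Pair2[OF H' elim(2)] by simp
      moreover have "AE u' in Q. H (?w (u, u')) = H' u u'"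
        using elim(1) by eventually_elim (simp add: cong)
      ultimately show ?case by (rule integral_cong_AE)
    qed
  qed
  finally show ?thesis .
qed

lemma semigroup:
  fixes h :: "'a \<times> 'a \<Rightarrow> real"
  assumes z: "z \<in> good" and t: "t \<ge> 0" "s \<ge> 0"
    and [measurable]: "h \<in> borel_measurable borel" and bound: "\<And>z. \<bar>h z\<bar> \<le> K"
  shows "(\<integral>u. h (fl z u (t + s)) \<partial>Q) = (\<integral>u. \<integral>u'. h (fl (fl z u t) u' s) \<partial>Q \<partial>Q)"
  using bound
  by (intro resample[OF z t(1), where K = K]) (auto simp: flight_comb_seq[OF R_frontier _ t(1) refl _ t(2)])

lemma mixing:
  fixes h :: "'a \<times> 'a \<Rightarrow> real"
  assumes z: "z \<in> good" and t: "t \<ge> 1"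
    and [measurable]: "h \<in> borel_measurable borel" and bound: "\<And>z. \<bar>h z\<bar> \<le> K" and K: "K > 0"
  shows "\<bar>(\<integral>u. h (fl z u t) \<partial>Q) - (\<integral>z. h z \<partial>chi)\<bar> \<le> 2 * K * (C * exp c) * exp (- c * t)"
proof -
  have "\<bar>(\<integral>y. h y \<partial>distr Q borel (\<lambda>u. fl z u t)) - (\<integral>z. h z \<partial>chi)\<bar>
      \<le> 2 * K * total_variation (distr Q borel (\<lambda>u. fl z u t)) chi"
    by (rule integral_diff_le_total_variation[OF prob_distr_flight prob_chi _ _ bound K]) (simp_all add: sets_chi)
  also have "\<dots> \<le> 2 * K * (C * exp c * exp (- c * t))"
    using ergodic_good[OF z t] K by (intro mult_left_mono) auto
  finally show ?thesis by (simp add: integral_distr mult.assoc)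
qed

text \<open>The solution of the Poisson equation is the sum of the iterated transition operators applied to \<open>a\<close>.\<close>

lemma poisson_equation:
  fixes a :: "'a \<times> 'a \<Rightarrow> real"
  assumes a[measurable]: "a \<in> borel_measurable borel" and bound: "\<And>z. \<bar>a z\<bar> \<le> K"
    and centered: "(\<integral>z. a z \<partial>chi) = 0"
  obtains g G where "g \<in> borel_measurable borel" "G > 0" "\<And>z. \<bar>g z\<bar> \<le> (G::real)"
    "\<And>z. z \<in> good \<Longrightarrow> g z = a z + (\<integral>u. g (fl z u 1) \<partial>Q)"
proof -
  have K: "K \<ge> 0" using bound[of undefined] by linarith
  define K' where "K' = 2 * (K + 1) * (C * exp c) + K + 1"
  have K': "K' > 0" using K C_pos unfolding K'_def by (intro add_nonneg_pos add_nonneg_nonneg mult_nonneg_nonneg) auto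
  define r where "r = exp (- c)"
  have r: "0 < r" "r < 1" using c_pos by (auto simp: r_def)
  define p where "p k z = (\<integral>u. a (fl z u (real k)) \<partial>Q)" for k z
  have p[measurable]: "p k \<in> borel_measurable borel" for k
    unfolding p_def by (intro P.borel_measurable_lebesgue_integral) (simp add: split_beta', measurable)
  have pK: "\<bar>p k z\<bar> \<le> K" for k z
    using bound unfolding p_def
    by (intro order_trans[OF integral_abs_bound] P.integral_le_const P.integrable_const_bound[where B = K]) auto
  have p_le: "\<bar>p k z\<bar> \<le> K' * r ^ k" if z: "z \<in> good" for k z
  proof (cases k)
    case 0
    have "0 \<le> 2 * (K + 1) * (C * exp c)" using K C_pos by simp
    then show ?thesis using pK[of k z] 0 by (simp add: K'_def)
  next
    case (Suc m)
    have "\<bar>a z\<bar> \<le> K + 1" for z using bound[of z] by linarith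
    then have "\<bar>p k z\<bar> \<le> 2 * (K + 1) * (C * exp c) * exp (- c * real k)"
      using mixing[OF z, of "real k" a "K + 1"] centered Suc K by (simp add: p_def)
    also have "\<dots> \<le> K' * exp (- c * real k)" using K by (intro mult_right_mono) (auto simp: K'_def)
    also have "exp (- c * real k) = r ^ k" by (simp add: r_def exp_of_nat_mult[symmetric] mult.commute)
    finally show ?thesis .
  qed
  \<comment> \<open>Cutting off outside \<open>good\<close> makes the geometric bound hold for all
    arguments, hence also the bound on \<open>g\<close>.\<close>
  define q where "q k z = indicator good z * p k z" for k z
  have q[measurable]: "q k \<in> borel_measurable borel" for k unfolding q_def by measurable
  have q_le: "\<bar>q k z\<bar> \<le> K' * r ^ k" for k z
    using p_le[of z k] K' r by (auto simp: q_def indicator_def)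
  have sumr: "summable (\<lambda>k. K' * r ^ k)" using r by (intro summable_mult summable_geometric) simp
  have sumq: "summable (\<lambda>k. \<bar>q k z\<bar>)" for z
    by (rule summable_comparison_test_ev[OF _ sumr]) (simp add: q_le)
  define g where "g z = (\<Sum>k. q k z)" for z
  have [measurable]: "g \<in> borel_measurable borel" unfolding g_def by measurable
  have gG: "\<bar>g z\<bar> \<le> (\<Sum>k. K' * r ^ k)" for z
    unfolding g_def by (rule order_trans[OF summable_rabs[OF sumq] suminf_le[OF q_le sumq sumr]])
  have eq: "g z = a z + (\<integral>u. g (fl z u 1) \<partial>Q)" if z: "z \<in> good" for z
  proof -
    have step: "(\<integral>u. q k (fl z u 1) \<partial>Q) = p (Suc k) z" for k
    proof -
      have "(\<integral>u. q k (fl z u 1) \<partial>Q) = (\<integral>u. p k (fl z u 1) \<partial>Q)"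
      proof (rule integral_cong_AE)
        show "AE u in Q. q k (fl z u 1) = p k (fl z u 1)"
          using AE_flight_good[OF z zero_le_one] by eventually_elim (simp add: q_def)
      qed measurable
      also have "\<dots> = p (Suc k) z"
        unfolding p_def using semigroup[OF z, of 1 "real k" a K] bound by (simp add: add.commute)
      finally show ?thesis .
    qed
    have int: "integrable Q (\<lambda>u. q k (fl z u 1))" for k
      using q_le by (intro P.integrable_const_bound[where B = "K' * r ^ k"]) auto
    have "(\<integral>u. g (fl z u 1) \<partial>Q) = (\<Sum>k. \<integral>u. q k (fl z u 1) \<partial>Q)"
      unfolding g_def
    proof (rule integral_suminf[OF int])
      show "AE u in Q. summable (\<lambda>k. norm (q k (fl z u 1)))" using sumq by simp
      show "summable (\<lambda>k. \<integral>u. norm (q k (fl z u 1)) \<partial>Q)"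
      proof (rule summable_comparison_test_ev[OF _ sumr], intro always_eventually allI)
        fix k
        have "(\<integral>u. \<bar>q k (fl z u 1)\<bar> \<partial>Q) \<le> K' * r ^ k"
          using int by (intro P.integral_le_const) (auto simp: q_le)
        then show "norm (\<integral>u. norm (q k (fl z u 1)) \<partial>Q) \<le> K' * r ^ k" by simp
      qed
    qed
    \<comment> \<open>The transition operator shifts the series by one term; the term that is lost
      is \<open>a\<close>.\<close>
    also have "\<dots> = (\<Sum>k. q (Suc k) z)" using z by (simp only: step) (simp add: q_def)
    also have "\<dots> = g z - q 0 z"
      unfolding g_def by (rule suminf_split_head[OF summable_rabs_cancel[OF sumq]])
    also have "q 0 z = a z" using z flight_0[OF z] by (simp add: q_def p_def P.prob_space)
    finally show ?thesis by simp
  qed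
  have "0 < (\<Sum>k. K' * r ^ k)" using K' r by (intro suminf_pos[OF sumr]) auto
  then show ?thesis using that[of g "\<Sum>k. K' * r ^ k"] gG eq by auto
qed

end

section \<open>Central limit theorem for additive functionals\<close>

lemma set_integral_bound_interval:
  fixes g :: "real \<Rightarrow> real"
  assumes [measurable]: "g \<in> borel_measurable borel" and g: "\<And>s. \<bar>g s\<bar> \<le> B"
  shows "set_integrable lborel {a..b} g"
    "a \<le> b \<Longrightarrow> \<bar>LINT s:{a..b}|lborel. g s\<bar> \<le> B * (b - a)"
proof -
  show int: "set_integrable lborel {a..b} g"
    unfolding set_integrable_def
    by (intro integrableI_bounded_set_indicator[where B = B]) (auto simp: g emeasure_lborel_Icc_eq)
  assume ab: "a \<le> b"
  have int': "integrable lborel (\<lambda>s. indicator {a..b} s *\<^sub>R B)"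
    by (intro integrableI_bounded_set_indicator[where B = "\<bar>B\<bar>"]) (auto simp: emeasure_lborel_Icc_eq)
  have "\<bar>LINT s:{a..b}|lborel. g s\<bar> \<le> (\<integral>s. \<bar>indicator {a..b} s *\<^sub>R g s\<bar> \<partial>lborel)"
    unfolding set_lebesgue_integral_def by (rule integral_abs_bound)
  also have "\<dots> \<le> (\<integral>s. indicator {a..b} s *\<^sub>R B \<partial>lborel)"
    using int unfolding set_integrable_def
    by (intro integral_mono integrable_abs int') (auto simp: indicator_def g)
  also have "\<dots> = B * (b - a)" using ab by simp
  finally show "\<bar>LINT s:{a..b}|lborel. g s\<bar> \<le> B * (b - a)" .
qed

lemma set_integral_interval_split:
  fixes g :: "real \<Rightarrow> real"
  assumes [measurable]: "g \<in> borel_measurable borel" and g: "\<And>s. \<bar>g s\<bar> \<le> B" and "a \<le> b" "b \<le> c"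
  shows "(LINT s:{a..c}|lborel. g s) = (LINT s:{a..b}|lborel. g s) + (LINT s:{b..c}|lborel. g s)"
proof -
  have "{a..c} = {a..b} \<union> {b..c}" using assms by auto
  moreover have "AE s in lborel. \<not> (s \<in> {a..b} \<and> s \<in> {b..c})"
    using AE_lborel_singleton[of b] by eventually_elim auto
  ultimately show ?thesis
    using set_integral_bound_interval(1)[OF assms(1) g] by (simp add: set_integral_Un_AE)
qed

lemma set_integral_interval_shift:
  fixes g :: "real \<Rightarrow> real"
  shows "(LINT s:{t..t + r}|lborel. g s) = (LINT s:{0..r}|lborel. g (t + s))"
  unfolding set_lebesgue_integral_def
  by (subst lborel_integral_real_affine[where c = 1 and t = t])
     (auto intro!: Bochner_Integration.integral_cong simp: indicator_def)

lemma (in prob_space) expectation_close: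
  fixes I :: "'a \<Rightarrow> complex"
  assumes I: "integrable M I" and le: "AE x in M. cmod (I x - l) \<le> e"
  shows "cmod (expectation I - l) \<le> e"
proof -
  have "expectation I - l = (\<integral>x. I x - l \<partial>M)" using I by (simp add: prob_space)
  also have "cmod \<dots> \<le> (\<integral>x. cmod (I x - l) \<partial>M)" by (rule integral_norm_bound)
  also have "\<dots> \<le> e" using I le by (intro integral_le_const) auto
  finally show ?thesis .
qed

section \<open>The additive functional and its twisted transition operators\<close>

locale additive_functional = ergodic_flight D R U \<rho> chi C c
  for D R :: "'a::euclidean_space set" and U :: "'a \<Rightarrow> 'a \<Rightarrow>\<^sub>L 'a" and \<rho> :: "'a measure" and chi C c +
  fixes f :: "'a \<times> 'a \<Rightarrow> real" and B :: real
  assumes f_borel [measurable]: "f \<in> borel_measurable borel"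
    and f_bound: "\<And>z. \<bar>f z\<bar> \<le> B" and f_centered: "(\<integral>z. f z \<partial>chi) = 0"
begin

definition accum :: "'a \<times> 'a \<Rightarrow> (nat \<Rightarrow> 'a) \<Rightarrow> real \<Rightarrow> real" where
  "accum z u t = (LINT s:{0..t}|lborel. f (fl z u s))"

text \<open>The transition operator over time \<open>t\<close> perturbed by a Fourier weight.
  Applied to the constant 1 it is the characteristic function of \<open>accum\<close> at
  \<epsilon>.\<close>

definition twisted :: "real \<Rightarrow> real \<Rightarrow> ('a \<times> 'a \<Rightarrow> complex) \<Rightarrow> 'a \<times> 'a \<Rightarrow> complex" where
  "twisted \<epsilon> t h z = (\<integral>u. iexp (\<epsilon> * accum z u t) * h (fl z u t) \<partial>Q)"

lemma B_nonneg: "B \<ge> 0" using f_bound[of undefined] by linarith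

lemma measurable_flight_time: "(\<lambda>s. f (fl z u s)) \<in> borel_measurable borel"
  by (rule measurable_compose[OF measurable_flight[OF U_borel] f_borel]) (simp_all add: space_PiM)

lemma measurable_accum [measurable (raw)]:
  assumes [measurable]: "g \<in> M \<rightarrow>\<^sub>M borel" "h \<in> M \<rightarrow>\<^sub>M borel_seq"
  shows "(\<lambda>w. accum (g w) (h w) t) \<in> borel_measurable M"
  unfolding accum_def set_lebesgue_integral_def
  by (intro lborel.borel_measurable_lebesgue_integral) (simp add: split_beta', measurable)

lemma measurable_twisted [measurable]:
  assumes [measurable]: "h \<in> borel_measurable borel"
  shows "twisted \<epsilon> t h \<in> borel_measurable borel"
  unfolding twisted_def
  by (intro P.borel_measurable_lebesgue_integral) (simp add: split_beta', measurable)

lemma accum_bound: "t \<ge> 0 \<Longrightarrow> \<bar>accum z u t\<bar> \<le> B * t"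
  using set_integral_bound_interval(2)[OF measurable_flight_time f_bound, of 0 t] by (simp add: accum_def)

lemma accum_split:
  assumes "0 \<le> t" "0 \<le> s"
  shows "accum z u (t + s) = accum z u t + (LINT r:{0..s}|lborel. f (fl z u (t + r)))"
  unfolding accum_def
  using set_integral_interval_split[OF measurable_flight_time f_bound, of 0 t "t + s"] assms
  by (simp add: set_integral_interval_shift)

lemma accum_comb_seq:
  assumes u: "proper_path D R U z u" and t: "0 \<le> t" and n: "n = leg_index D U z u t"
    and w: "proper_path D R U z (comb_seq n u u')" and s: "0 \<le> s"
  shows "accum z (comb_seq n u u') (t + s) = accum z u t + accum (fl z u t) u' s"
proof -
  let ?w = "comb_seq n u u'"
  have "accum z ?w t = accum z u t"
    unfolding accum_def by (intro set_lebesgue_integral_cong) (auto simp: leg_index_comb_seq(2)[OF u t n w])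
  moreover have "(LINT r:{0..s}|lborel. f (fl z ?w (t + r))) = accum (fl z u t) u' s"
    unfolding accum_def
    by (intro set_lebesgue_integral_cong) (auto simp: flight_comb_seq[OF R_frontier u t n w])
  ultimately show ?thesis using accum_split[OF t s, of z ?w] by simp
qed

lemma twisted_integrable:
  assumes [measurable]: "h \<in> borel_measurable borel" and h: "\<And>z. cmod (h z) \<le> K"
  shows "integrable Q (\<lambda>u. iexp (\<epsilon> * accum z u t) * h (fl z u t))"
  using h by (intro P.integrable_const_bound[where B = K]) (auto simp: norm_mult)

lemma twisted_bound:
  assumes [measurable]: "h \<in> borel_measurable borel" and h: "\<And>z. cmod (h z) \<le> K"
  shows "cmod (twisted \<epsilon> t h z) \<le> K"
  using P.expectation_close[OF twisted_integrable[OF assms, of \<epsilon> z t], of 0 K] h by (simp add: twisted_def norm_mult)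

text \<open>An estimate on \<open>good\<close> suffices because the state at time \<open>t\<close>
  almost surely lies there, and the weight has modulus 1.\<close>

lemma twisted_diff_bound:
  assumes z: "z \<in> good" and t: "t \<ge> 0"
    and [measurable]: "h \<in> borel_measurable borel" "h' \<in> borel_measurable borel"
    and h: "\<And>z. cmod (h z) \<le> K" "\<And>z. cmod (h' z) \<le> K"
    and le: "\<And>z. z \<in> good \<Longrightarrow> cmod (h z - h' z) \<le> e"
  shows "cmod (twisted \<epsilon> t h z - twisted \<epsilon> t h' z) \<le> e"
proof -
  note i = twisted_integrable[OF assms(3) h(1), of \<epsilon> z t] twisted_integrable[OF assms(4) h(2), of \<epsilon> z t]
  let ?d = "\<lambda>u. iexp (\<epsilon> * accum z u t) * h (fl z u t) - iexp (\<epsilon> * accum z u t) * h' (fl z u t)"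
  have eq: "twisted \<epsilon> t h z - twisted \<epsilon> t h' z = (\<integral>u. ?d u \<partial>Q)"
    unfolding twisted_def using i by (rule Bochner_Integration.integral_diff[symmetric])
  have "AE u in Q. cmod (?d u - 0) \<le> e"
    using AE_flight_good[OF z t]
  proof eventually_elim
    case (elim u)
    have "?d u = iexp (\<epsilon> * accum z u t) * (h (fl z u t) - h' (fl z u t))" by (simp add: algebra_simps)
    then show ?case using le[OF elim] by (simp add: norm_mult)
  qed
  from P.expectation_close[OF Bochner_Integration.integrable_diff[OF i] this] show ?thesis
    unfolding eq by simp
qed

lemma twisted_scale: "twisted \<epsilon> t (\<lambda>z. a * h z) z = a * twisted \<epsilon> t h z"
proof -
  have "iexp (\<epsilon> * accum z u t) * (a * h (fl z u t)) = a * (iexp (\<epsilon> * accum z u t) * h (fl z u t))" for u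
    by (simp add: algebra_simps)
  then show ?thesis unfolding twisted_def by (simp only: integral_mult_right_zero)
qed

lemma twisted_0: "z \<in> good \<Longrightarrow> twisted \<epsilon> 0 h z = h z"
  using accum_bound[of 0 z] by (simp add: twisted_def flight_0 P.prob_space)

text \<open>The weight factors because \<open>accum\<close> is additive when the path is restarted
  with fresh directions.\<close>

lemma twisted_semigroup:
  assumes z: "z \<in> good" and t: "0 \<le> t" "0 \<le> s"
    and [measurable]: "h \<in> borel_measurable borel" and h: "\<And>z. cmod (h z) \<le> K"
  shows "twisted \<epsilon> (t + s) h z = twisted \<epsilon> t (twisted \<epsilon> s h) z"
proof -
  have "twisted \<epsilon> (t + s) h z
      = (\<integral>u. \<integral>u'. iexp (\<epsilon> * accum z u t) * (iexp (\<epsilon> * accum (fl z u t) u' s) * h (fl (fl z u t) u' s)) \<partial>Q \<partial>Q)"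
    unfolding twisted_def
  proof (rule resample[OF z t(1), where K = K])
    show "norm (iexp (\<epsilon> * accum z u (t + s)) * h (fl z u (t + s))) \<le> K" for u
      using h by (simp add: norm_mult)
    fix u u'
    assume u: "proper_path D R U z u" "proper_path D R U z (comb_seq (leg_index D U z u t) u u')"
    show "iexp (\<epsilon> * accum z (comb_seq (leg_index D U z u t) u u') (t + s)) * h (fl z (comb_seq (leg_index D U z u t) u u') (t + s))
       = iexp (\<epsilon> * accum z u t) * (iexp (\<epsilon> * accum (fl z u t) u' s) * h (fl (fl z u t) u' s))"
      using accum_comb_seq[OF u(1) t(1) refl u(2) t(2)] flight_comb_seq[OF R_frontier u(1) t(1) refl u(2) t(2)]
      by (simp add: distrib_left exp_add)
  qed measurable
  then show ?thesis by (simp add: twisted_def)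
qed

lemma expectation_accum:
  assumes t: "0 \<le> t"
  shows "(\<integral>u. accum z u t \<partial>Q) = (LINT s:{0..t}|lborel. (\<integral>u. f (fl z u s) \<partial>Q))"
proof -
  interpret F: pair_sigma_finite lborel Q
    by (simp add: pair_sigma_finite_def lborel.sigma_finite_measure_axioms P.sigma_finite_measure_axioms)
  have "integrable (lborel \<Otimes>\<^sub>M Q) (\<lambda>(s, u). indicator {0..t} s *\<^sub>R f (fl z u s))"
  proof -
    have "integrable (lborel \<Otimes>\<^sub>M Q) (\<lambda>p. indicator ({0..t} \<times> space Q) p *\<^sub>R f (fl z (snd p) (fst p)))"
    proof (rule integrableI_bounded_set_indicator[where B = B])
      show "emeasure (lborel \<Otimes>\<^sub>M Q) ({0..t} \<times> space Q) < \<infinity>"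
        using t by (subst P.emeasure_pair_measure_Times) (auto simp: P.emeasure_space_1)
    qed (auto simp: f_bound)
    also have "?this \<longleftrightarrow> integrable (lborel \<Otimes>\<^sub>M Q) (\<lambda>(s, u). indicator {0..t} s *\<^sub>R f (fl z u s))"
      by (intro Bochner_Integration.integrable_cong) (auto simp: space_pair_measure indicator_def)
    finally show ?thesis .
  qed
  from F.Fubini_integral[OF this] show ?thesis
    unfolding accum_def set_lebesgue_integral_def by simp
qed

text \<open>The mean of \<open>accum\<close> over one unit of time, started from the state at time \<open>k\<close>, is an integral
  over \<open>{k..k+1}\<close> of quantities that tend to \<open>chi f = 0\<close>.\<close>

lemma integral_chi_mean_accum:
  assumes z: "z \<in> good"
  shows "(\<integral>z. (\<integral>u. accum z u 1 \<partial>Q) \<partial>chi) = 0"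
proof -
  define a where "a z = (\<integral>u. accum z u 1 \<partial>Q)" for z
  have a[measurable]: "a \<in> borel_measurable borel"
    unfolding a_def by (intro P.borel_measurable_lebesgue_integral) (simp add: split_beta', measurable)
  \<comment> \<open>The extra 1 provides the positive constant that \<open>mixing\<close> asks for,
    also when \<open>B\<close> is 0.\<close>
  have aB: "\<bar>a z\<bar> \<le> B + 1" for z
  proof -
    have "\<bar>accum z u 1\<bar> \<le> B" for u using accum_bound[of 1] by simp
    then have "\<bar>a z\<bar> \<le> B" unfolding a_def
      by (intro order_trans[OF integral_abs_bound] P.integral_le_const P.integrable_const_bound[where B = B]) auto
    then show ?thesis by simp
  qed
  define K where "K = 2 * (B + 1) * (C * exp c)"
  have step: "\<bar>\<integral>u. a (fl z u (real k)) \<partial>Q\<bar> \<le> K * exp (- c * real k)" if k: "k \<ge> 1" for k :: nat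
  proof -
    define e where "e s = (\<integral>u. f (fl z u s) \<partial>Q)" for s
    have e[measurable]: "e \<in> borel_measurable borel"
      unfolding e_def by (intro P.borel_measurable_lebesgue_integral) (simp add: split_beta', measurable)
    have eB: "\<bar>e s\<bar> \<le> B" for s
      unfolding e_def using f_bound
      by (intro order_trans[OF integral_abs_bound] P.integral_le_const P.integrable_const_bound[where B = B]) auto
    have int: "integrable Q (\<lambda>u. accum z u t)" if "t \<ge> 0" for t
      using accum_bound[OF that] by (intro P.integrable_const_bound[where B = "B * t"]) auto
    \<comment> \<open>Comparing the means up to times \<open>k + 1\<close> and \<open>k\<close>
      isolates the unit interval that starts at \<open>k\<close>.\<close>
    have "(\<integral>u. accum z u (real k + 1) \<partial>Q) = (\<integral>u. \<integral>u'. accum z u (real k) + accum (fl z u (real k)) u' 1 \<partial>Q \<partial>Q)"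
      using accum_bound[of "real k + 1"]
      by (intro resample[OF z, of "real k", where K = "B * (real k + 1)"]) (auto simp: accum_comb_seq)
    also have "\<dots> = (\<integral>u. accum z u (real k) + a (fl z u (real k)) \<partial>Q)"
    proof (rule Bochner_Integration.integral_cong[OF refl])
      fix u
      have "integrable Q (\<lambda>u'. accum y u' 1)" for y
        using accum_bound[of 1] by (intro P.integrable_const_bound[where B = B]) auto
      then show "(\<integral>u'. accum z u (real k) + accum (fl z u (real k)) u' 1 \<partial>Q) = accum z u (real k) + a (fl z u (real k))"
        by (simp add: a_def P.prob_space)
    qed
    also have "\<dots> = (\<integral>u. accum z u (real k) \<partial>Q) + (\<integral>u. a (fl z u (real k)) \<partial>Q)"
    proof (rule Bochner_Integration.integral_add)
      show "integrable Q (\<lambda>u. accum z u (real k))" by (rule int) simp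
      show "integrable Q (\<lambda>u. a (fl z u (real k)))"
        using aB by (intro P.integrable_const_bound[where B = "B + 1"]) auto
    qed
    finally have "(\<integral>u. a (fl z u (real k)) \<partial>Q) = (LINT s:{real k..real k + 1}|lborel. e s)"
      using set_integral_interval_split[OF e eB, of 0 "real k" "real k + 1"]
      by (simp add: expectation_accum e_def)
    also have "\<dots> = (LINT s:{0..1}|lborel. e (real k + s))" by (rule set_integral_interval_shift)
    also have "\<bar>\<dots>\<bar> \<le> (LINT s:{0..1::real}|lborel. K * exp (- c * real k))"
      unfolding set_lebesgue_integral_def
    proof (rule integral_abs_bound[THEN order_trans], rule integral_mono)
      have "set_integrable lborel {0..1} (\<lambda>s. e (real k + s))"
        using eB by (intro set_integral_bound_interval(1)[where B = B]) auto
      then show "integrable lborel (\<lambda>s. \<bar>indicator {0..1} s *\<^sub>R e (real k + s)\<bar>)"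
        by (simp add: set_integrable_def)
      show "integrable lborel (\<lambda>s. indicator {0..1::real} s *\<^sub>R (K * exp (- c * real k)))"
        by (intro integrable_scaleR_left integrable_real_indicator) auto
      fix s :: real
      show "\<bar>indicator {0..1} s *\<^sub>R e (real k + s)\<bar> \<le> indicator {0..1} s *\<^sub>R (K * exp (- c * real k))"
      proof (cases "s \<in> {0..1}")
        case True
        have "\<bar>f z\<bar> \<le> B + 1" for z using f_bound[of z] by linarith
        then have "\<bar>e (real k + s)\<bar> \<le> K * exp (- c * (real k + s))"
          using mixing[OF z, of "real k + s" f "B + 1"] True k f_centered B_nonneg by (simp add: e_def K_def)
        also have "\<dots> \<le> K * exp (- c * real k)"
          using True c_pos C_pos B_nonneg by (intro mult_left_mono) (auto simp: K_def)
        finally show ?thesis using True by simp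
      qed simp
    qed
    also have "\<dots> = K * exp (- c * real k)" by (simp add: set_lebesgue_integral_def)
    finally show ?thesis .
  qed
  \<comment> \<open>The mean of \<open>a\<close> at time \<open>k\<close> is close both to 0 and to
    the \<open>chi\<close>-mean of \<open>a\<close>; letting \<open>k\<close> grow identifies the
    latter.\<close>
  have "\<bar>\<integral>z. a z \<partial>chi\<bar> \<le> 2 * K * exp (- c) ^ k" if k: "k \<ge> 1" for k :: nat
  proof -
    have "\<bar>(\<integral>u. a (fl z u (real k)) \<partial>Q) - (\<integral>z. a z \<partial>chi)\<bar> \<le> K * exp (- c * real k)"
      using mixing[OF z, of "real k" a "B + 1"] k aB B_nonneg by (simp add: K_def)
    then have "\<bar>\<integral>z. a z \<partial>chi\<bar> \<le> 2 * K * exp (- c * real k)" using step[OF k] by linarith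
    then show ?thesis by (simp add: exp_of_nat_mult[symmetric] mult.commute)
  qed
  moreover have "(\<lambda>k. 2 * K * exp (- c) ^ k) \<longlonglongrightarrow> 2 * K * 0"
    using c_pos by (intro tendsto_mult tendsto_const LIMSEQ_power_zero) simp
  ultimately have "\<bar>\<integral>z. a z \<partial>chi\<bar> \<le> 2 * K * 0"
    by (intro tendsto_lowerbound[where F = sequentially]) (auto intro!: eventually_sequentiallyI[of 1])
  then show ?thesis by (simp add: a_def)
qed

end

section \<open>Expansions in the frequency\<close>

text \<open>The characteristic function of the centered normal law of variance \<open>v\<close>,
  written for every real \<open>v\<close> because the sign of \<open>v\<close> is settled only after
  the limit theorem.\<close>

abbreviation gauss :: "real \<Rightarrow> real \<Rightarrow> complex" where
  "gauss v \<theta> \<equiv> exp (complex_of_real (- (\<theta>\<^sup>2 * v / 2)))"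

text \<open>\<open>A\<close> is one step of the functional, \<open>g\<close> and \<open>k\<close>
  are the correctors at the end of the step. The powers of \<epsilon> are separated here pathwise,
  so that the Poisson equations can be applied to the mean of each coefficient.\<close>

lemma iexp_second_order:
  fixes A g k \<epsilon> :: real
  assumes A: "\<bar>A\<bar> \<le> B" and g: "\<bar>g\<bar> \<le> G" and k: "\<bar>k\<bar> \<le> K" and \<epsilon>: "\<bar>\<epsilon>\<bar> \<le> 1"
  shows "cmod (iexp (\<epsilon> * A) * (1 + \<i> * complex_of_real (\<epsilon> * g) - complex_of_real (\<epsilon>\<^sup>2 * k))
      - (1 + \<i> * complex_of_real (\<epsilon> * (A + g)) - complex_of_real (\<epsilon>\<^sup>2 * (A\<^sup>2 / 2 + A * g + k))))
    \<le> (B ^ 3 * (1 + G + K) + B * K + B\<^sup>2 * G + B\<^sup>2 * K) * \<bar>\<epsilon>\<bar> ^ 3"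
proof -
  define W :: complex where "W = 1 + \<i> * complex_of_real (\<epsilon> * g) - complex_of_real (\<epsilon>\<^sup>2 * k)"
  define T :: complex where "T = 1 + \<i> * (\<epsilon> * A) - \<epsilon>\<^sup>2 * (A\<^sup>2 / 2)"
  define r where "r = \<bar>\<epsilon>\<bar>"
  have r: "0 \<le> r" "r \<le> 1" using \<epsilon> by (auto simp: r_def)
  have pos: "B \<ge> 0" "G \<ge> 0" "K \<ge> 0" using A g k by linarith+
  have "cmod (iexp (\<epsilon> * A) - (\<Sum>j\<le>2. (\<i> * (\<epsilon> * A)) ^ j / fact j)) \<le> \<bar>\<epsilon> * A\<bar> ^ 3 / fact 3"
    using iexp_approx1[of "\<epsilon> * A" 2] by (simp add: numeral_3_eq_3)
  also have "(\<Sum>j\<le>2. (\<i> * (\<epsilon> * A)) ^ j / fact j) = T"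
    by (simp add: T_def numeral_2_eq_2 power2_eq_square algebra_simps)
  also have "\<bar>\<epsilon> * A\<bar> ^ 3 / fact 3 \<le> \<bar>\<epsilon> * A\<bar> ^ 3 / 1"
    by (intro divide_left_mono) (auto simp: fact_numeral)
  also have "\<dots> = r ^ 3 * \<bar>A\<bar> ^ 3" by (simp add: abs_mult power_mult_distrib r_def)
  also have "\<dots> \<le> r ^ 3 * B ^ 3" using A r by (intro mult_left_mono power_mono) auto
  finally have 1: "cmod (iexp (\<epsilon> * A) - T) \<le> r ^ 3 * B ^ 3" .
  have "cmod W \<le> cmod (1 + \<i> * (\<epsilon> * g)) + cmod (\<epsilon>\<^sup>2 * k)"
    unfolding W_def by (rule norm_triangle_ineq4)
  also have "\<dots> \<le> 1 + cmod (\<i> * (\<epsilon> * g)) + cmod (\<epsilon>\<^sup>2 * k)"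
    using norm_triangle_ineq[of 1 "\<i> * (\<epsilon> * g)"] by simp
  also have "\<dots> = 1 + r * \<bar>g\<bar> + r ^ 2 * \<bar>k\<bar>" by (simp add: norm_mult norm_power r_def)
  also have "\<dots> \<le> 1 + 1 * G + 1 * K"
    using g k r by (intro add_mono mult_mono order_refl) (auto simp: power_le_one)
  finally have 2: "cmod W \<le> 1 + G + K" by simp
  \<comment> \<open>The product of \<open>T\<close> and \<open>W\<close> agrees with the expansion
    through second order; its terms of orders three and four form the last summand.\<close>
  have split: "iexp (\<epsilon> * A) * W - (1 + \<i> * complex_of_real (\<epsilon> * (A + g)) - complex_of_real (\<epsilon>\<^sup>2 * (A\<^sup>2 / 2 + A * g + k)))
      = (iexp (\<epsilon> * A) - T) * W + complex_of_real (\<epsilon> ^ 3) * (\<epsilon> * (A\<^sup>2 * k / 2) - \<i> * (A * k + A\<^sup>2 * g / 2))"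
    by (simp add: T_def W_def power2_eq_square power3_eq_cube algebra_simps)
  have "cmod (complex_of_real (\<epsilon> * (A\<^sup>2 * k / 2)) - \<i> * complex_of_real (A * k + A\<^sup>2 * g / 2))
      \<le> \<bar>\<epsilon> * (A\<^sup>2 * k / 2)\<bar> + \<bar>A * k + A\<^sup>2 * g / 2\<bar>"
    by (rule order_trans[OF norm_triangle_ineq4]) (simp add: norm_mult del: of_real_mult of_real_add of_real_divide)
  also have "\<dots> \<le> r * (\<bar>A\<bar>\<^sup>2 * \<bar>k\<bar>) + (\<bar>A\<bar> * \<bar>k\<bar> + \<bar>A\<bar>\<^sup>2 * \<bar>g\<bar>)"
  proof (rule add_mono)
    show "\<bar>\<epsilon> * (A\<^sup>2 * k / 2)\<bar> \<le> r * (\<bar>A\<bar>\<^sup>2 * \<bar>k\<bar>)"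
      using r by (simp add: abs_mult r_def)
    show "\<bar>A * k + A\<^sup>2 * g / 2\<bar> \<le> \<bar>A\<bar> * \<bar>k\<bar> + \<bar>A\<bar>\<^sup>2 * \<bar>g\<bar>"
      by (rule order_trans[OF abs_triangle_ineq]) (simp add: abs_mult)
  qed
  also have "\<dots> \<le> 1 * (B\<^sup>2 * K) + (B * K + B\<^sup>2 * G)"
    using r A g k pos by (intro add_mono mult_mono power_mono) auto
  finally have 3: "cmod (complex_of_real (\<epsilon> * (A\<^sup>2 * k / 2)) - \<i> * complex_of_real (A * k + A\<^sup>2 * g / 2))
      \<le> B\<^sup>2 * K + B * K + B\<^sup>2 * G" by simp
  have "cmod (iexp (\<epsilon> * A) * W - (1 + \<i> * complex_of_real (\<epsilon> * (A + g)) - complex_of_real (\<epsilon>\<^sup>2 * (A\<^sup>2 / 2 + A * g + k))))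
      \<le> cmod (iexp (\<epsilon> * A) - T) * cmod W
        + r ^ 3 * cmod (complex_of_real (\<epsilon> * (A\<^sup>2 * k / 2)) - \<i> * complex_of_real (A * k + A\<^sup>2 * g / 2))"
    unfolding split by (rule order_trans[OF norm_triangle_ineq]) (simp add: norm_mult norm_power r_def)
  also have "\<dots> \<le> (r ^ 3 * B ^ 3) * (1 + G + K) + r ^ 3 * (B\<^sup>2 * K + B * K + B\<^sup>2 * G)"
    using 1 2 3 r pos by (intro add_mono mult_mono) auto
  also have "\<dots> = (B ^ 3 * (1 + G + K) + B * K + B\<^sup>2 * G + B\<^sup>2 * K) * \<bar>\<epsilon>\<bar> ^ 3"
    by (simp add: r_def algebra_simps)
  finally show ?thesis unfolding W_def .
qed

lemma exp_first_order:
  fixes v \<epsilon> :: real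
  assumes "\<bar>\<epsilon>\<bar> \<le> 1"
  shows "cmod (gauss v \<epsilon> - (1 - \<epsilon>\<^sup>2 * v / 2)) \<le> exp \<bar>v\<bar> * v\<^sup>2 * \<bar>\<epsilon>\<bar> ^ 3"
proof -
  define z where "z = complex_of_real (- (\<epsilon>\<^sup>2 * v / 2))"
  define r where "r = \<bar>\<epsilon>\<bar>"
  have r: "0 \<le> r" "r \<le> 1" "\<epsilon>\<^sup>2 = r\<^sup>2" using assms by (auto simp: r_def)
  have nz: "cmod z = r\<^sup>2 * \<bar>v\<bar> / 2" using r by (simp add: z_def norm_mult norm_power abs_mult r_def)
  have "cmod (exp z - (\<Sum>k\<le>1. z ^ k / fact k)) \<le> exp \<bar>Re z\<bar> * cmod z ^ Suc 1 / fact 1"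
    by (rule Taylor_exp)
  also have "(\<Sum>k\<le>1. z ^ k / fact k) = 1 - \<epsilon>\<^sup>2 * v / 2" by (simp add: z_def)
  also have "exp \<bar>Re z\<bar> * cmod z ^ Suc 1 / fact 1 = exp (r\<^sup>2 * \<bar>v\<bar> / 2) * (r\<^sup>2 * \<bar>v\<bar> / 2)\<^sup>2"
    unfolding nz using r by (simp add: z_def abs_mult power2_eq_square)
  also have "\<dots> \<le> exp \<bar>v\<bar> * (r ^ 3 * v\<^sup>2)"
  proof (intro mult_mono)
    have "r\<^sup>2 * \<bar>v\<bar> \<le> 1 * \<bar>v\<bar>" using r by (intro mult_right_mono) (auto simp: power_le_one)
    then show "exp (r\<^sup>2 * \<bar>v\<bar> / 2) \<le> exp \<bar>v\<bar>" by simp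
    have "(r\<^sup>2 * \<bar>v\<bar> / 2)\<^sup>2 = r ^ 4 * (v\<^sup>2 / 4)" by (simp add: power_mult_distrib power_divide flip: power_mult)
    also have "\<dots> \<le> r ^ 3 * v\<^sup>2"
      using r by (intro mult_mono power_decreasing) auto
    finally show "(r\<^sup>2 * \<bar>v\<bar> / 2)\<^sup>2 \<le> r ^ 3 * v\<^sup>2" .
  qed auto
  finally show ?thesis by (simp add: z_def r_def algebra_simps)
qed

context additive_functional
begin

text \<open>Iterating the unit-time operator reaches integer times only. During the remaining
  fraction of a time unit \<open>accum\<close> changes by at most \<open>B\<close>.\<close>

lemma twisted_const_approx:
  assumes z: "z \<in> good" and t: "t \<ge> 0" and \<epsilon>: "\<bar>\<epsilon>\<bar> \<le> 1"
  shows "cmod (twisted \<epsilon> t (\<lambda>_. 1) z - twisted \<epsilon> (real (nat \<lfloor>t\<rfloor>)) (\<lambda>_. 1) z) \<le> B * \<bar>\<epsilon>\<bar>"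
proof -
  define n where "n = real (nat \<lfloor>t\<rfloor>)"
  have n: "0 \<le> n" "n \<le> t" "t - n \<le> 1" using t unfolding n_def by linarith+
  let ?d = "\<lambda>u. iexp (\<epsilon> * accum z u t) * 1 - iexp (\<epsilon> * accum z u n) * 1"
  note i = twisted_integrable[of "\<lambda>_. 1" 1 \<epsilon> z]
  have eq: "twisted \<epsilon> t (\<lambda>_. 1) z - twisted \<epsilon> n (\<lambda>_. 1) z = (\<integral>u. ?d u \<partial>Q)"
    unfolding twisted_def by (rule Bochner_Integration.integral_diff[symmetric]) (use i in auto)
  have d: "cmod (?d u) \<le> B * \<bar>\<epsilon>\<bar>" for u
  proof -
    have "accum z u t - accum z u n = (LINT r:{0..t - n}|lborel. f (fl z u (n + r)))"
      using accum_split[OF n(1), of "t - n" z u] n by simp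
    also have "\<bar>\<dots>\<bar> \<le> B * (t - n - 0)"
      using n by (intro set_integral_bound_interval(2) f_bound measurable_compose[OF _ measurable_flight_time]) auto
    also have "\<dots> \<le> B * 1" using n B_nonneg by (intro mult_left_mono) auto
    finally have a: "\<bar>accum z u t - accum z u n\<bar> \<le> B" by simp
    have "iexp (\<epsilon> * accum z u t) * 1 - iexp (\<epsilon> * accum z u n) * 1
        = iexp (\<epsilon> * accum z u n) * (iexp (\<epsilon> * (accum z u t - accum z u n)) - 1)"
      by (simp add: algebra_simps flip: exp_add)
    then have "cmod (?d u) = cmod (iexp (\<epsilon> * (accum z u t - accum z u n)) - 1)"
      by (simp add: norm_mult)
    also have "\<dots> \<le> \<bar>\<epsilon> * (accum z u t - accum z u n)\<bar>"
      using iexp_approx1[of "\<epsilon> * (accum z u t - accum z u n)" 0] by simp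
    also have "\<dots> \<le> \<bar>\<epsilon>\<bar> * B" using a by (simp add: abs_mult mult_left_mono)
    finally show ?thesis by (simp add: mult.commute)
  qed
  have "cmod ((\<integral>u. ?d u \<partial>Q) - 0) \<le> B * \<bar>\<epsilon>\<bar>"
    using d i by (intro P.expectation_close Bochner_Integration.integrable_diff) auto
  then show ?thesis unfolding n_def[symmetric] eq by simp
qed

text \<open>The function \<open>1 + \<i> \<epsilon> g - \<epsilon>\<^sup>2 k\<close>, with \<open>g\<close> and \<open>k\<close> solving two Poisson equations, is an eigenfunction
  of the twisted transition operator up to an error of third order in \<open>\<epsilon>\<close>.\<close>

lemma almost_eigenfunction:
  assumes ne: "good \<noteq> {}"
  obtains v M :: real and G :: real and w :: "real \<Rightarrow> 'a \<times> 'a \<Rightarrow> complex" where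
    "M \<ge> 0" "G \<ge> 0" "\<And>\<epsilon>. w \<epsilon> \<in> borel_measurable borel"
    "\<And>\<epsilon> z. \<bar>\<epsilon>\<bar> \<le> 1 \<Longrightarrow> cmod (w \<epsilon> z - 1) \<le> G * \<bar>\<epsilon>\<bar>"
    "\<And>\<epsilon> z. z \<in> good \<Longrightarrow> \<bar>\<epsilon>\<bar> \<le> 1 \<Longrightarrow>
      cmod (twisted \<epsilon> 1 (w \<epsilon>) z - gauss v \<epsilon> * w \<epsilon> z) \<le> M * \<bar>\<epsilon>\<bar> ^ 3"
proof -
  obtain z0 where z0: "z0 \<in> good" using ne by blast
  have acc: "\<bar>accum z u 1\<bar> \<le> B" for z u using accum_bound[of 1] by simp
  have iacc: "integrable Q (\<lambda>u. accum z u 1)" for z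
    using acc by (intro P.integrable_const_bound[where B = B]) auto
  define a where "a z = (\<integral>u. accum z u 1 \<partial>Q)" for z
  have a[measurable]: "a \<in> borel_measurable borel"
    unfolding a_def by (intro P.borel_measurable_lebesgue_integral) (simp add: split_beta', measurable)
  have aB: "\<bar>a z\<bar> \<le> B" for z
    unfolding a_def using acc iacc by (intro order_trans[OF integral_abs_bound] P.integral_le_const) auto
  \<comment> \<open>The first corrector is chosen such that the first-order coefficient, the step
    plus \<open>g\<close> at its end, has mean \<open>g\<close> at its start.\<close>
  obtain g G where g[measurable]: "g \<in> borel_measurable borel" and G: "G > 0" "\<And>z. \<bar>g z\<bar> \<le> G"
    and g_eq: "\<And>z. z \<in> good \<Longrightarrow> g z = a z + (\<integral>u. g (fl z u 1) \<partial>Q)"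
    using poisson_equation[OF a aB] integral_chi_mean_accum[OF z0] unfolding a_def by metis
  \<comment> \<open>The mean of the second-order coefficient apart from \<open>k\<close>. As
    \<open>g\<close> sums the expected later steps, the product term collects their correlations
    with the present one.\<close>
  define b where "b z = (\<integral>u. (accum z u 1)\<^sup>2 / 2 + accum z u 1 * g (fl z u 1) \<partial>Q)" for z
  have b[measurable]: "b \<in> borel_measurable borel"
    unfolding b_def by (intro P.borel_measurable_lebesgue_integral) (simp add: split_beta', measurable)
  have bint: "\<bar>(accum z u 1)\<^sup>2 / 2 + accum z u 1 * g (fl z u 1)\<bar> \<le> B\<^sup>2 + B * G" for z u
  proof -
    have "\<bar>accum z u 1\<bar>\<^sup>2 \<le> B\<^sup>2" using acc by (intro power_mono) auto
    moreover have "\<bar>accum z u 1\<bar> * \<bar>g (fl z u 1)\<bar> \<le> B * G" using acc G B_nonneg by (intro mult_mono) auto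
    moreover have "\<bar>(accum z u 1)\<^sup>2 / 2 + accum z u 1 * g (fl z u 1)\<bar>
        \<le> \<bar>accum z u 1\<bar>\<^sup>2 / 2 + \<bar>accum z u 1\<bar> * \<bar>g (fl z u 1)\<bar>"
      by (rule order_trans[OF abs_triangle_ineq]) (simp add: abs_mult)
    ultimately show ?thesis using zero_le_power2[of B] by linarith
  qed
  have ib: "integrable Q (\<lambda>u. (accum z u 1)\<^sup>2 / 2 + accum z u 1 * g (fl z u 1))" for z
    using bint by (intro P.integrable_const_bound[where B = "B\<^sup>2 + B * G"]) auto
  have bB: "\<bar>b z\<bar> \<le> B\<^sup>2 + B * G" for z
    unfolding b_def using bint ib by (intro order_trans[OF integral_abs_bound] P.integral_le_const) auto
  \<comment> \<open>The only value for which \<open>b - v / 2\<close> is centered, so that the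
    second Poisson equation is solvable. It is the Green-Kubo variance: the \<open>chi\<close>-mean
    of the squared step plus twice its correlation with the sum of all later steps.\<close>
  define v where "v = 2 * (\<integral>z. b z \<partial>chi)"
  have ibc: "integrable chi b" using bB by (intro chi.integrable_const_bound[where B = "B\<^sup>2 + B * G"]) auto
  have "\<bar>b z - v / 2\<bar> \<le> B\<^sup>2 + B * G + \<bar>v\<bar> / 2" for z using bB[of z] by linarith
  moreover have "(\<integral>z. b z - v / 2 \<partial>chi) = 0" using ibc by (simp add: v_def chi.prob_space)
  moreover have "(\<lambda>z. b z - v / 2) \<in> borel_measurable borel" by measurable
  ultimately obtain k K where k[measurable]: "k \<in> borel_measurable borel" and K: "K > 0" "\<And>z. \<bar>k z\<bar> \<le> K"
    and k_eq: "\<And>z. z \<in> good \<Longrightarrow> k z = (b z - v / 2) + (\<integral>u. k (fl z u 1) \<partial>Q)"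
    using poisson_equation[of "\<lambda>z. b z - v / 2" "B\<^sup>2 + B * G + \<bar>v\<bar> / 2"] by metis
  define w where "w \<epsilon> z = 1 + \<i> * complex_of_real (\<epsilon> * g z) - complex_of_real (\<epsilon>\<^sup>2 * k z)" for \<epsilon> :: real and z
  have w[measurable]: "w \<epsilon> \<in> borel_measurable borel" for \<epsilon> unfolding w_def by measurable
  have w1: "cmod (w \<epsilon> z - 1) \<le> (G + K) * \<bar>\<epsilon>\<bar>" if \<epsilon>: "\<bar>\<epsilon>\<bar> \<le> 1" for \<epsilon> z
  proof -
    have "cmod (w \<epsilon> z - 1) \<le> cmod (\<i> * complex_of_real (\<epsilon> * g z)) + cmod (complex_of_real (\<epsilon>\<^sup>2 * k z))"
      unfolding w_def using norm_triangle_ineq4[of "\<i> * complex_of_real (\<epsilon> * g z)" "complex_of_real (\<epsilon>\<^sup>2 * k z)"] by simp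
    also have "\<dots> = \<bar>\<epsilon>\<bar> * \<bar>g z\<bar> + \<bar>\<epsilon>\<bar> ^ 2 * \<bar>k z\<bar>" by (simp add: norm_mult norm_power)
    also have "\<dots> \<le> \<bar>\<epsilon>\<bar> * G + \<bar>\<epsilon>\<bar> ^ 1 * K"
      using G K \<epsilon> by (intro add_mono mult_mono power_decreasing) auto
    finally show ?thesis by (simp add: algebra_simps)
  qed
  define M1 where "M1 = B ^ 3 * (1 + G + K) + B * K + B\<^sup>2 * G + B\<^sup>2 * K"
  define M2 where "M2 = \<bar>v\<bar> * G + \<bar>v\<bar> * K"
  define M3 where "M3 = exp \<bar>v\<bar> * v\<^sup>2 * (1 + G + K)"
  have M: "M1 \<ge> 0" "M2 \<ge> 0" "M3 \<ge> 0" using B_nonneg G K by (auto simp: M1_def M2_def M3_def)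
  have eig: "cmod (twisted \<epsilon> 1 (w \<epsilon>) z - gauss v \<epsilon> * w \<epsilon> z) \<le> (M1 + M2 + M3) * \<bar>\<epsilon>\<bar> ^ 3"
    if z: "z \<in> good" and \<epsilon>: "\<bar>\<epsilon>\<bar> \<le> 1" for \<epsilon> z
  proof -
    let ?A = "\<lambda>u. accum z u 1" and ?g = "\<lambda>u. g (fl z u 1)" and ?k = "\<lambda>u. k (fl z u 1)"
    let ?p = "\<lambda>u. 1 + \<i> * complex_of_real (\<epsilon> * (?A u + ?g u)) - complex_of_real (\<epsilon>\<^sup>2 * ((?A u)\<^sup>2 / 2 + ?A u * ?g u + ?k u))"
    have ig: "integrable Q ?g" using G by (intro P.integrable_const_bound[where B = G]) auto
    have ik: "integrable Q ?k" using K by (intro P.integrable_const_bound[where B = K]) auto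
    have i1: "integrable Q (\<lambda>u. \<epsilon> * (?A u + ?g u))" using iacc ig by simp
    have i2: "integrable Q (\<lambda>u. \<epsilon>\<^sup>2 * ((?A u)\<^sup>2 / 2 + ?A u * ?g u + ?k u))"
      by (intro integrable_mult_right Bochner_Integration.integrable_add[OF ib ik])
    have ip: "integrable Q ?p"
      by (intro Bochner_Integration.integrable_add Bochner_Integration.integrable_diff integrable_mult_right
          integrable_of_real i1 i2 P.integrable_const)
    have wK: "cmod (w \<epsilon> z) \<le> 1 + G + K" for z
    proof -
      have "cmod (w \<epsilon> z) \<le> 1 + cmod (w \<epsilon> z - 1)" using norm_triangle_ineq[of 1 "w \<epsilon> z - 1"] by simp
      also have "\<dots> \<le> 1 + (G + K) * 1"
        using w1[OF \<epsilon>, of z] mult_left_mono[OF \<epsilon>, of "G + K"] G K by linarith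
      finally show ?thesis by simp
    qed
    note iw = twisted_integrable[OF w[of \<epsilon>] wK, of \<epsilon> z 1]
    have "twisted \<epsilon> 1 (w \<epsilon>) z - (\<integral>u. ?p u \<partial>Q) = (\<integral>u. iexp (\<epsilon> * ?A u) * w \<epsilon> (fl z u 1) - ?p u \<partial>Q)"
      unfolding twisted_def using iw ip by (rule Bochner_Integration.integral_diff[symmetric])
    moreover have "AE u in Q. cmod (iexp (\<epsilon> * ?A u) * w \<epsilon> (fl z u 1) - ?p u - 0) \<le> M1 * \<bar>\<epsilon>\<bar> ^ 3"
      unfolding w_def M1_def diff_0_right using iexp_second_order[OF acc G(2) K(2) \<epsilon>] by (intro AE_I2)
    ultimately have 1: "cmod (twisted \<epsilon> 1 (w \<epsilon>) z - (\<integral>u. ?p u \<partial>Q)) \<le> M1 * \<bar>\<epsilon>\<bar> ^ 3"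
      using P.expectation_close[OF Bochner_Integration.integrable_diff[OF iw ip], of 0] by simp
    have "(\<integral>u. ?p u \<partial>Q) = (\<integral>u. 1 + \<i> * complex_of_real (\<epsilon> * (?A u + ?g u)) \<partial>Q)
        - (\<integral>u. complex_of_real (\<epsilon>\<^sup>2 * ((?A u)\<^sup>2 / 2 + ?A u * ?g u + ?k u)) \<partial>Q)"
      by (intro Bochner_Integration.integral_diff Bochner_Integration.integrable_add integrable_mult_right
          integrable_of_real i1 i2 P.integrable_const)
    also have "(\<integral>u. 1 + \<i> * complex_of_real (\<epsilon> * (?A u + ?g u)) \<partial>Q)
        = (\<integral>u. 1 \<partial>Q) + (\<integral>u. \<i> * complex_of_real (\<epsilon> * (?A u + ?g u)) \<partial>Q)"
      by (intro Bochner_Integration.integral_add integrable_mult_right integrable_of_real i1 P.integrable_const)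
    also have "\<dots> = 1 + \<i> * complex_of_real (\<integral>u. \<epsilon> * (?A u + ?g u) \<partial>Q)"
      by (simp only: integral_mult_right_zero integral_complex_of_real) (simp add: P.prob_space)
    also have "(\<integral>u. complex_of_real (\<epsilon>\<^sup>2 * ((?A u)\<^sup>2 / 2 + ?A u * ?g u + ?k u)) \<partial>Q)
        = complex_of_real (\<integral>u. \<epsilon>\<^sup>2 * ((?A u)\<^sup>2 / 2 + ?A u * ?g u + ?k u) \<partial>Q)"
      by (rule integral_complex_of_real)
    also have "(\<integral>u. \<epsilon> * (?A u + ?g u) \<partial>Q) = \<epsilon> * (a z + (\<integral>u. ?g u \<partial>Q))"
      using iacc ig by (simp add: a_def)
    also have "a z + (\<integral>u. ?g u \<partial>Q) = g z" using g_eq[OF z] by simp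
    also have "(\<integral>u. \<epsilon>\<^sup>2 * (((?A u)\<^sup>2 / 2 + ?A u * ?g u) + ?k u) \<partial>Q) = \<epsilon>\<^sup>2 * (b z + (\<integral>u. ?k u \<partial>Q))"
      unfolding b_def using ib ik by (subst integral_mult_right_zero, subst Bochner_Integration.integral_add) auto
    also have "b z + (\<integral>u. ?k u \<partial>Q) = k z + v / 2" using k_eq[OF z] by simp
    finally have p: "(\<integral>u. ?p u \<partial>Q) = 1 + \<i> * complex_of_real (\<epsilon> * g z) - complex_of_real (\<epsilon>\<^sup>2 * (k z + v / 2))" .
    \<comment> \<open>The expansion of \<open>gauss v \<epsilon>\<close> through second order. In
      the difference below all terms up to second order cancel, which is the effect of the two
      Poisson equations.\<close>
    define L where "L = complex_of_real (1 - \<epsilon>\<^sup>2 * v / 2)"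
    have "(\<integral>u. ?p u \<partial>Q) - L * w \<epsilon> z = complex_of_real (\<epsilon> ^ 3) * (\<i> * complex_of_real (v * g z / 2) - complex_of_real (\<epsilon> * (v * k z / 2)))"
      unfolding p L_def w_def by (simp add: power2_eq_square power3_eq_cube algebra_simps)
    also have "cmod \<dots> \<le> \<bar>\<epsilon>\<bar> ^ 3 * (\<bar>v * g z / 2\<bar> + \<bar>\<epsilon> * (v * k z / 2)\<bar>)"
      unfolding norm_mult[of "complex_of_real (\<epsilon> ^ 3)"]
      using norm_triangle_ineq4[of "\<i> * complex_of_real (v * g z / 2)" "complex_of_real (\<epsilon> * (v * k z / 2))"]
      by (intro mult_mono) (auto simp: norm_mult norm_power)
    also have "\<dots> \<le> \<bar>\<epsilon>\<bar> ^ 3 * M2"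
    proof (intro mult_left_mono)
      have "\<bar>v\<bar> * \<bar>g z\<bar> \<le> \<bar>v\<bar> * G" "\<bar>v\<bar> * \<bar>k z\<bar> \<le> \<bar>v\<bar> * K"
        by (intro mult_left_mono G(2) K(2) abs_ge_zero)+
      moreover have "\<bar>\<epsilon>\<bar> * (\<bar>v\<bar> * \<bar>k z\<bar>) \<le> 1 * (\<bar>v\<bar> * \<bar>k z\<bar>)" using \<epsilon> by (intro mult_right_mono) auto
      ultimately have "\<bar>v\<bar> * \<bar>g z\<bar> / 2 + \<bar>\<epsilon>\<bar> * (\<bar>v\<bar> * \<bar>k z\<bar>) / 2 \<le> M2"
        unfolding M2_def using G(1) K(1) abs_ge_zero[of "v"] mult_nonneg_nonneg[of "\<bar>v\<bar>" G] mult_nonneg_nonneg[of "\<bar>v\<bar>" K] by linarith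
      then show "\<bar>v * g z / 2\<bar> + \<bar>\<epsilon> * (v * k z / 2)\<bar> \<le> M2" by (simp add: abs_mult)
    qed simp
    finally have 2: "cmod ((\<integral>u. ?p u \<partial>Q) - L * w \<epsilon> z) \<le> M2 * \<bar>\<epsilon>\<bar> ^ 3" by (simp add: mult.commute)
    have "cmod (L * w \<epsilon> z - gauss v \<epsilon> * w \<epsilon> z)
        = cmod (gauss v \<epsilon> - L) * cmod (w \<epsilon> z)"
      by (simp add: norm_mult[symmetric] left_diff_distrib norm_minus_commute)
    also have "\<dots> \<le> (exp \<bar>v\<bar> * v\<^sup>2 * \<bar>\<epsilon>\<bar> ^ 3) * (1 + G + K)"
      using exp_first_order[OF \<epsilon>, of v] wK[of z] by (intro mult_mono) (auto simp: L_def)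
    also have "\<dots> = M3 * \<bar>\<epsilon>\<bar> ^ 3" by (simp add: M3_def algebra_simps)
    finally have 3: "cmod (L * w \<epsilon> z - gauss v \<epsilon> * w \<epsilon> z) \<le> M3 * \<bar>\<epsilon>\<bar> ^ 3" .
    have "cmod (twisted \<epsilon> 1 (w \<epsilon>) z - gauss v \<epsilon> * w \<epsilon> z)
        \<le> cmod (twisted \<epsilon> 1 (w \<epsilon>) z - (\<integral>u. ?p u \<partial>Q)) + cmod ((\<integral>u. ?p u \<partial>Q) - L * w \<epsilon> z)
          + cmod (L * w \<epsilon> z - gauss v \<epsilon> * w \<epsilon> z)"
      by (rule norm_diff_triangle_le[OF norm_diff_triangle_le[OF order_refl order_refl] order_refl])
    also have "\<dots> \<le> (M1 + M2 + M3) * \<bar>\<epsilon>\<bar> ^ 3" using 1 2 3 by (simp add: algebra_simps)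
    finally show ?thesis .
  qed
  show ?thesis
    by (rule that[of "M1 + M2 + M3" "G + K" w v]) (use M G K w w1 eig in auto)
qed

text \<open>The operator is a contraction in the supremum norm, so the errors of single steps add up
  and are amplified at most by powers of \<open>l\<close>. The bound \<open>L \<ge> 1\<close> allows
  for \<open>l\<close> of modulus above 1, since the sign of the variance is still open.\<close>

lemma twisted_iterate:
  assumes z: "z \<in> good" and M: "M \<ge> 0" and w[measurable]: "w \<in> borel_measurable borel"
    and wK: "\<And>z. cmod (w z) \<le> K"
    and eig: "\<And>z. z \<in> good \<Longrightarrow> cmod (twisted \<epsilon> 1 w z - l * w z) \<le> M"
    and L: "cmod l \<le> L" "1 \<le> L"
  shows "cmod (twisted \<epsilon> (real n) w z - l ^ n * w z) \<le> real n * L ^ n * M"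
  using z
proof (induction n arbitrary: z)
  case 0
  then show ?case by (simp add: twisted_0)
next
  case (Suc n)
  have semi: "twisted \<epsilon> (real (Suc n)) w z = twisted \<epsilon> 1 (twisted \<epsilon> (real n) w) z"
    using twisted_semigroup[OF Suc.prems, of 1 "real n" w K] wK by (simp add: add.commute)
  have K0: "0 \<le> K" using norm_ge_zero wK[of undefined] by (rule order_trans)
  have ln: "cmod (l ^ n) \<le> L ^ n" using L(1) by (simp add: norm_power power_mono)
  have L1: "1 \<le> L ^ n" using L(2) by simp
  have "cmod (twisted \<epsilon> 1 (twisted \<epsilon> (real n) w) z - twisted \<epsilon> 1 (\<lambda>z. l ^ n * w z) z) \<le> real n * L ^ n * M"
  proof (rule twisted_diff_bound[OF Suc.prems, where K = "L ^ n * K"])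
    show "cmod (twisted \<epsilon> (real n) w z) \<le> L ^ n * K" for z
      using twisted_bound[OF w wK, of \<epsilon> "real n" z] mult_right_mono[OF L1 K0] by simp
    show "cmod (l ^ n * w z) \<le> L ^ n * K" for z
      unfolding norm_mult using ln wK L by (intro mult_mono) auto
  qed (use Suc.IH in auto)
  moreover have "cmod (twisted \<epsilon> 1 (\<lambda>z. l ^ n * w z) z - l ^ n * (l * w z)) \<le> L ^ n * M"
    unfolding twisted_scale right_diff_distrib[symmetric] norm_mult
    using ln eig[OF Suc.prems] L by (intro mult_mono) auto
  ultimately have "cmod (twisted \<epsilon> 1 (twisted \<epsilon> (real n) w) z - l ^ n * (l * w z)) \<le> real n * L ^ n * M + L ^ n * M"
    by (rule norm_diff_triangle_le)
  also have "\<dots> = (real n + 1) * (L ^ n * M)" by (simp add: algebra_simps)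
  also have "\<dots> \<le> (real n + 1) * (L ^ Suc n * M)"
    using M L by (intro mult_left_mono mult_right_mono power_increasing) auto
  finally show ?case unfolding semi by (simp add: algebra_simps)
qed

text \<open>The error \<open>e\<close> does not depend on the starting state; this lets the estimate
  be averaged over arbitrary initial laws later.\<close>

theorem uniform_central_limit:
  "\<exists>v. \<forall>\<theta>. \<exists>e. (e \<longlongrightarrow> 0) at_top \<and> (\<forall>\<^sub>F t in at_top. \<forall>z\<in>good.
     cmod ((\<integral>u. iexp (\<theta> / sqrt t * accum z u t) \<partial>Q) - gauss v \<theta>) \<le> e t)"
proof (cases "good = {}")
  case True
  then show ?thesis by (auto intro!: exI[of _ "\<lambda>_. 0"])
next
  case False
  show ?thesis
  proof (rule almost_eigenfunction[OF False])
    fix v M G w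
    assume M: "M \<ge> 0" and G: "G \<ge> 0" and w[measurable]: "\<And>\<epsilon>. w \<epsilon> \<in> borel_measurable borel"
      and w1: "\<And>\<epsilon> z. \<bar>\<epsilon>\<bar> \<le> 1 \<Longrightarrow> cmod (w \<epsilon> z - 1) \<le> G * \<bar>\<epsilon>\<bar>"
      and eig: "\<And>\<epsilon> z. z \<in> good \<Longrightarrow> \<bar>\<epsilon>\<bar> \<le> 1 \<Longrightarrow>
        cmod (twisted \<epsilon> 1 (w \<epsilon>) z - gauss v \<epsilon> * w \<epsilon> z) \<le> M * \<bar>\<epsilon>\<bar> ^ 3"
    show ?thesis
    proof (intro exI[of _ v] allI)
      fix \<theta> :: real
      \<comment> \<open>Bounds the powers \<open>L ^ n\<close> for all large \<open>t\<close>,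
        because \<open>n\<close> times \<open>(\<epsilon> t)\<^sup>2\<close> is at most
        \<open>\<theta>\<^sup>2\<close>.\<close>
      define X where "X = exp (\<theta>\<^sup>2 * \<bar>v\<bar> / 2)"
      define \<epsilon> where "\<epsilon> t = \<theta> / sqrt t" for t
      define err where "err t = cmod (exp (complex_of_real (- (real (nat \<lfloor>t\<rfloor>) / t * (\<theta>\<^sup>2 * v / 2)))) - gauss v \<theta>)" for t
      \<comment> \<open>\<open>B\<close> pays for the fraction of a time unit, \<open>G\<close> for
        replacing 1 by the almost eigenfunction, \<open>X * G\<close> for undoing this, the term
        with \<open>M\<close> for the iteration, and \<open>err\<close> for \<open>n\<close>
        differing from \<open>t\<close>.\<close>
      define e where "e t = (B + G + X * G) * \<bar>\<epsilon> t\<bar> + X * M * \<theta>\<^sup>2 * \<bar>\<epsilon> t\<bar> + err t" for t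
      have "((\<lambda>t. \<theta> / sqrt t) \<longlongrightarrow> 0) at_top"
        by (intro tendsto_divide_0[OF tendsto_const] filterlim_at_top_imp_at_infinity sqrt_at_top)
      then have \<epsilon>0: "((\<lambda>t. \<bar>\<epsilon> t\<bar>) \<longlongrightarrow> 0) at_top"
        unfolding \<epsilon>_def by (rule tendsto_rabs_zero)
      have frac: "((\<lambda>t. real (nat \<lfloor>t\<rfloor>) / t) \<longlongrightarrow> 1) at_top"
      proof (rule tendsto_sandwich)
        show "\<forall>\<^sub>F t in at_top. 1 - 1 / t \<le> real (nat \<lfloor>t\<rfloor>) / t"
          using eventually_gt_at_top[of 0]
        proof eventually_elim
          case (elim t)
          then have "t - 1 \<le> real (nat \<lfloor>t\<rfloor>)" by linarith
          then have "(t - 1) / t \<le> real (nat \<lfloor>t\<rfloor>) / t" using elim by (intro divide_right_mono) auto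
          then show ?case using elim by (simp add: diff_divide_distrib)
        qed
        show "\<forall>\<^sub>F t in at_top. real (nat \<lfloor>t\<rfloor>) / t \<le> 1"
          using eventually_gt_at_top[of 0]
        proof eventually_elim
          case (elim t)
          then have "real (nat \<lfloor>t\<rfloor>) \<le> t" by linarith
          then show ?case using elim by simp
        qed
        have "((\<lambda>t. 1 - 1 / t) \<longlongrightarrow> 1 - 0) (at_top :: real filter)"
          by (intro tendsto_intros tendsto_divide_0[OF tendsto_const] filterlim_at_top_imp_at_infinity filterlim_ident)
        then show "((\<lambda>t. 1 - 1 / t) \<longlongrightarrow> 1) (at_top :: real filter)" by simp
      qed simp
      have "((\<lambda>t. exp (complex_of_real (- (real (nat \<lfloor>t\<rfloor>) / t * (\<theta>\<^sup>2 * v / 2))))) \<longlongrightarrow> exp (complex_of_real (- (1 * (\<theta>\<^sup>2 * v / 2))))) at_top"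
        by (intro tendsto_intros frac)
      then have err0: "(err \<longlongrightarrow> 0) at_top"
        unfolding err_def by (intro tendsto_norm_zero) (simp add: LIM_zero)
      have "((\<lambda>t. (B + G + X * G) * \<bar>\<epsilon> t\<bar> + X * M * \<theta>\<^sup>2 * \<bar>\<epsilon> t\<bar> + err t) \<longlongrightarrow> (B + G + X * G) * 0 + X * M * \<theta>\<^sup>2 * 0 + 0) at_top"
        by (intro tendsto_intros \<epsilon>0 err0)
      then have e0: "(e \<longlongrightarrow> 0) at_top" by (simp add: e_def[abs_def])
      \<comment> \<open>The threshold \<open>\<theta>\<^sup>2\<close> for \<open>t\<close>
        guarantees that the frequency \<open>\<epsilon> t\<close> is at most 1 in modulus, as the
        expansions require.\<close>
      have bound: "cmod ((\<integral>u. iexp (\<theta> / sqrt t * accum z u t) \<partial>Q) - gauss v \<theta>) \<le> e t"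
        if z: "z \<in> good" and t: "t \<ge> max 1 (\<theta>\<^sup>2)" for z t
      proof -
        define n where "n = nat \<lfloor>t\<rfloor>"
        have t0: "t > 0" and nt: "real n \<le> t" using t unfolding n_def by linarith+
        have \<epsilon>2: "(\<epsilon> t)\<^sup>2 = \<theta>\<^sup>2 / t" using t0 by (simp add: \<epsilon>_def power_divide)
        have "(\<epsilon> t)\<^sup>2 \<le> 1" using t t0 by (simp add: \<epsilon>2)
        then have \<epsilon>1: "\<bar>\<epsilon> t\<bar> \<le> 1" using abs_square_le_1 by blast
        define l where "l = gauss v (\<epsilon> t)"
        define L where "L = exp ((\<epsilon> t)\<^sup>2 * \<bar>v\<bar> / 2)"
        have "- ((\<epsilon> t)\<^sup>2 * v / 2) \<le> (\<epsilon> t)\<^sup>2 * \<bar>v\<bar> / 2"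
          using mult_left_mono[of "- v" "\<bar>v\<bar>" "(\<epsilon> t)\<^sup>2"] by simp
        then have lL: "cmod l \<le> L" "1 \<le> L" by (auto simp: l_def L_def norm_exp_eq_Re)
        have "L ^ n = exp (real n * ((\<epsilon> t)\<^sup>2 * \<bar>v\<bar> / 2))" by (simp only: L_def exp_of_nat_mult)
        also have "real n * ((\<epsilon> t)\<^sup>2 * \<bar>v\<bar> / 2) = real n / t * (\<theta>\<^sup>2 * \<bar>v\<bar> / 2)" by (simp add: \<epsilon>2)
        also have "\<dots> \<le> 1 * (\<theta>\<^sup>2 * \<bar>v\<bar> / 2)" using nt t0 by (intro mult_right_mono) auto
        finally have LX: "L ^ n \<le> X" by (simp add: X_def)
        have ln: "l ^ n = exp (complex_of_real (- (real n / t * (\<theta>\<^sup>2 * v / 2))))"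
        proof -
          have "l ^ n = exp (of_nat n * complex_of_real (- ((\<epsilon> t)\<^sup>2 * v / 2)))"
            unfolding l_def by (rule exp_of_nat_mult[symmetric])
          also have "of_nat n * complex_of_real (- ((\<epsilon> t)\<^sup>2 * v / 2)) = complex_of_real (- (real n / t * (\<theta>\<^sup>2 * v / 2)))"
            unfolding \<epsilon>2 by simp
          finally show ?thesis .
        qed
        have wK: "cmod (w (\<epsilon> t) z) \<le> 1 + G" for z
          using norm_triangle_ineq[of 1 "w (\<epsilon> t) z - 1"] w1[OF \<epsilon>1, of z] mult_left_mono[OF \<epsilon>1 G] by simp
        have s1: "cmod (twisted (\<epsilon> t) t (\<lambda>_. 1) z - twisted (\<epsilon> t) (real n) (\<lambda>_. 1) z) \<le> B * \<bar>\<epsilon> t\<bar>"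
          unfolding n_def using t0 by (intro twisted_const_approx z \<epsilon>1) auto
        have s2: "cmod (twisted (\<epsilon> t) (real n) (\<lambda>_. 1) z - twisted (\<epsilon> t) (real n) (w (\<epsilon> t)) z) \<le> G * \<bar>\<epsilon> t\<bar>"
          using G wK w1[OF \<epsilon>1] by (intro twisted_diff_bound[OF z, where K = "1 + G"]) (auto simp: norm_minus_commute)
        have s3: "cmod (twisted (\<epsilon> t) (real n) (w (\<epsilon> t)) z - l ^ n * w (\<epsilon> t) z) \<le> X * M * \<theta>\<^sup>2 * \<bar>\<epsilon> t\<bar>"
        proof -
          have "cmod (twisted (\<epsilon> t) (real n) (w (\<epsilon> t)) z - l ^ n * w (\<epsilon> t) z) \<le> real n * L ^ n * (M * \<bar>\<epsilon> t\<bar> ^ 3)"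
            unfolding l_def using M wK eig[OF _ \<epsilon>1] lL[unfolded l_def] by (intro twisted_iterate[OF z, where K = "1 + G"]) auto
          also have "\<dots> \<le> t * X * (M * \<bar>\<epsilon> t\<bar> ^ 3)"
            using nt LX M t0 by (intro mult_right_mono mult_mono) (auto simp: L_def)
          also have "\<bar>\<epsilon> t\<bar> ^ 3 = (\<epsilon> t)\<^sup>2 * \<bar>\<epsilon> t\<bar>" by (simp add: power3_eq_cube power2_eq_square abs_mult_self_eq)
          also have "t * X * (M * ((\<epsilon> t)\<^sup>2 * \<bar>\<epsilon> t\<bar>)) = X * M * \<theta>\<^sup>2 * \<bar>\<epsilon> t\<bar>" using t0 by (simp add: \<epsilon>2)
          finally show ?thesis .
        qed
        have s4: "cmod (l ^ n * w (\<epsilon> t) z - l ^ n) \<le> X * G * \<bar>\<epsilon> t\<bar>"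
        proof -
          have "cmod (l ^ n * w (\<epsilon> t) z - l ^ n) = cmod (l ^ n) * cmod (w (\<epsilon> t) z - 1)"
            by (simp add: norm_mult[symmetric] right_diff_distrib)
          also have "\<dots> \<le> X * (G * \<bar>\<epsilon> t\<bar>)"
          proof (intro mult_mono w1[OF \<epsilon>1])
            have "cmod (l ^ n) \<le> L ^ n" using lL(1) by (simp add: norm_power power_mono)
            then show "cmod (l ^ n) \<le> X" using LX by (rule order_trans)
          qed (auto simp: X_def)
          finally show ?thesis by simp
        qed
        have s5: "cmod (l ^ n - gauss v \<theta>) \<le> err t"
          unfolding ln err_def unfolding n_def by (rule order_refl)
        have "cmod (twisted (\<epsilon> t) t (\<lambda>_. 1) z - gauss v \<theta>)
            \<le> B * \<bar>\<epsilon> t\<bar> + G * \<bar>\<epsilon> t\<bar> + X * M * \<theta>\<^sup>2 * \<bar>\<epsilon> t\<bar> + X * G * \<bar>\<epsilon> t\<bar> + err t"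
          by (rule norm_diff_triangle_le[OF norm_diff_triangle_le[OF norm_diff_triangle_le[OF norm_diff_triangle_le[OF s1 s2] s3] s4] s5])
        also have "\<dots> = e t" by (simp add: e_def algebra_simps)
        finally show ?thesis by (simp add: twisted_def \<epsilon>_def)
      qed
      show "\<exists>e. (e \<longlongrightarrow> 0) at_top \<and> (\<forall>\<^sub>F t in at_top. \<forall>z\<in>good.
          cmod ((\<integral>u. iexp (\<theta> / sqrt t * accum z u t) \<partial>Q) - gauss v \<theta>) \<le> e t)"
        using e0 bound by (intro exI[of _ e] conjI eventually_at_top_linorderI[of "max 1 (\<theta>\<^sup>2)"]) auto
    qed
  qed
qed

end

section \<open>Random initial conditions and convergence in law\<close>

text \<open>The flight in progress at time 0 of a billiard started from \<open>z\<close>, and the directions left for the later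
  reflections.\<close>

definition start_state ::
  "'a::euclidean_space set \<Rightarrow> ('a \<Rightarrow> 'a \<Rightarrow>\<^sub>L 'a) \<Rightarrow> 'a \<times> 'a \<Rightarrow> (nat \<Rightarrow> 'a) \<Rightarrow> 'a \<times> 'a" where
  "start_state D U z u = (if fst z \<in> D then z else (fst z, blinfun_apply (U (fst z)) (u 0)))"

definition start_dirs :: "'a set \<Rightarrow> 'a \<times> 'a \<Rightarrow> (nat \<Rightarrow> 'a) \<Rightarrow> nat \<Rightarrow> 'a" where
  "start_dirs D z u = (if fst z \<in> D then u else (\<lambda>i. u (Suc i)))"

abbreviation proper_start ::
  "'a::euclidean_space set \<Rightarrow> 'a set \<Rightarrow> ('a \<Rightarrow> 'a \<Rightarrow>\<^sub>L 'a) \<Rightarrow> 'a \<times> 'a \<Rightarrow> (nat \<Rightarrow> 'a) \<Rightarrow> bool" where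
  "proper_start D R U z u \<equiv> proper_path D R U (start_state D U z u) (start_dirs D z u)"

definition admissible :: "'a::euclidean_space set \<Rightarrow> 'a set \<Rightarrow> ('a \<times> 'a) set" where
  "admissible D R = {z. (z \<in> D \<times> unit_sphere \<or> fst z \<in> frontier D) \<and> first_boundary_point D z \<in> R}"

lemma billiard_state_start:
  assumes "proper_start D R U z u" and "t \<ge> 0"
  shows "billiard_state D U z u t = flight D U (start_state D U z u) (start_dirs D z u) t"
proof (cases "fst z \<in> D")
  case True
  then show ?thesis
    using billiard_state_interior_start[of "fst z" D R U "snd z" u t] assms
      proper_pathD(1)[of D R U z u]
    by (simp add: start_state_def start_dirs_def)
next
  case False
  then show ?thesis
    using billiard_state_boundary_start[of "fst z" D R U u t "snd z"] assms
    by (simp add: start_state_def start_dirs_def)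
qed

lemma in_flight_of_interior:
  assumes D: "open D" "bounded D" and z: "fst z \<in> D" "z \<in> admissible D R"
  shows "z \<in> in_flight D R"
proof -
  obtain x v where xv: "z = (x, v)" by fastforce
  have x: "x \<in> D" and v: "norm v = 1" and R: "exit_point D x v \<in> R"
    using z D(1) by (auto simp: admissible_def xv first_boundary_point_def frontier_def interior_open)
  obtain d where d: "d > 0" "ball x d \<subseteq> D" using D(1) x openE by blast
  have "x + s *\<^sub>R v \<in> D" if "s \<in> {0<..<d}" for s
    using that v by (intro subsetD[OF d(2)]) (simp add: dist_norm)
  then show ?thesis unfolding xv using exit_of_entering_ray(3)[OF D v d(1) _ R] by blast
qed

context additive_functional
begin

abbreviation "start_accum z u t \<equiv> accum (start_state D U z u) (start_dirs D z u) t"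

lemma sets_admissible [measurable]: "admissible D R \<in> sets borel"
proof -
  have "D \<times> unit_sphere \<in> sets (borel :: ('a \<times> 'a) measure)"
    using open_D by (intro borel_Times) auto
  then have [measurable]: "Measurable.pred borel (\<lambda>z :: 'a \<times> 'a. z \<in> D \<times> unit_sphere)" by simp
  have "frontier D \<in> sets borel" by simp
  note [measurable] = this
  have fb: "first_boundary_point D z = (if fst z \<in> D then exit_point D (fst z) (snd z) else fst z)" for z
    by (simp add: first_boundary_point_def split: prod.splits)
  have "admissible D R = {z \<in> space borel. (z \<in> D \<times> unit_sphere \<or> fst z \<in> frontier D) \<and>
      (if fst z \<in> D then exit_point D (fst z) (snd z) else fst z) \<in> R}"
    by (simp add: admissible_def fb)
  also have "\<dots> \<in> sets borel" by measurable
  finally show ?thesis .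
qed

lemma measurable_start [measurable]:
  assumes [measurable]: "g \<in> M \<rightarrow>\<^sub>M borel" "h \<in> M \<rightarrow>\<^sub>M borel_seq"
  shows "(\<lambda>w. start_state D U (g w) (h w)) \<in> M \<rightarrow>\<^sub>M borel"
    "(\<lambda>w. start_dirs D (g w) (h w)) \<in> M \<rightarrow>\<^sub>M borel_seq"
proof -
  have [measurable]: "(\<lambda>w. blinfun_apply (U (fst (g w))) (h w 0)) \<in> borel_measurable M"
    by (intro borel_measurable_blinfun_apply U_borel) measurable
  show "(\<lambda>w. start_state D U (g w) (h w)) \<in> M \<rightarrow>\<^sub>M borel" unfolding start_state_def by measurable
  have m: "(\<lambda>w. h w (Suc i)) \<in> borel_measurable M" for i by measurable
  have "(\<lambda>w i. h w (Suc i)) \<in> M \<rightarrow>\<^sub>M borel_seq"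
    by (intro measurable_PiM_single' m) auto
  then show "(\<lambda>w. start_dirs D (g w) (h w)) \<in> M \<rightarrow>\<^sub>M borel_seq"
    unfolding start_dirs_def by (rule measurable_If[OF assms(2)]) measurable
qed

lemma AE_start_proper:
  assumes z: "z \<in> admissible D R"
  shows "AE u in Q. proper_start D R U z u"
proof (cases "fst z \<in> D")
  case True
  then show ?thesis
    using AE_proper_path[OF in_flight_of_interior[OF open_D bounded_D True z]]
    by (simp add: start_state_def start_dirs_def)
next
  case False
  then have R: "fst z \<in> R" using z by (auto simp: admissible_def first_boundary_point_def split: prod.splits)
  have [measurable]: "(\<lambda>s. blinfun_apply (U (fst z)) s) \<in> borel_measurable borel"
    by (intro borel_measurable_continuous_onI continuous_intros)
  have "AE s in \<rho>. AE u in Q. proper_path D R U (fst z, blinfun_apply (U (fst z)) s) u"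
    using reflect[OF R] by eventually_elim (rule AE_proper_path)
  then have "AE p in \<rho> \<Otimes>\<^sub>M Q. proper_path D R U (fst z, blinfun_apply (U (fst z)) (fst p)) (snd p)"
    by (intro \<rho>Q.AE_pair_measure) auto
  then have "AE p in \<rho> \<Otimes>\<^sub>M Q. proper_start D R U z (case_nat (fst p) (snd p))"
    using False by (simp add: start_state_def start_dirs_def)
  then have "AE u in distr (\<rho> \<Otimes>\<^sub>M Q) Q (\<lambda>(s, \<omega>). case_nat s \<omega>). proper_start D R U z u"
    by (subst AE_distr_iff) (auto simp: split_beta')
  then show ?thesis unfolding PiM_iter .
qed

text \<open>From a boundary point, the first direction almost surely produces a state in
  \<open>good\<close>, where the uniform bound holds; averaging over this direction preserves the
  bound.\<close>

lemma start_char: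
  assumes z: "z \<in> admissible D R"
    and bound: "\<And>z. z \<in> good \<Longrightarrow> cmod ((\<integral>u. iexp (a * accum z u t) \<partial>Q) - l) \<le> e"
  shows "cmod ((\<integral>u. iexp (a * start_accum z u t) \<partial>Q) - l) \<le> e"
proof (cases "fst z \<in> D")
  case True
  then show ?thesis
    using bound[OF in_flight_of_interior[OF open_D bounded_D True z]]
    by (simp add: start_state_def start_dirs_def)
next
  case False
  then have R: "fst z \<in> R" using z by (auto simp: admissible_def first_boundary_point_def split: prod.splits)
  have [measurable]: "(\<lambda>s. blinfun_apply (U (fst z)) s) \<in> borel_measurable borel"
    by (intro borel_measurable_continuous_onI continuous_intros)
  let ?y = "\<lambda>s. (fst z, blinfun_apply (U (fst z)) s)"
  let ?I = "\<lambda>s. \<integral>u. iexp (a * accum (?y s) u t) \<partial>Q"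
  have meas: "(\<lambda>p. iexp (a * accum (?y (fst p)) (snd p) t)) \<in> borel_measurable (\<rho> \<Otimes>\<^sub>M Q)" by measurable
  have I: "?I \<in> borel_measurable \<rho>"
    using meas by (intro P.borel_measurable_lebesgue_integral) (simp add: split_beta')
  have Ib: "cmod (?I s) \<le> 1" for s
    by (rule order_trans[OF integral_norm_bound]) (simp add: P.prob_space)
  have iI: "integrable \<rho> ?I" using I Ib by (intro M.integrable_const_bound[where B = 1]) auto
  have H: "(\<lambda>u. iexp (a * start_accum z u t)) \<in> borel_measurable Q" by measurable
  have "(\<integral>u. iexp (a * start_accum z u t) \<partial>Q)
      = (\<integral>u. iexp (a * start_accum z u t) \<partial>distr (\<rho> \<Otimes>\<^sub>M Q) Q (\<lambda>(s, \<omega>). case_nat s \<omega>))"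
    unfolding PiM_iter ..
  also have "\<dots> = (\<integral>p. iexp (a * accum (?y (fst p)) (snd p) t) \<partial>(\<rho> \<Otimes>\<^sub>M Q))"
    using False by (subst integral_distr[OF _ H]) (auto simp: split_beta' start_state_def start_dirs_def)
  also have "\<dots> = (\<integral>s. ?I s \<partial>\<rho>)"
    using \<rho>Q.integral_fst'[OF \<rho>Q.P.integrable_const_bound[OF _ meas, of 1]] by simp
  finally have eq: "(\<integral>u. iexp (a * start_accum z u t) \<partial>Q) = (\<integral>s. ?I s \<partial>\<rho>)" .
  have "AE s in \<rho>. cmod (?I s - l) \<le> e" using reflect[OF R] by eventually_elim (rule bound)
  then show ?thesis unfolding eq by (rule M.expectation_close[OF iI])
qed

lemma random_start_char:
  assumes \<mu>: "prob_space \<mu>" "sets \<mu> = sets borel" and adm: "AE z in \<mu>. z \<in> admissible D R"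
    and bound: "\<And>z. z \<in> good \<Longrightarrow> cmod ((\<integral>u. iexp (a * accum z u t) \<partial>Q) - l) \<le> e"
  shows "cmod ((\<integral>p. iexp (a * start_accum (fst p) (snd p) t) \<partial>(\<mu> \<Otimes>\<^sub>M Q)) - l) \<le> e"
proof -
  interpret \<mu>: prob_space \<mu> by fact
  interpret \<mu>Q: pair_prob_space \<mu> Q ..
  note [measurable_cong] = \<mu>(2)
  let ?F = "\<lambda>z u. iexp (a * start_accum z u t)"
  let ?I = "\<lambda>z. \<integral>u. ?F z u \<partial>Q"
  have meas: "(\<lambda>p. ?F (fst p) (snd p)) \<in> borel_measurable (\<mu> \<Otimes>\<^sub>M Q)" by measurable
  have I: "?I \<in> borel_measurable \<mu>"
    using meas by (intro P.borel_measurable_lebesgue_integral) (simp add: split_beta')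
  have Ib: "cmod (?I s) \<le> 1" for s
    by (rule order_trans[OF integral_norm_bound]) (simp add: P.prob_space)
  have iI: "integrable \<mu> ?I" using I Ib by (intro \<mu>.integrable_const_bound[where B = 1]) auto
  have "(\<integral>z. ?I z \<partial>\<mu>) = (\<integral>p. ?F (fst p) (snd p) \<partial>(\<mu> \<Otimes>\<^sub>M Q))"
    using \<mu>Q.integral_fst'[OF \<mu>Q.P.integrable_const_bound[OF _ meas, of 1]] by simp
  moreover have "AE z in \<mu>. cmod (?I z - l) \<le> e" using adm by eventually_elim (rule start_char[OF _ bound])
  ultimately show ?thesis using \<mu>.expectation_close[OF iI] by simp
qed

end

section \<open>Laws under completion, continuity points, characteristic functions\<close>

text \<open>A function that agrees almost everywhere with a measurable one is measurable for the
  completion, and completing does not change the law of the measurable one.\<close>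

lemma law_AE_eq:
  fixes Y Y' :: "'w \<Rightarrow> 'b::topological_space"
  assumes Y': "Y' \<in> borel_measurable M" and ae: "AE \<omega> in M. Y \<omega> = Y' \<omega>"
  shows "law M Y = distr M borel Y'"
proof -
  have ae': "AE \<omega> in completion M. Y \<omega> = Y' \<omega>" using ae by (rule AE_completion)
  have Yc': "Y' \<in> borel_measurable (completion M)" using Y' by (rule measurable_completion)
  have Y: "Y \<in> borel_measurable (completion M)"
  proof (rule measurableI)
    fix A :: "'b set" assume A: "A \<in> sets borel"
    show "Y -` A \<inter> space (completion M) \<in> sets (completion M)"
    proof (rule completion.in_sets_AE[OF _ measurable_sets[OF Yc' A]])
      show "AE \<omega> in completion M. \<omega> \<in> Y' -` A \<inter> space (completion M) \<longleftrightarrow> \<omega> \<in> Y -` A \<inter> space (completion M)"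
        using ae' by eventually_elim auto
    qed auto
  qed simp
  have "law M Y = distr (completion M) borel Y'"
    unfolding law_def by (rule distr_cong_AE[OF refl refl ae' Y Yc'])
  then show ?thesis by (simp add: distr_completion[OF Y'])
qed

text \<open>For an arbitrary function, the points of vanishing oscillation relative to
  \<open>F\<close> form a countable intersection of relatively open sets.\<close>

lemma sets_continuity_points:
  fixes h :: "'a::metric_space \<Rightarrow> 'b::metric_space"
  assumes F: "closed F"
  shows "{x \<in> F. continuous (at x within F) h} \<in> sets borel"
proof -
  define V where "V n = \<Union> {W. open W \<and> (\<forall>y\<in>W \<inter> F. \<forall>y'\<in>W \<inter> F. dist (h y) (h y') < 1 / real (Suc n))}" for n
  have V: "open (V n)" for n unfolding V_def by (intro open_Union) auto
  have "{x \<in> F. continuous (at x within F) h} = F \<inter> (\<Inter>n. V n)"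
  proof (intro subset_antisym subsetI IntI INT_I)
    fix x n assume "x \<in> {x \<in> F. continuous (at x within F) h}"
    then have x: "x \<in> F" "continuous (at x within F) h" by auto
    show "x \<in> F" by (rule x)
    define q where "q = 1 / (2 * real (Suc n))"
    have q: "q > 0" "q + q = 1 / real (Suc n)" by (simp_all add: q_def field_simps)
    obtain d where d: "d > 0" "\<And>y. y \<in> F \<Longrightarrow> dist y x < d \<Longrightarrow> dist (h y) (h x) < q"
      using x(2) q(1) unfolding continuous_within_eps_delta by metis
    have "dist (h y) (h y') < 1 / real (Suc n)" if "y \<in> ball x d \<inter> F" "y' \<in> ball x d \<inter> F" for y y'
      using d(2)[of y] d(2)[of y'] that dist_triangle2[of "h y" "h y'" "h x"] q(2)
      by (simp add: dist_commute del: of_nat_Suc)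
    then show "x \<in> V n" unfolding V_def using d(1) by (intro UnionI[of "ball x d"]) auto
  next
    fix x assume x: "x \<in> F \<inter> (\<Inter>n. V n)"
    have "continuous (at x within F) h"
      unfolding continuous_within_eps_delta
    proof (intro allI impI)
      fix e :: real assume "e > 0"
      then obtain n where n: "inverse (real (Suc n)) < e" using reals_Archimedean by blast
      have "x \<in> V n" using x by blast
      then obtain W where W: "W \<in> {W. open W \<and> (\<forall>y\<in>W \<inter> F. \<forall>y'\<in>W \<inter> F. dist (h y) (h y') < 1 / real (Suc n))}" "x \<in> W"
        unfolding V_def by (rule UnionE)
      obtain d where d: "d > 0" "ball x d \<subseteq> W" using W openE by blast
      have "dist (h y) (h x) < e" if "y \<in> F" "dist y x < d" for y
      proof -
        have "y \<in> W" using that d(2) by (auto simp: dist_commute)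
        then have "dist (h y) (h x) < 1 / real (Suc n)" using W x that by auto
        then show ?thesis using n by (simp add: inverse_eq_divide)
      qed
      then show "\<exists>d>0. \<forall>y\<in>F. dist y x < d \<longrightarrow> dist (h y) (h x) < e" using d(1) by blast
    qed
    then show "x \<in> {x \<in> F. continuous (at x within F) h}" using x by simp
  qed
  also have "\<dots> \<in> sets borel" using F V by (intro sets.Int sets.countable_INT'') auto
  finally show ?thesis .
qed

lemma real_distribution_normal_law:
  assumes "v \<ge> 0"
  shows "real_distribution (normal_law v)"
proof (cases "v = 0")
  case True
  then show ?thesis
    by (simp add: normal_law_def real_distribution_def real_distribution_axioms_def prob_space_return)
next
  case False
  then show ?thesis
    using assms prob_space_normal_density[of "sqrt v" 0]
    by (simp add: normal_law_def real_distribution_def real_distribution_axioms_def)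
qed

lemma char_normal_law:
  assumes "v \<ge> 0"
  shows "char (normal_law v) \<theta> = gauss v \<theta>"
proof (cases "v = 0")
  case True
  then show ?thesis by (simp add: normal_law_def char_def integral_return)
next
  case False
  then have v: "v > 0" using assms by simp
  interpret N: prob_space std_normal_distribution by (rule prob_space_normal_density) simp
  have "distributed std_normal_distribution lborel (\<lambda>x. x) (normal_density 0 1)"
    by (simp add: distributed_def distr_id2)
  then have "distributed std_normal_distribution lborel (\<lambda>x. 0 + sqrt v * x) (normal_density (0 + sqrt v * 0) (\<bar>sqrt v\<bar> * 1))"
    using v by (intro N.normal_density_affine) auto
  then have "distr std_normal_distribution lborel (\<lambda>x. sqrt v * x) = normal_law v"
    using v by (simp add: distributed_def normal_law_def)
  then have "char (normal_law v) \<theta> = char (distr std_normal_distribution lborel (\<lambda>x. sqrt v * x)) \<theta>" by simp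
  also have "\<dots> = char std_normal_distribution (\<theta> * sqrt v)"
    unfolding char_def by (subst integral_distr) (auto simp: mult.assoc)
  also have "\<dots> = gauss v \<theta>"
    using v by (simp only: char_std_normal_distribution exp_of_real) (simp add: power_mult_distrib)
  finally show ?thesis .
qed

text \<open>Convergence at infinity may be tested along sequences of times, to each of which the
  continuity theorem of Levy applies.\<close>

lemma converges_in_law_char:
  assumes M: "\<And>t. real_distribution (M t)" and N: "real_distribution N"
    and char: "\<And>\<theta>. ((\<lambda>t. char (M t) \<theta>) \<longlongrightarrow> char N \<theta>) at_top"
  shows "converges_in_law M N"
  unfolding converges_in_law_def
proof (intro allI impI tendsto_at_topI_sequentially)
  fix x and X :: "nat \<Rightarrow> real" assume x: "isCont (cdf N) x" and X: "filterlim X at_top sequentially"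
  have "weak_conv_m (\<lambda>n. M (X n)) N"
    by (rule levy_continuity[OF M N]) (rule filterlim_compose[OF char X])
  then show "(\<lambda>n. cdf (M (X n)) x) \<longlonglongrightarrow> cdf N x"
    using x by (simp add: weak_conv_m_def weak_conv_def)
qed

text \<open>A trajectory evaluates the family of operators at its hitting points only. This permits
  replacing \<open>U\<close> by an extension that is Borel on the whole space.\<close>

lemma billiard_state_cong:
  assumes UV: "\<And>x. x \<in> frontier D \<Longrightarrow> U x = V x"
    and hit: "\<And>n. hit_point D V (first_boundary_point D z) u n \<in> frontier D"
  shows "billiard_state D U z u t = billiard_state D V z u t"
proof -
  let ?y = "first_boundary_point D z"
  have h: "hit_point D U ?y u n = hit_point D V ?y u n" for n
    by (induction n) (simp_all add: UV hit del: hit_point.simps(2), simp add: UV hit)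
  have o: "out_velocity D U ?y u n = out_velocity D V ?y u n" for n
    by (simp add: out_velocity_def h UV hit)
  have "boundary_state D U ?y u s = boundary_state D V ?y u s" for s
    by (simp add: boundary_state_def hit_time_def h o)
  then show ?thesis
    by (cases "fst z \<in> D") (simp_all add: billiard_state_def first_boundary_point_def split_beta')
qed

lemma hit_point_in_frontier:
  assumes R: "R \<subseteq> frontier D" and z: "z \<in> admissible D R"
    and u: "proper_start D R V z u"
  shows "hit_point D V (first_boundary_point D z) u n \<in> frontier D"
proof -
  obtain x v where xv: "z = (x, v)" by (rule prod.exhaust)
  have reg: "leg D V (start_state D V z u) (start_dirs D z u) n \<in> in_flight D R" for n
    using proper_pathD(1)[OF u] by (simp add: regular_path_def)
  have R': "fst (leg D V (start_state D V z u) (start_dirs D z u) (Suc n)) \<in> R" for n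
    using reg[of n] by (auto simp: Let_def in_flight_def)
  show ?thesis
  proof (cases "x \<in> D")
    case True
    then show ?thesis
      using R'[of n] R
      by (auto simp: xv start_state_def start_dirs_def first_boundary_point_def leg_Suc_eq_hit simp del: leg.simps)
  next
    case False
    then have *: "hit_point D V (first_boundary_point D z) u n
        = fst (leg D V (start_state D V z u) (start_dirs D z u) n)" for n
      by (simp add: xv start_state_def start_dirs_def first_boundary_point_def leg_boundary_start)
    show ?thesis
    proof (cases n)
      case 0
      then show ?thesis using z R by (auto simp: admissible_def)
    next
      case (Suc m)
      then show ?thesis using R'[of m] R unfolding * by blast
    qed
  qed
qed

section \<open>The billiard as a flight process\<close>

context billiard
begin

abbreviation "R \<equiv> regular_points D Rt \<gamma> U"

text \<open>\<open>U\<close> is measurable on the frontier only; its extension by zero is Borel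
  everywhere and agrees with \<open>U\<close> wherever a reflection takes place.\<close>

definition U0 :: "'m space \<Rightarrow> 'm space \<Rightarrow>\<^sub>L 'm space" where
  "U0 x = indicator (frontier D) x *\<^sub>R U x"

lemma U0_borel: "U0 \<in> borel_measurable borel"
  using U_measurable unfolding U0_def[abs_def] by (subst (asm) borel_measurable_restrict_space_iff) auto

lemma R_frontier: "R \<subseteq> frontier D"
  using openin_imp_subset[OF smooth_part_open] by (auto simp: regular_points_def)

lemma Rt_borel: "Rt \<in> sets borel"
  using smooth_part_open unfolding openin_open by (auto intro!: sets.Int)

lemma continuity_set_borel: "{x \<in> frontier D. U_continuous_at D U x} \<in> sets borel"
  unfolding U_continuous_at_def by (intro sets_continuity_points) simp

lemma R_borel: "R \<in> sets borel"
proof -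
  have "{x \<in> Rt. U_continuous_at D U x} = Rt \<inter> {x \<in> frontier D. U_continuous_at D U x}"
    using openin_imp_subset[OF smooth_part_open] by auto
  then show ?thesis using Rt_borel continuity_set_borel by (simp add: regular_points_def)
qed

lemma sets_reflection_measure: "sets (reflection_measure \<gamma>) = sets borel"
  by (simp add: reflection_measure_def sphere_measure_def)

lemma half_sphere_borel: "half_sphere e \<in> sets (borel :: 'm space measure)"
proof -
  have "half_sphere e = unit_sphere \<inter> {w. e \<bullet> w > 0}" by (auto simp: half_sphere_def)
  then show ?thesis by (auto intro!: sets.Int borel_open open_halfspace_gt)
qed

lemma AE_reflection_measureI:
  assumes "AE u in sphere_measure. u \<in> half_sphere e1 \<longrightarrow> Pr u"
  shows "AE u in reflection_measure \<gamma>. Pr u"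
proof -
  have "(\<lambda>u. indicator (half_sphere e1) u *\<^sub>R \<gamma> u) \<in> borel_measurable borel"
    using density_measurable by (subst (asm) borel_measurable_restrict_space_iff) (auto simp: half_sphere_borel)
  then have "(\<lambda>u. ennreal (indicator (half_sphere e1) u * \<gamma> u)) \<in> borel_measurable borel" by simp
  then have "(\<lambda>u. ennreal (indicator (half_sphere e1) u * \<gamma> u)) \<in> borel_measurable sphere_measure"
    by (simp add: measurable_def sphere_measure_def space_scale_measure)
  then show ?thesis
    unfolding reflection_measure_def using assms
    by (subst AE_density) (auto elim!: eventually_mono simp: indicator_def split: if_splits)
qed

text \<open>The exceptional directions lie, after the orthogonal map, in the cone over
  \<open>N\<close> with apex \<open>y\<close>, which is negligible. Positivity of the exit time is
  what places the exit point on the open ray.\<close>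

lemma AE_avoids_boundary_null:
  fixes T :: "'m space \<Rightarrow>\<^sub>L 'm space"
  assumes T: "orthogonal_transformation (blinfun_apply T)" and N: "boundary_null N" "N \<in> sets borel"
  shows "AE u in sphere_measure. 0 < exit_time D y (blinfun_apply T u) \<longrightarrow> exit_point D y (blinfun_apply T u) \<notin> N"
    (is "AE u in _. ?Pr u")
proof (rule AE_sphere_measureI)
  have [measurable]: "blinfun_apply T \<in> borel_measurable borel"
    by (intro borel_measurable_continuous_onI continuous_intros)
  note [measurable] = N(2)
  show "Measurable.pred borel ?Pr" by measurable
  have "{p. p \<noteq> 0 \<and> \<not> ?Pr (sgn p)}
      \<subseteq> blinfun_apply T -` {q. \<exists>s>0. y + s *\<^sub>R q \<in> N}"
  proof
    fix p assume p: "p \<in> {p. p \<noteq> 0 \<and> \<not> ?Pr (sgn p)}"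
    let ?s = "exit_time D y (blinfun_apply T (sgn p)) / norm p"
    have "y + ?s *\<^sub>R blinfun_apply T p \<in> N"
      using p by (simp add: exit_point_def sgn_div_norm blinfun.scaleR_right divide_inverse mult.commute)
    moreover have "?s > 0" using p by simp
    ultimately show "p \<in> blinfun_apply T -` {q. \<exists>s>0. y + s *\<^sub>R q \<in> N}" by auto
  qed
  moreover have "negligible (blinfun_apply T -` {q. \<exists>s>0. y + s *\<^sub>R q \<in> N})"
  proof (rule negligible_vimage_orthogonal[OF T])
    show "negligible {q. \<exists>s>0. y + s *\<^sub>R q \<in> N}" by (rule negligible_cone_over_boundary_null[OF N(1)])
  qed
  ultimately show "negligible {p. p \<noteq> 0 \<and> \<not> ?Pr (sgn p)}"
    by (rule negligible_subset[rotated])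
qed

text \<open>The angle with the normal survives the orthogonal map, so the ray enters
  \<open>D\<close>; its exit point avoids both the nonsmooth part of the boundary and, without
  rotational symmetry, the discontinuities of \<open>U\<close>.\<close>

lemma AE_reflect_in_flight:
  assumes bounded: "bounded D" and y: "y \<in> R"
  shows "AE u in reflection_measure \<gamma>. (y, blinfun_apply (U y) u) \<in> in_flight D R"
proof (rule AE_reflection_measureI)
  have yF: "y \<in> frontier D" and yRt: "y \<in> Rt" using y R_frontier by (auto simp: regular_points_def split: if_splits)
  note T = U_orthogonal[OF yF]
  have 1: "AE u in sphere_measure. 0 < exit_time D y (blinfun_apply (U y) u) \<longrightarrow> exit_point D y (blinfun_apply (U y) u) \<notin> frontier D - Rt"
    using Rt_borel by (intro AE_avoids_boundary_null T smooth_part_full) auto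
  have 2: "AE u in sphere_measure. \<not> rotation_symmetric \<gamma> \<longrightarrow> 0 < exit_time D y (blinfun_apply (U y) u) \<longrightarrow>
      exit_point D y (blinfun_apply (U y) u) \<notin> {x \<in> frontier D. \<not> U_continuous_at D U x}"
  proof (cases "rotation_symmetric \<gamma>")
    case False
    have "{x \<in> frontier D. \<not> U_continuous_at D U x} = frontier D - {x \<in> frontier D. U_continuous_at D U x}" by auto
    then have "{x \<in> frontier D. \<not> U_continuous_at D U x} \<in> sets borel" using continuity_set_borel by auto
    then show ?thesis using AE_avoids_boundary_null[OF T U_continuous[OF False], of y] by simp
  qed simp
  show "AE u in sphere_measure. u \<in> half_sphere e1 \<longrightarrow> (y, blinfun_apply (U y) u) \<in> in_flight D R"
    using 1 2
  proof eventually_elim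
    case (elim u)
    show ?case
    proof
      assume u: "u \<in> half_sphere e1"
      let ?v = "blinfun_apply (U y) u"
      have v: "norm ?v = 1" using u orthogonal_transformation_norm[OF T, of u] by (simp add: half_sphere_def)
      have "?v \<bullet> blinfun_apply (U y) e1 = u \<bullet> e1" using T unfolding orthogonal_transformation_def by blast
      then have "?v \<bullet> blinfun_apply (U y) e1 > 0" using u by (simp add: half_sphere_def inner_commute)
      then obtain d where d: "d > 0" "\<And>s. s \<in> {0<..<d} \<Longrightarrow> y + s *\<^sub>R ?v \<in> D"
        using inward_ray_enters_domain[OF open_domain U_normal[OF yRt] v] by blast
      have ex: "exit_time D y ?v \<ge> d" "exit_point D y ?v \<in> frontier D"
          "exit_point D y ?v \<in> R \<Longrightarrow> (y, ?v) \<in> in_flight D R"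
        using exit_of_entering_ray[OF open_domain bounded v d] by blast+
      have "exit_time D y ?v > 0" using ex(1) d(1) by linarith
      then have "exit_point D y ?v \<in> R"
        using elim ex(2) by (auto simp: regular_points_def)
      then show "(y, ?v) \<in> in_flight D R" by (rule ex(3))
    qed
  qed
qed

lemma flight_process_billiard:
  assumes "bounded D"
  shows "flight_process D R U0 (reflection_measure \<gamma>)"
proof (rule flight_process.intro[OF open_domain assms R_borel R_frontier U0_borel density_prob sets_reflection_measure])
  fix y assume y: "y \<in> R"
  then have "U0 y = U y" using R_frontier by (auto simp: U0_def)
  then show "AE u in reflection_measure \<gamma>. (y, blinfun_apply (U0 y) u) \<in> in_flight D R"
    using AE_reflect_in_flight[OF assms y] by simp
qed

abbreviation direction_seq :: "(nat \<Rightarrow> 'm space) measure" where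
  "direction_seq \<equiv> PiM UNIV (\<lambda>_. reflection_measure \<gamma>)"

text \<open>A deterministic start realized on the type of sample points for which the mixing
  hypothesis is formulated.\<close>

definition fixed_start :: "'m space \<times> 'm space \<Rightarrow> (('m space \<times> 'm space) \<times> (nat \<Rightarrow> 'm space)) measure" where
  "fixed_start z = distr direction_seq (borel \<Otimes>\<^sub>M borel_seq) (\<lambda>u. (z, u))"

lemma stochastic_billiard_fixed_start:
  assumes "bounded D" and z: "z \<in> in_flight D R" "fst z \<in> D"
  shows "stochastic_billiard D Rt \<gamma> U (fixed_start z) (\<lambda>_. z) (\<lambda>n \<omega>. snd \<omega> n)"
proof -
  define P where P_def: "P = fixed_start z"
  interpret flight_process D R U0 "reflection_measure \<gamma>" by (rule flight_process_billiard) fact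
  have m[measurable]: "(\<lambda>u. (z, u)) \<in> Q \<rightarrow>\<^sub>M borel \<Otimes>\<^sub>M borel_seq" by measurable
  interpret Pz: prob_space P unfolding P_def fixed_start_def by (rule P.prob_space_distr[OF m])
  have setsP[measurable_cong]: "sets P = sets (borel \<Otimes>\<^sub>M borel_seq)" by (simp add: P_def fixed_start_def)
  have "distr P borel_seq snd = distr Q borel_seq (\<lambda>u. u)"
    unfolding P_def fixed_start_def by (subst distr_distr) (auto simp: comp_def)
  also have "\<dots> = Q" using distr_cong[OF refl sets_Q[symmetric], of Q "\<lambda>u. u" "\<lambda>u. u"] by simp
  finally have snd: "distr P borel_seq snd = Q" .
  have comp: "distr P borel (\<lambda>\<omega>. snd \<omega> n) = reflection_measure \<gamma>" for n
  proof -
    have "distr P borel (\<lambda>\<omega>. snd \<omega> n) = distr (distr P borel_seq snd) borel (\<lambda>u. u n)"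
      by (subst distr_distr) (auto simp: comp_def)
    also have "\<dots> = distr Q (reflection_measure \<gamma>) (\<lambda>u. u n)"
      unfolding snd by (rule distr_cong) (simp_all add: sets_reflection_measure)
    also have "\<dots> = reflection_measure \<gamma>" by (intro distr_PiM_component prob_\<rho>) simp
    finally show ?thesis .
  qed
  have "Pz.indep_vars (\<lambda>_. borel) (\<lambda>n \<omega>. snd \<omega> n) UNIV"
    by (subst Pz.indep_vars_iff_distr_eq_PiM) (simp_all add: comp restrict_UNIV snd)
  moreover have "Pz.indep_set (sets (vimage_algebra (space P) (\<lambda>_. z) borel))
       (sets (vimage_algebra (space P) (\<lambda>\<omega> n. snd \<omega> n) borel_seq))" (is "Pz.indep_set ?A ?B")
    unfolding Pz.indep_sets2_eq
  proof (intro conjI ballI)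
    \<comment> \<open>A constant initial condition generates the trivial sigma-algebra, which is
      independent of every other.\<close>
    have A: "a = {} \<or> a = space P" if a: "a \<in> ?A" for a
    proof -
      obtain A where "a = (\<lambda>_. z) -` A \<inter> space P" using a by (subst (asm) sets_vimage_algebra2) auto
      then show ?thesis by (cases "z \<in> A") simp_all
    qed
    then show "?A \<subseteq> Pz.events" by auto
    show B: "?B \<subseteq> Pz.events"
      by (subst sets_vimage_algebra2) (auto simp: space_PiM intro!: measurable_sets[where A = borel_seq])
    fix a b assume ab: "a \<in> ?A" "b \<in> ?B"
    then have "b \<subseteq> space P" using B sets.sets_into_space by blast
    then show "Pz.prob (a \<inter> b) = Pz.prob a * Pz.prob b"
      using A[OF ab(1)] by (auto simp: Int_absorb1 Pz.prob_space)
  qed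
  moreover have "z \<in> D \<times> unit_sphere" "first_boundary_point D z \<in> R"
    using z by (auto simp: in_flight_def first_boundary_point_def)
  ultimately show ?thesis
    unfolding stochastic_billiard_def P_def[symmetric] using comp Pz.prob_space_axioms by simp
qed

text \<open>Works with almost sure regularity alone, because it translates the mixing hypothesis to
  flights and properness of paths is drawn from that translation.\<close>

lemma law_fixed_start:
  assumes bounded: "bounded D" and z: "z \<in> in_flight D R" "fst z \<in> D" and t: "t \<ge> 0"
  shows "law (fixed_start z) (billiard_process D U (\<lambda>_. z) (\<lambda>n \<omega>. snd \<omega> n) t)
    = distr direction_seq borel (\<lambda>u. flight D U0 z u t)"
proof -
  define P where P_def: "P = fixed_start z"
  interpret flight_process D R U0 "reflection_measure \<gamma>" by (rule flight_process_billiard) fact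
  have m[measurable]: "(\<lambda>u. (z, u)) \<in> Q \<rightarrow>\<^sub>M borel \<Otimes>\<^sub>M borel_seq" by measurable
  have setsP[measurable_cong]: "sets P = sets (borel \<Otimes>\<^sub>M borel_seq)" by (simp add: P_def fixed_start_def)
  obtain x v where xv: "z = (x, v)" by (rule prod.exhaust)
  have eq: "billiard_state D U z u t = flight D U0 z u t" if u: "regular_path D R U0 z u" for u
  proof -
    have hit: "hit_point D U0 (first_boundary_point D z) u n \<in> frontier D" for n
    proof -
      have "leg D U0 z u n \<in> in_flight D R" using u by (simp add: regular_path_def)
      then have "fst (leg D U0 z u (Suc n)) \<in> R" by (auto simp: Let_def in_flight_def)
      then show ?thesis
        using z(2) R_frontier by (auto simp: xv first_boundary_point_def leg_Suc_eq_hit simp del: leg.simps)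
    qed
    have "billiard_state D U z u t = billiard_state D U0 z u t"
      by (rule billiard_state_cong[OF _ hit]) (simp add: U0_def)
    also have "\<dots> = flight D U0 z u t"
      using billiard_state_interior_start[of x D R U0 v u t] u z(2) t by (simp add: xv)
    finally show ?thesis .
  qed
  have "AE \<omega> in P. regular_path D R U0 z (snd \<omega>)"
    unfolding P_def fixed_start_def using AE_regular_path[OF z(1)] by (subst AE_distr_iff) auto
  then have ae: "AE \<omega> in P. billiard_process D U (\<lambda>_. z) (\<lambda>n \<omega>. snd \<omega> n) t \<omega> = flight D U0 z (snd \<omega>) t"
    by eventually_elim (simp add: billiard_process_def eq)
  have "law P (billiard_process D U (\<lambda>_. z) (\<lambda>n \<omega>. snd \<omega> n) t) = distr P borel (\<lambda>\<omega>. flight D U0 z (snd \<omega>) t)"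
    by (rule law_AE_eq[OF _ ae]) measurable
  also have "\<dots> = distr Q borel (\<lambda>u. flight D U0 z u t)"
    unfolding P_def fixed_start_def by (subst distr_distr) (auto simp: comp_def)
  finally show ?thesis unfolding P_def .
qed

end

text \<open>Moves a billiard from its own sample space to the product of the initial law and the law
  of the directions, where integrals can be taken one factor after the other.\<close>

lemma (in prob_space) joint_law_of_indep_sequence:
  assumes X: "X \<in> borel_measurable M" and \<eta>: "indep_vars (\<lambda>_. borel) \<eta> (UNIV :: nat set)"
    and \<rho>: "\<And>n. distr M borel (\<eta> n) = \<rho>"
    and ind: "indep_set (sets (vimage_algebra (space M) X borel))
       (sets (vimage_algebra (space M) (\<lambda>\<omega> n. \<eta> n \<omega>) borel_seq))"
  shows "(\<lambda>\<omega>. (X \<omega>, \<lambda>n. \<eta> n \<omega>)) \<in> M \<rightarrow>\<^sub>M borel \<Otimes>\<^sub>M borel_seq"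
    "distr M (borel \<Otimes>\<^sub>M borel_seq) (\<lambda>\<omega>. (X \<omega>, \<lambda>n. \<eta> n \<omega>)) = distr M borel X \<Otimes>\<^sub>M PiM UNIV (\<lambda>_. \<rho>)"
proof -
  have \<eta>m: "\<eta> n \<in> borel_measurable M" for n using \<eta> by (simp add: indep_vars_def)
  have W: "(\<lambda>\<omega> n. \<eta> n \<omega>) \<in> M \<rightarrow>\<^sub>M borel_seq"
    by (intro measurable_PiM_single' \<eta>m) auto
  show J: "(\<lambda>\<omega>. (X \<omega>, \<lambda>n. \<eta> n \<omega>)) \<in> M \<rightarrow>\<^sub>M borel \<Otimes>\<^sub>M borel_seq"
    using X W by (rule measurable_Pair)
  have WQ: "distr M borel_seq (\<lambda>\<omega> n. \<eta> n \<omega>) = PiM UNIV (\<lambda>_. \<rho>)"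
    using \<eta> \<eta>m by (subst (asm) indep_vars_iff_distr_eq_PiM) (simp_all add: \<rho> restrict_UNIV)
  let ?J = "\<lambda>\<omega>. (X \<omega>, \<lambda>n. \<eta> n \<omega>)" and ?W = "\<lambda>\<omega> n. \<eta> n \<omega>"
  interpret X: prob_space "distr M borel X" using X by (rule prob_space_distr)
  interpret W: prob_space "distr M borel_seq ?W" using W by (rule prob_space_distr)
  have "distr M borel X \<Otimes>\<^sub>M distr M borel_seq ?W = distr M (borel \<Otimes>\<^sub>M borel_seq) ?J"
  proof (rule pair_measure_eqI)
    fix A B assume "A \<in> sets (distr M borel X)" "B \<in> sets (distr M borel_seq ?W)"
    then have A: "A \<in> sets borel" and B: "B \<in> sets borel_seq" by simp_all
    have "X -` A \<inter> space M \<in> sets (vimage_algebra (space M) X borel)"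
      "?W -` B \<inter> space M \<in> sets (vimage_algebra (space M) ?W borel_seq)"
      using A B by (auto intro: in_vimage_algebra)
    then have "prob ((X -` A \<inter> space M) \<inter> (?W -` B \<inter> space M)) = prob (X -` A \<inter> space M) * prob (?W -` B \<inter> space M)"
      using ind unfolding indep_sets2_eq by blast
    also have "(X -` A \<inter> space M) \<inter> (?W -` B \<inter> space M) = ?J -` (A \<times> B) \<inter> space M" by auto
    finally show "emeasure (distr M borel X) A * emeasure (distr M borel_seq ?W) B
        = emeasure (distr M (borel \<Otimes>\<^sub>M borel_seq) ?J) (A \<times> B)"
      using A B X W J by (simp add: emeasure_distr emeasure_eq_measure ennreal_mult)
  qed (simp_all add: X.sigma_finite_measure_axioms W.sigma_finite_measure_axioms cong: sets_pair_measure_cong)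
  then show "distr M (borel \<Otimes>\<^sub>M borel_seq) ?J = distr M borel X \<Otimes>\<^sub>M PiM UNIV (\<lambda>_. \<rho>)"
    by (simp add: WQ)
qed

text \<open>The variance comes from the uniform limit theorem for deterministic states, and is
  thereby common to all sample spaces and initial laws.\<close>

theorem theorem2p3:
  fixes D Rt :: "'m::{finite,linorder} space set"
    and \<gamma> :: "'m space \<Rightarrow> real"
    and U :: "'m space \<Rightarrow> 'm space \<Rightarrow>\<^sub>L 'm space"
    and chi :: "('m space \<times> 'm space) measure"
    and f :: "'m space \<times> 'm space \<Rightarrow> real"
  assumes "billiard D Rt \<gamma> U"
    and "bounded D"
    and "invariant_measure D Rt \<gamma> U chi"
    and "f \<in> borel_measurable (restrict_space borel (closure D \<times> unit_sphere))"
    and "bounded (f ` (closure D \<times> unit_sphere))"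
    and "(LINT z : closure D \<times> unit_sphere | chi. f z) = 0"
  shows "\<exists>\<sigma>2\<ge>0. \<forall>(P :: 'w measure) Z0 \<eta>.
           stochastic_billiard D Rt \<gamma> U P Z0 \<eta> \<longrightarrow>
           converges_in_law
             (\<lambda>t. law P (\<lambda>\<omega>. t powr (- 1 / 2) *
                           (LINT s : {0..t} | lborel. f (billiard_process D U Z0 \<eta> s \<omega>))))
             (normal_law \<sigma>2)"
proof -
  interpret billiard D Rt \<gamma> U by fact
  let ?S = "closure D \<times> (unit_sphere :: 'm space set)"
  \<comment> \<open>Extension by zero yields a Borel function on the whole space; almost surely the
    state never leaves \<open>?S\<close>, so the time integrals are those of
    \<open>f\<close>.\<close>
  define g where "g z = indicator ?S z * f z" for z
  have S: "?S \<in> sets borel" by (intro borel_closed closed_Times) auto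
  have g: "g \<in> borel_measurable borel"
    using assms(4) S unfolding g_def[abs_def] by (subst (asm) borel_measurable_restrict_space_iff) auto
  obtain B where B: "B > 0" "\<And>z. z \<in> ?S \<Longrightarrow> \<bar>f z\<bar> \<le> B"
    using assms(5) unfolding bounded_pos by auto
  have gB: "\<bar>g z\<bar> \<le> B" for z using B by (auto simp: g_def indicator_def)
  have g0: "(\<integral>z. g z \<partial>chi) = 0"
    using assms(6) by (simp add: set_lebesgue_integral_def g_def[abs_def])
  obtain C c where chi: "prob_space chi" "sets chi = sets borel" "emeasure chi (D \<times> unit_sphere) = 1"
    and Cc: "C > 0" "c > 0"
    and TV: "\<And>(P :: (('m space \<times> 'm space) \<times> (nat \<Rightarrow> 'm space)) measure) Z0 \<eta> t.
          stochastic_billiard D Rt \<gamma> U P Z0 \<eta> \<Longrightarrow> t \<ge> 0 \<Longrightarrow>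
          total_variation (law P (billiard_process D U Z0 \<eta> t)) chi \<le> C * exp (- c * t)"
    using assms(3) unfolding invariant_measure_def by blast
  interpret flight_process D R U0 "reflection_measure \<gamma>"
    by (rule flight_process_billiard[OF assms(2)])
  interpret additive_functional D R U0 "reflection_measure \<gamma>" chi C c g B
  proof (intro additive_functional.intro ergodic_flight.intro ergodic_flight_axioms.intro
      additive_functional_axioms.intro flight_process_axioms chi Cc g gB g0)
    fix z and t :: real assume z: "z \<in> in_flight D R" "fst z \<in> D" "t \<ge> 0"
    show "total_variation (distr Q borel (\<lambda>u. flight D U0 z u t)) chi \<le> C * exp (- c * t)"
      using TV[OF stochastic_billiard_fixed_start[OF assms(2) z(1,2)] z(3)]
      unfolding law_fixed_start[OF assms(2) z] .
  qed
  obtain v where v: "\<And>\<theta>. \<exists>e. (e \<longlongrightarrow> 0) at_top \<and> (\<forall>\<^sub>F t in at_top. \<forall>z\<in>good.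
     cmod ((\<integral>u. iexp (\<theta> / sqrt t * accum z u t) \<partial>Q) - gauss v \<theta>) \<le> e t)"
    using uniform_central_limit by blast
  \<comment> \<open>At frequency 1 the limit \<open>gauss v 1\<close> of numbers of modulus at most
    1 has modulus \<open>exp (- v / 2)\<close>, which forces the sign of \<open>v\<close>.\<close>
  have v0: "v \<ge> 0" if z: "z \<in> good" for z
  proof -
    obtain e where e: "(e \<longlongrightarrow> 0) at_top" "\<forall>\<^sub>F t in at_top. \<forall>z\<in>good.
       cmod ((\<integral>u. iexp (1 / sqrt t * accum z u t) \<partial>Q) - gauss v 1) \<le> e t"
      using v[of 1] by blast
    have "\<forall>\<^sub>F t in at_top. exp (- v / 2) - 1 \<le> e t"
      using e(2)
    proof eventually_elim
      case (elim t)
      let ?I = "\<integral>u. iexp (1 / sqrt t * accum z u t) \<partial>Q"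
      have "cmod ?I \<le> 1" by (rule order_trans[OF integral_norm_bound]) (simp add: P.prob_space)
      moreover have "cmod (gauss v 1) = exp (- v / 2)" by (simp add: norm_exp_eq_Re)
      moreover have "cmod (?I - gauss v 1) \<le> e t" using elim z by blast
      moreover have "cmod (gauss v 1) - cmod ?I \<le> cmod (?I - gauss v 1)"
        by (subst norm_minus_commute) (rule norm_triangle_ineq2)
      ultimately show ?case by linarith
    qed
    then have "exp (- v / 2) - 1 \<le> 0"
      using e(1) by (intro tendsto_lowerbound) auto
    then show ?thesis by simp
  qed
  \<comment> \<open>The variance must be named before any billiard is given, but its sign is known
    only once \<open>good\<close> is nonempty; hence \<open>max v 0\<close>. A billiard, when there
    is one, supplies a state in \<open>good\<close>.\<close>
  show ?thesis
  proof (intro exI[of _ "max v 0"] conjI allI impI)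
    fix P :: "'w measure" and Z0 \<eta>
    assume sb: "stochastic_billiard D Rt \<gamma> U P Z0 \<eta>"
    then interpret Pw: prob_space P by (simp add: stochastic_billiard_def)
    have Z0: "Z0 \<in> borel_measurable P"
      and adm: "AE \<omega> in P. Z0 \<omega> \<in> admissible D R"
      using sb by (auto simp: stochastic_billiard_def admissible_def)
    have indep: "Pw.indep_vars (\<lambda>_. borel) \<eta> UNIV" "\<And>n. distr P borel (\<eta> n) = reflection_measure \<gamma>"
      "Pw.indep_set (sets (vimage_algebra (space P) Z0 borel))
         (sets (vimage_algebra (space P) (\<lambda>\<omega> n. \<eta> n \<omega>) borel_seq))"
      using sb unfolding stochastic_billiard_def by blast+
    define \<mu> where "\<mu> = distr P borel Z0"
    define J where "J \<omega> = (Z0 \<omega>, \<lambda>n. \<eta> n \<omega>)" for \<omega>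
    have J: "J \<in> P \<rightarrow>\<^sub>M borel \<Otimes>\<^sub>M borel_seq"
      and JQ: "distr P (borel \<Otimes>\<^sub>M borel_seq) J = \<mu> \<Otimes>\<^sub>M Q"
      unfolding J_def[abs_def] \<mu>_def
      by (rule Pw.joint_law_of_indep_sequence[OF Z0 indep])+
    have \<mu>: "prob_space \<mu>" "sets \<mu> = sets borel" unfolding \<mu>_def using Z0 by (auto intro: Pw.prob_space_distr)
    interpret \<mu>: prob_space \<mu> by fact
    interpret \<mu>Q: pair_prob_space \<mu> Q ..
    note [measurable_cong] = \<mu>(2)
    have adm\<mu>: "AE z in \<mu>. z \<in> admissible D R"
      unfolding \<mu>_def using adm by (subst AE_distr_iff[OF Z0]) auto
    have "AE p in \<mu> \<Otimes>\<^sub>M Q. fst p \<in> admissible D R \<and>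
        proper_start D R U0 (fst p) (snd p)"
    proof (rule \<mu>Q.AE_pair_measure)
      show "AE z in \<mu>. AE u in Q. fst (z, u) \<in> admissible D R \<and>
          proper_start D R U0 (fst (z, u)) (snd (z, u))"
        using adm\<mu> by eventually_elim (use AE_start_proper in auto)
    qed measurable
    then have proper: "AE \<omega> in P. fst (J \<omega>) \<in> admissible D R \<and>
        proper_start D R U0 (fst (J \<omega>)) (snd (J \<omega>))"
      unfolding JQ[symmetric] by (rule AE_distrD[OF J])
    define A where "A t p = start_accum (fst p) (snd p) t" for t p
    have A[measurable]: "A t \<in> borel_measurable (borel \<Otimes>\<^sub>M borel_seq)" for t
      unfolding A_def[abs_def] by measurable
    have AJ: "(\<lambda>\<omega>. t powr (- 1 / 2) * A t (J \<omega>)) \<in> borel_measurable P" for t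
      using measurable_compose[OF J A[of t]] by simp
    have law: "law P (\<lambda>\<omega>. t powr (- 1 / 2) * (LINT s : {0..t} | lborel. f (billiard_process D U Z0 \<eta> s \<omega>)))
        = distr P borel (\<lambda>\<omega>. t powr (- 1 / 2) * A t (J \<omega>))" for t
    proof (rule law_AE_eq[OF AJ])
      show "AE \<omega> in P. t powr (- 1 / 2) * (LINT s : {0..t} | lborel. f (billiard_process D U Z0 \<eta> s \<omega>))
          = t powr (- 1 / 2) * A t (J \<omega>)"
        using proper
      proof eventually_elim
        case (elim \<omega>)
        let ?z = "Z0 \<omega>" and ?u = "\<lambda>n. \<eta> n \<omega>"
        have pr: "proper_start D R U0 ?z ?u" and ad: "?z \<in> admissible D R"
          using elim by (simp_all add: J_def)
        have "f (billiard_process D U Z0 \<eta> s \<omega>) = g (flight D U0 (start_state D U0 ?z ?u) (start_dirs D ?z ?u) s)"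
          if s: "s \<ge> 0" for s
        proof -
          have "billiard_process D U Z0 \<eta> s \<omega> = billiard_state D U0 ?z ?u s"
            unfolding billiard_process_def
            by (rule billiard_state_cong[OF _ hit_point_in_frontier[OF R_frontier ad pr]]) (simp add: U0_def)
          also have "\<dots> = flight D U0 (start_state D U0 ?z ?u) (start_dirs D ?z ?u) s"
            by (rule billiard_state_start[OF pr s])
          finally show ?thesis
            using flight_domain[OF open_domain R_frontier pr s] by (simp add: g_def)
        qed
        then have "(LINT s : {0..t} | lborel. f (billiard_process D U Z0 \<eta> s \<omega>)) = A t (J \<omega>)"
          unfolding A_def accum_def J_def by (intro set_lebesgue_integral_cong) auto
        then show ?case by simp
      qed
    qed
    have v_nonneg: "v \<ge> 0"
    proof -
      have "\<exists>\<omega>. proper_start D R U0 (fst (J \<omega>)) (snd (J \<omega>))"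
        using Pw.AE_contr[OF proper] by auto
      then obtain z u where "proper_start D R U0 z u" by blast
      then have "leg D U0 (start_state D U0 z u) (start_dirs D z u) 0 \<in> good"
        using proper_pathD(1) unfolding regular_path_def by blast
      then show ?thesis using v0 by simp
    qed
    then have v_pos: "max v 0 = v" by simp
    show "converges_in_law
             (\<lambda>t. law P (\<lambda>\<omega>. t powr (- 1 / 2) * (LINT s : {0..t} | lborel. f (billiard_process D U Z0 \<eta> s \<omega>))))
             (normal_law (max v 0))"
      unfolding law
    proof (rule converges_in_law_char)
      show "real_distribution (distr P borel (\<lambda>\<omega>. t powr (- 1 / 2) * A t (J \<omega>)))" for t
        using AJ by (rule Pw.real_distribution_distr)
      show "real_distribution (normal_law (max v 0))" by (rule real_distribution_normal_law) simp
      fix \<theta>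
      obtain e where e: "(e \<longlongrightarrow> 0) at_top" "\<forall>\<^sub>F t in at_top. \<forall>z\<in>good.
         cmod ((\<integral>u. iexp (\<theta> / sqrt t * accum z u t) \<partial>Q) - gauss v \<theta>) \<le> e t"
        using v[of \<theta>] by blast
      have "\<forall>\<^sub>F t in at_top. cmod (char (distr P borel (\<lambda>\<omega>. t powr (- 1 / 2) * A t (J \<omega>))) \<theta> - char (normal_law (max v 0)) \<theta>) \<le> e t"
        using e(2) eventually_gt_at_top[of 0]
      proof eventually_elim
        case (elim t)
        have "char (distr P borel (\<lambda>\<omega>. t powr (- 1 / 2) * A t (J \<omega>))) \<theta> = (\<integral>\<omega>. iexp (\<theta> / sqrt t * A t (J \<omega>)) \<partial>P)"
          unfolding char_def using elim(2)
          by (subst integral_distr[OF AJ]) (auto simp: powr_minus powr_half_sqrt field_simps)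
        also have "\<dots> = (\<integral>p. iexp (\<theta> / sqrt t * A t p) \<partial>(\<mu> \<Otimes>\<^sub>M Q))"
          unfolding JQ[symmetric] by (subst integral_distr[OF J]) auto
        finally have "char (distr P borel (\<lambda>\<omega>. t powr (- 1 / 2) * A t (J \<omega>))) \<theta> - char (normal_law (max v 0)) \<theta>
            = (\<integral>p. iexp (\<theta> / sqrt t * A t p) \<partial>(\<mu> \<Otimes>\<^sub>M Q)) - gauss v \<theta>"
          by (simp only: v_pos char_normal_law[OF v_nonneg])
        also have "cmod \<dots> \<le> e t"
          unfolding A_def using elim(1) by (intro random_start_char \<mu> adm\<mu>) auto
        finally show ?case .
      qed
      then have "((\<lambda>t. char (distr P borel (\<lambda>\<omega>. t powr (- 1 / 2) * A t (J \<omega>))) \<theta> - char (normal_law (max v 0)) \<theta>) \<longlongrightarrow> 0) at_top"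
        by (rule Lim_null_comparison[OF _ e(1)])
      then show "((\<lambda>t. char (distr P borel (\<lambda>\<omega>. t powr (- 1 / 2) * A t (J \<omega>))) \<theta>) \<longlongrightarrow> char (normal_law (max v 0)) \<theta>) at_top"
        by (rule LIM_zero_cancel)
    qed
  qed simp
qed

end
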